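(* Let $r\ge 2$ be an integer and let $G$ be a finitely generated parafree group in the same nilpotent genus as a free group of rank $r$. Then the reduced $C^*$-algebra of $G$ is simple, and every generating set for $G$ contains an $r$-element subset that generates a free subgroup of rank $r$.
   Context: The lower central series of a group $G$ is defined by $G_1=G$ and $G_{n+1}=\langle [x,y] : x\in G_n,\ y\in G\rangle$. A group $G$ is residually nilpotent if $\bigcap_n G_n=1$. Two residually nilpotent groups $G$ and $\Lambda$ have the same nilpotent genus if $G/G_c\cong\Lambda/\Lambda_c$ for all $c\ge 1$. A group is parafree if it is residually nilpotent and has the same nilpotent genus as a free group. The reduced $C^*$-algebra $C^*_\lambda(G)$ is the norm closure of the image of the complex group algebra $\mathbb{C}[G]$ under the left-regular representation $\lambda_G:\mathbb{C}[G]\to\mathcal{L}(\ell^2(G))$, $(\lambda_G(\gamma)\xi)(x)=\xi(\gamma^{-1}x)$ for $\gamma,x\in G$, $\xi\in\ell^2(G)$. It is simple if it is simple as a complex algebra, i.e. has no proper non-zero two-sided ideals. *)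

theory Defs
  imports
    "HOL-Analysis.Analysis"
    "HOL-Algebra.Algebra"
    "HOL-Library.Poly_Mapping"
begin

section \<open>Free groups\<close>

text \<open>
  The letter \<open>(x, True)\<close> stands for the generator \<open>x\<close> and \<open>(x, False)\<close> for its inverse. The
  free group on \<open>B\<close> consists of the reduced words over \<open>B\<close>; the product of two words is the
  reduction of their concatenation.
\<close>

type_synonym 'x letter = "'x \<times> bool"

definition inv_letter :: "'x letter \<Rightarrow> 'x letter" where
  "inv_letter a = (fst a, \<not> snd a)"

fun reduced_word :: "'x letter list \<Rightarrow> bool" where
  "reduced_word (a # b # w) \<longleftrightarrow> b \<noteq> inv_letter a \<and> reduced_word (b # w)"
| "reduced_word w \<longleftrightarrow> True"

fun push_letter :: "'x letter \<Rightarrow> 'x letter list \<Rightarrow> 'x letter list" where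
  "push_letter a [] = [a]"
| "push_letter a (b # w) = (if b = inv_letter a then w else a # b # w)"

definition reduce_word :: "'x letter list \<Rightarrow> 'x letter list" where
  "reduce_word w = foldr push_letter w []"

definition free_group :: "'x set \<Rightarrow> 'x letter list monoid" where
  "free_group B =
    \<lparr>carrier = {w \<in> lists (B \<times> UNIV). reduced_word w}, monoid.mult = (\<lambda>u v. reduce_word (u @ v)), one = []\<rparr>"

lemma inv_letter_invol [simp]: "inv_letter (inv_letter a) = a"
  by (cases a) (simp add: inv_letter_def)

lemma inv_letter_neq [simp]: "inv_letter a \<noteq> a" "a \<noteq> inv_letter a"
  by (cases a; simp add: inv_letter_def)+

lemma reduced_tl: "reduced_word (a # w) \<Longrightarrow> reduced_word w"
  by (cases w) auto

lemma reduced_push: "reduced_word w \<Longrightarrow> reduced_word (push_letter a w)"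
  by (cases w) (auto dest: reduced_tl)

lemma push_push: "reduced_word w \<Longrightarrow> push_letter a (push_letter (inv_letter a) w) = w"
proof (cases w)
  case (Cons b v)
  then show "reduced_word w \<Longrightarrow> push_letter a (push_letter (inv_letter a) w) = w"
    by (cases v) auto
qed simp

lemma reduced_act: "reduced_word w \<Longrightarrow> reduced_word (foldr push_letter u w)"
  by (induction u) (auto intro: reduced_push)

lemma reduced_reduce: "reduced_word (reduce_word w)"
  by (simp add: reduce_word_def reduced_act)

lemma reduce_eq: "reduced_word w \<Longrightarrow> reduce_word w = w"
proof (induction w)
  case (Cons a w)
  then have "reduce_word w = w" by (auto dest: reduced_tl)
  then show ?case using Cons.prems by (cases w) (auto simp: reduce_word_def)
qed (simp add: reduce_word_def)

lemma act_push:
  assumes "reduced_word w"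
  shows "foldr push_letter (push_letter a u) w = push_letter a (foldr push_letter u w)"
proof (cases u)
  case (Cons b v)
  then show ?thesis
    using push_push[OF reduced_act[OF assms], of a v] by auto
qed simp

lemma act_reduce: "reduced_word w \<Longrightarrow> foldr push_letter (reduce_word u) w = foldr push_letter u w"
  by (induction u) (auto simp: reduce_word_def act_push)

lemma reduce_append: "reduce_word (u @ v) = foldr push_letter u (reduce_word v)"
  by (simp add: reduce_word_def)

lemma act_act:
  assumes "reduced_word v" "reduced_word w"
  shows "foldr push_letter (foldr push_letter u v) w = foldr push_letter u (foldr push_letter v w)"
  using act_reduce[OF assms(2), of "u @ v"] by (simp add: reduce_append reduce_eq assms(1))

lemma set_push: "set (push_letter a w) \<subseteq> insert a (set w)"
  by (cases w) auto

lemma set_reduce: "set (reduce_word w) \<subseteq> set w"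
proof (induction w)
  case (Cons a w)
  then show ?case using set_push[of a "reduce_word w"] by (auto simp: reduce_word_def)
qed (simp add: reduce_word_def)

lemma reduce_in_lists: "w \<in> lists A \<Longrightarrow> reduce_word w \<in> lists A"
  using set_reduce[of w] by (auto simp: in_lists_conv_set)

lemma reduce_inverse: "reduced_word w \<Longrightarrow> reduce_word (rev (map inv_letter w) @ w) = []"
proof -
  assume "reduced_word w"
  then have "foldr push_letter (rev (map inv_letter w)) w = []"
    by (induction w) (auto dest: reduced_tl)
  then show ?thesis using \<open>reduced_word w\<close> by (simp add: reduce_append reduce_eq)
qed

lemma group_free_group: "group (free_group B)"
proof (rule groupI)
  fix u v w assume "u \<in> carrier (free_group B)" "v \<in> carrier (free_group B)"
    "w \<in> carrier (free_group B)"
  then show "u \<otimes>\<^bsub>free_group B\<^esub> v \<otimes>\<^bsub>free_group B\<^esub> w =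
    u \<otimes>\<^bsub>free_group B\<^esub> (v \<otimes>\<^bsub>free_group B\<^esub> w)"
    by (simp add: free_group_def reduce_append reduced_act reduce_eq act_act)
next
  fix w assume w: "w \<in> carrier (free_group B)"
  let ?v = "reduce_word (rev (map inv_letter w))"
  have "rev (map inv_letter w) \<in> lists (B \<times> UNIV)"
    using w by (force simp: free_group_def in_lists_conv_set inv_letter_def mem_Times_iff)
  then have "?v \<in> lists (B \<times> UNIV)" by (rule reduce_in_lists)
  then have "?v \<in> carrier (free_group B)" using reduced_reduce by (simp add: free_group_def)
  moreover have "?v \<otimes>\<^bsub>free_group B\<^esub> w = \<one>\<^bsub>free_group B\<^esub>"
    using w reduce_inverse[of w]
    by (simp add: free_group_def reduce_append act_reduce reduced_reduce)
  ultimately show "\<exists>y\<in>carrier (free_group B). y \<otimes>\<^bsub>free_group B\<^esub> w = \<one>\<^bsub>free_group B\<^esub>" by blast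
qed (auto simp: free_group_def reduced_reduce reduce_eq intro!: reduce_in_lists)

text \<open>The universal property of \<^term>\<open>free_group B\<close>.\<close>

theorem free_group_universal:
  fixes H (structure)
  assumes H: "group H" and f: "f \<in> B \<rightarrow> carrier H"
  shows "\<exists>h \<in> hom (free_group B) H. (\<forall>x\<in>B. h [(x, True)] = f x) \<and>
    (\<forall>g \<in> hom (free_group B) H. (\<forall>x\<in>B. g [(x, True)] = f x) \<longrightarrow>
      (\<forall>w \<in> carrier (free_group B). g w = h w))"
proof -
  interpret group H by fact
  define val where "val = (\<lambda>(x, b). if b then f x else inv (f x))"
  define h where "h = (\<lambda>w. foldr (\<lambda>a y. val a \<otimes> y) w \<one>)"
  define L where "L = B \<times> (UNIV :: bool set)"
  have val: "val a \<in> carrier H" "val (inv_letter a) = inv (val a)" if "a \<in> L" for a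
    using that f by (auto simp: L_def val_def inv_letter_def Pi_iff)
  have h_Cons: "h (a # w) = val a \<otimes> h w" and h_Nil: "h [] = \<one>" for a w
    by (simp_all add: h_def)
  have h_closed: "h w \<in> carrier H" if "w \<in> lists L" for w
    using that by induction (simp_all add: h_Cons h_Nil val)
  have h_push: "h (push_letter a w) = val a \<otimes> h w" if "a \<in> L" "w \<in> lists L" for a w
  proof (cases w)
    case (Cons b v)
    have "val a \<otimes> (inv (val a) \<otimes> h v) = h v"
      using that Cons val(1)[of a] h_closed[of v] by (simp add: m_assoc[symmetric])
    then show ?thesis using Cons that by (simp add: h_Cons val)
  qed (simp add: h_Cons h_Nil)
  have h_app: "h (u @ v) = h u \<otimes> h v" if "u \<in> lists L" "v \<in> lists L" for u v
    using that by induction (simp_all add: h_Cons h_Nil m_assoc val h_closed)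
  have free_group_L: "free_group B =
      \<lparr>carrier = {w \<in> lists L. reduced_word w}, monoid.mult = (\<lambda>u v. reduce_word (u @ v)), one = []\<rparr>"
    by (simp add: free_group_def L_def)
  have h_reduce: "h (reduce_word w) = h w" if "w \<in> lists L" for w
    using that
  proof (induction w)
    case (Cons a w)
    then have "w \<in> lists L" by simp
    then have "reduce_word w \<in> lists L" by (rule reduce_in_lists)
    with Cons show ?case using h_push[of a "reduce_word w"] by (simp add: reduce_word_def h_Cons)
  qed (simp add: reduce_word_def)
  have hom: "h \<in> hom (free_group B) H"
    by (rule homI) (simp_all add: free_group_L h_closed h_reduce h_app)
  have gen: "\<forall>x\<in>B. h [(x, True)] = f x"
    using f by (auto simp: h_def val_def Pi_iff)
  have uniq: "g w = h w"
    if g: "g \<in> hom (free_group B) H" "\<forall>x\<in>B. g [(x, True)] = f x" and w: "w \<in> carrier (free_group B)"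
    for g w
  proof -
    interpret F: group "free_group B" by (rule group_free_group)
    interpret gh: group_hom "free_group B" H g
      by unfold_locales (rule g(1))
    have g_letter: "g [a] = val a" if "a \<in> L" for a
    proof -
      obtain x b where a: "a = (x, b)" "x \<in> B" using \<open>a \<in> L\<close> by (auto simp: L_def)
      have c: "[(x, c)] \<in> carrier (free_group B)" for c using a by (simp add: free_group_def)
      have "[(x, False)] \<otimes>\<^bsub>free_group B\<^esub> [(x, True)] = \<one>\<^bsub>free_group B\<^esub>"
        by (simp add: free_group_L reduce_word_def inv_letter_def)
      then have "[(x, False)] = inv\<^bsub>free_group B\<^esub> [(x, True)]"
        using F.inv_equality[OF _ c c] by metis
      then have "g [(x, False)] = inv (f x)" using g(2) a(2) c by simp
      then show ?thesis using a g(2) by (cases b) (auto simp: val_def)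
    qed
    have "w \<in> lists L" "reduced_word w" using w by (auto simp: free_group_L)
    then show ?thesis
    proof (induction w)
      case Nil
      have "g \<one>\<^bsub>free_group B\<^esub> = \<one>" by (rule gh.hom_one)
      then show ?case by (simp add: free_group_L h_Nil)
    next
      case (Cons a w)
      then have a: "a \<in> L" and w: "w \<in> lists L" "reduced_word w"
        by (auto dest: reduced_tl)
      have "[a] \<in> carrier (free_group B)" "w \<in> carrier (free_group B)"
        using a w by (auto simp: free_group_L)
      then have "g ([a] \<otimes>\<^bsub>free_group B\<^esub> w) = g [a] \<otimes> g w" by simp
      moreover have "[a] \<otimes>\<^bsub>free_group B\<^esub> w = a # w"
        using Cons.prems by (simp add: free_group_L reduce_eq)
      ultimately show ?case using Cons.IH w g_letter[OF a] by (simp add: h_Cons)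
    qed
  qed
  show ?thesis using hom gen uniq by (intro bexI[of _ h]) auto
qed


section \<open>Nilpotent genus and parafree groups\<close>

text \<open>
  The series starts at index \<open>1\<close> with the whole group; the value at index \<open>0\<close> is never used.
\<close>

fun lower_central :: "('a, 'b) monoid_scheme \<Rightarrow> nat \<Rightarrow> 'a set" where
  "lower_central G 0 = carrier G"
| "lower_central G (Suc 0) = carrier G"
| "lower_central G (Suc (Suc n)) =
    generate G {x \<otimes>\<^bsub>G\<^esub> y \<otimes>\<^bsub>G\<^esub> inv\<^bsub>G\<^esub> x \<otimes>\<^bsub>G\<^esub> inv\<^bsub>G\<^esub> y | x y.
      x \<in> lower_central G (Suc n) \<and> y \<in> carrier G}"

definition residually_nilpotent :: "('a, 'b) monoid_scheme \<Rightarrow> bool" where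
  "residually_nilpotent G \<longleftrightarrow> (\<Inter>n\<in>{1..}. lower_central G n) = {\<one>\<^bsub>G\<^esub>}"

text \<open>
  Residual nilpotence of the two groups is not part of the following relation: \<open>parafree\<close> states
  it for \<open>G\<close>, and for free groups it is a theorem of Magnus.
\<close>

definition same_nilpotent_genus ::
    "('a, 'b) monoid_scheme \<Rightarrow> ('c, 'd) monoid_scheme \<Rightarrow> bool" where
  "same_nilpotent_genus G H \<longleftrightarrow>
    (\<forall>c\<ge>1. (G Mod lower_central G c) \<cong> (H Mod lower_central H c))"

text \<open>
  It is no restriction to take the basis of the free group inside the type of \<open>G\<close>: if \<open>G\<close> has the
  same nilpotent genus as a free group on \<open>B\<close>, then the abelianization of \<open>G\<close> is free abelian on a
  set in bijection with \<open>B\<close>, so \<open>B\<close> is in bijection with a subset of \<open>carrier G\<close>.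
\<close>

definition parafree :: "('a, 'b) monoid_scheme \<Rightarrow> bool" where
  "parafree G \<longleftrightarrow>
    residually_nilpotent G \<and> (\<exists>B :: 'a set. same_nilpotent_genus G (free_group B))"

definition finitely_generated :: "('a, 'b) monoid_scheme \<Rightarrow> bool" where
  "finitely_generated G \<longleftrightarrow> (\<exists>S. finite S \<and> S \<subseteq> carrier G \<and> generate G S = carrier G)"

lemma lower_central_normal:
  assumes "group G" shows "lower_central G n \<lhd> G"
proof -
  interpret group G by fact
  have carr: "carrier G \<lhd> G" by (rule normal_invI[OF subgroup_self]) auto
  have "lower_central G (Suc n) \<lhd> G" for n
  proof (induction n)
    case (Suc n)
    let ?N = "lower_central G (Suc n)"
    interpret N: normal ?N G by fact
    let ?C = "{x \<otimes>\<^bsub>G\<^esub> y \<otimes>\<^bsub>G\<^esub> inv\<^bsub>G\<^esub> x \<otimes>\<^bsub>G\<^esub> inv\<^bsub>G\<^esub> y | x y. x \<in> ?N \<and> y \<in> carrier G}"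
    have conj: "g \<otimes>\<^bsub>G\<^esub> h \<otimes>\<^bsub>G\<^esub> inv\<^bsub>G\<^esub> g \<in> ?C"
      if "x \<in> ?N" "y \<in> carrier G" "g \<in> carrier G"
        "h = x \<otimes>\<^bsub>G\<^esub> y \<otimes>\<^bsub>G\<^esub> inv\<^bsub>G\<^esub> x \<otimes>\<^bsub>G\<^esub> inv\<^bsub>G\<^esub> y" for g h x y
    proof -
      let ?x = "g \<otimes>\<^bsub>G\<^esub> x \<otimes>\<^bsub>G\<^esub> inv\<^bsub>G\<^esub> g" and ?y = "g \<otimes>\<^bsub>G\<^esub> y \<otimes>\<^bsub>G\<^esub> inv\<^bsub>G\<^esub> g"
      have x: "x \<in> carrier G" using that(1) by (rule N.mem_carrier)
      have cancel: "inv\<^bsub>G\<^esub> g \<otimes>\<^bsub>G\<^esub> (g \<otimes>\<^bsub>G\<^esub> z) = z" if "z \<in> carrier G" for z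
        using that \<open>g \<in> carrier G\<close> by (simp add: m_assoc[symmetric])
      have "g \<otimes>\<^bsub>G\<^esub> h \<otimes>\<^bsub>G\<^esub> inv\<^bsub>G\<^esub> g = ?x \<otimes>\<^bsub>G\<^esub> ?y \<otimes>\<^bsub>G\<^esub> inv\<^bsub>G\<^esub> ?x \<otimes>\<^bsub>G\<^esub> inv\<^bsub>G\<^esub> ?y"
        using that(2-4) x by (simp add: inv_mult_group m_assoc cancel)
      moreover have "?x \<in> ?N" using that by (intro N.inv_op_closed2)
      moreover have "?y \<in> carrier G" using that by simp
      ultimately show ?thesis by blast
    qed
    have "?C \<subseteq> carrier G"
    proof
      fix h assume "h \<in> ?C"
      then obtain x y where "h = x \<otimes>\<^bsub>G\<^esub> y \<otimes>\<^bsub>G\<^esub> inv\<^bsub>G\<^esub> x \<otimes>\<^bsub>G\<^esub> inv\<^bsub>G\<^esub> y" "x \<in> ?N" "y \<in> carrier G"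
        by blast
      then show "h \<in> carrier G" using N.mem_carrier[of x] by simp
    qed
    then have "generate G ?C \<lhd> G"
    proof (rule normal_generateI)
      fix h g assume "h \<in> ?C" "g \<in> carrier G"
      then show "g \<otimes>\<^bsub>G\<^esub> h \<otimes>\<^bsub>G\<^esub> inv\<^bsub>G\<^esub> g \<in> ?C" using conj by blast
    qed
    then show ?case by (simp only: lower_central.simps(3))
  qed (simp only: lower_central.simps carr)
  then show ?thesis using carr by (cases n) (simp_all only: lower_central.simps(1))
qed


section \<open>The reduced C*-algebra\<close>

text \<open>
  Vectors of \<open>\<ell>\<^sup>2(A)\<close> are functions on the whole type that vanish outside \<open>A\<close>, and operators on
  \<open>\<ell>\<^sup>2(A)\<close> are functions that vanish outside \<open>\<ell>\<^sup>2(A)\<close>. With this convention equality of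
  operators is equality of functions, and sums, scalar multiples and composites are the
  pointwise ones.
\<close>

definition ell2 :: "'a set \<Rightarrow> ('a \<Rightarrow> complex) set" where
  "ell2 A = {\<xi>. (\<forall>x. x \<notin> A \<longrightarrow> \<xi> x = 0) \<and> (\<lambda>x. (cmod (\<xi> x))\<^sup>2) summable_on A}"

definition ell2_norm :: "'a set \<Rightarrow> ('a \<Rightarrow> complex) \<Rightarrow> real" where
  "ell2_norm A \<xi> = sqrt (\<Sum>\<^sub>\<infinity>x\<in>A. (cmod (\<xi> x))\<^sup>2)"

type_synonym 'a operator = "('a \<Rightarrow> complex) \<Rightarrow> 'a \<Rightarrow> complex"

definition bounded_operators :: "'a set \<Rightarrow> 'a operator set" where
  "bounded_operators A = {T.
    (\<forall>\<xi>. \<xi> \<notin> ell2 A \<longrightarrow> T \<xi> = (\<lambda>_. 0)) \<and>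
    (\<forall>\<xi>\<in>ell2 A. T \<xi> \<in> ell2 A) \<and>
    (\<forall>\<xi>\<in>ell2 A. \<forall>\<eta>\<in>ell2 A. T (\<lambda>x. \<xi> x + \<eta> x) = (\<lambda>x. T \<xi> x + T \<eta> x)) \<and>
    (\<forall>c. \<forall>\<xi>\<in>ell2 A. T (\<lambda>x. c * \<xi> x) = (\<lambda>x. c * T \<xi> x)) \<and>
    (\<exists>K. \<forall>\<xi>\<in>ell2 A. ell2_norm A (T \<xi>) \<le> K * ell2_norm A \<xi>)}"

definition op_norm :: "'a set \<Rightarrow> 'a operator \<Rightarrow> real" where
  "op_norm A T = (SUP \<xi>\<in>{\<xi> \<in> ell2 A. ell2_norm A \<xi> \<le> 1}. ell2_norm A (T \<xi>))"

definition group_algebra :: "('a, 'b) monoid_scheme \<Rightarrow> ('a \<Rightarrow>\<^sub>0 complex) set" where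
  "group_algebra G = {a. Poly_Mapping.keys a \<subseteq> carrier G}"

definition left_translate ::
    "('a, 'b) monoid_scheme \<Rightarrow> 'a \<Rightarrow> ('a \<Rightarrow> complex) \<Rightarrow> 'a \<Rightarrow> complex" where
  "left_translate G \<gamma> \<xi> = (\<lambda>x. if x \<in> carrier G then \<xi> (inv\<^bsub>G\<^esub> \<gamma> \<otimes>\<^bsub>G\<^esub> x) else 0)"

definition left_regular :: "('a, 'b) monoid_scheme \<Rightarrow> ('a \<Rightarrow>\<^sub>0 complex) \<Rightarrow> 'a operator" where
  "left_regular G a = (\<lambda>\<xi>. if \<xi> \<in> ell2 (carrier G)
     then (\<lambda>x. \<Sum>\<gamma>\<in>Poly_Mapping.keys a. Poly_Mapping.lookup a \<gamma> * left_translate G \<gamma> \<xi> x) else (\<lambda>_. 0))"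

definition reduced_cstar_algebra ::
    "('a, 'b) monoid_scheme \<Rightarrow> (complex, 'a operator) module" where
  "reduced_cstar_algebra G =
    \<lparr>carrier = {T \<in> bounded_operators (carrier G). \<forall>\<epsilon>>0. \<exists>a\<in>group_algebra G.
       op_norm (carrier G) (\<lambda>\<xi> x. T \<xi> x - left_regular G a \<xi> x) < \<epsilon>},
     monoid.mult = (\<lambda>S T \<xi>. S (T \<xi>)),
     one = (\<lambda>\<xi>. if \<xi> \<in> ell2 (carrier G) then \<xi> else (\<lambda>_. 0)),
     ring.zero = (\<lambda>\<xi> x. 0),
     add = (\<lambda>S T \<xi> x. S \<xi> x + T \<xi> x),
     module.smult = (\<lambda>c T \<xi> x. c * T \<xi> x)\<rparr>"

text \<open>
  Simplicity is algebraic: no closedness is required of the ideals. Note that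
  \<^const>\<open>ideal\<close> means two-sided ideal, and that it presupposes a ring; see
  \<open>ring_reduced_cstar_algebra\<close> below.
\<close>

definition simple_complex_algebra :: "(complex, 'c, 'd) module_scheme \<Rightarrow> bool" where
  "simple_complex_algebra M \<longleftrightarrow>
    (\<forall>I. ideal I M \<and> (\<forall>c. \<forall>T\<in>I. c \<odot>\<^bsub>M\<^esub> T \<in> I) \<longrightarrow> I = {\<zero>\<^bsub>M\<^esub>} \<or> I = carrier M)"

subsection \<open>The reduced C*-algebra is a ring\<close>

lemma ell2_normI:
  assumes "\<And>x. x \<notin> A \<Longrightarrow> \<xi> x = 0"
    and B: "\<And>F. finite F \<Longrightarrow> F \<subseteq> A \<Longrightarrow> L2_set (\<lambda>x. cmod (\<xi> x)) F \<le> B"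
  shows "\<xi> \<in> ell2 A" "ell2_norm A \<xi> \<le> B"
proof -
  have "0 \<le> B" using B[of "{}"] by simp
  have *: "(\<Sum>x\<in>F. (cmod (\<xi> x))\<^sup>2) \<le> B\<^sup>2" if "finite F" "F \<subseteq> A" for F
    using B[OF that] \<open>0 \<le> B\<close> real_sqrt_le_iff[of _ "B\<^sup>2"] by (simp add: L2_set_def)
  have s: "(\<lambda>x. (cmod (\<xi> x))\<^sup>2) summable_on A"
    by (rule nonneg_bdd_above_summable_on) (auto intro!: bdd_aboveI[of _ "B\<^sup>2"] *)
  then show "\<xi> \<in> ell2 A" using assms(1) by (auto simp: ell2_def)
  have "(\<Sum>\<^sub>\<infinity>x\<in>A. (cmod (\<xi> x))\<^sup>2) \<le> B\<^sup>2"
    by (rule infsum_le_finite_sums[OF s *])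
  then show "ell2_norm A \<xi> \<le> B"
    unfolding ell2_norm_def using \<open>0 \<le> B\<close> by (rule real_le_lsqrt[rotated 1])
qed

lemma ell2_normD:
  assumes "\<xi> \<in> ell2 A" "finite F" "F \<subseteq> A"
  shows "L2_set (\<lambda>x. cmod (\<xi> x)) F \<le> ell2_norm A \<xi>"
  unfolding L2_set_def ell2_norm_def using assms
  by (intro real_sqrt_le_mono finite_sum_le_infsum) (auto simp: ell2_def)

lemma ell2_norm_nonneg: "0 \<le> ell2_norm A \<xi>"
  by (simp add: ell2_norm_def infsum_nonneg)

lemma ell2_zero: "(\<lambda>_. 0) \<in> ell2 A" "ell2_norm A (\<lambda>_. 0) = 0"
  by (simp_all add: ell2_def ell2_norm_def)

lemma ell2_add:
  assumes "\<xi> \<in> ell2 A" "\<eta> \<in> ell2 A"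
  shows "(\<lambda>x. \<xi> x + \<eta> x) \<in> ell2 A"
    "ell2_norm A (\<lambda>x. \<xi> x + \<eta> x) \<le> ell2_norm A \<xi> + ell2_norm A \<eta>"
proof -
  have bound: "L2_set (\<lambda>x. cmod (\<xi> x + \<eta> x)) F \<le> ell2_norm A \<xi> + ell2_norm A \<eta>"
    if "finite F" "F \<subseteq> A" for F
  proof -
    have "L2_set (\<lambda>x. cmod (\<xi> x + \<eta> x)) F \<le> L2_set (\<lambda>x. cmod (\<xi> x) + cmod (\<eta> x)) F"
      by (intro L2_set_mono norm_triangle_ineq) auto
    also have "\<dots> \<le> L2_set (\<lambda>x. cmod (\<xi> x)) F + L2_set (\<lambda>x. cmod (\<eta> x)) F"
      by (rule L2_set_triangle_ineq)
    also have "\<dots> \<le> ell2_norm A \<xi> + ell2_norm A \<eta>"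
      using assms that by (intro add_mono ell2_normD)
    finally show ?thesis .
  qed
  have supp: "\<xi> x + \<eta> x = 0" if "x \<notin> A" for x
    using assms that by (simp add: ell2_def)
  show "(\<lambda>x. \<xi> x + \<eta> x) \<in> ell2 A"
    "ell2_norm A (\<lambda>x. \<xi> x + \<eta> x) \<le> ell2_norm A \<xi> + ell2_norm A \<eta>"
    by (rule ell2_normI[OF supp bound]; assumption)+
qed

lemma ell2_scale:
  assumes "\<xi> \<in> ell2 A"
  shows "(\<lambda>x. c * \<xi> x) \<in> ell2 A" "ell2_norm A (\<lambda>x. c * \<xi> x) = cmod c * ell2_norm A \<xi>"
proof -
  show "(\<lambda>x. c * \<xi> x) \<in> ell2 A"
    using assms by (auto simp: ell2_def norm_mult power_mult_distrib intro: summable_on_cmult_right)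
  show "ell2_norm A (\<lambda>x. c * \<xi> x) = cmod c * ell2_norm A \<xi>"
    by (simp add: ell2_norm_def norm_mult power_mult_distrib infsum_cmult_right' real_sqrt_mult)
qed

lemma bounded_operatorsI:
  assumes "\<And>\<xi>. \<xi> \<notin> ell2 A \<Longrightarrow> T \<xi> = (\<lambda>_. 0)"
    and "\<And>\<xi>. \<xi> \<in> ell2 A \<Longrightarrow> T \<xi> \<in> ell2 A"
    and "\<And>\<xi> \<eta>. \<xi> \<in> ell2 A \<Longrightarrow> \<eta> \<in> ell2 A \<Longrightarrow> T (\<lambda>x. \<xi> x + \<eta> x) = (\<lambda>x. T \<xi> x + T \<eta> x)"
    and "\<And>c \<xi>. \<xi> \<in> ell2 A \<Longrightarrow> T (\<lambda>x. c * \<xi> x) = (\<lambda>x. c * T \<xi> x)"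
    and "\<And>\<xi>. \<xi> \<in> ell2 A \<Longrightarrow> ell2_norm A (T \<xi>) \<le> K * ell2_norm A \<xi>"
  shows "T \<in> bounded_operators A"
  using assms unfolding bounded_operators_def by blast

lemma bounded_operatorsD:
  assumes "T \<in> bounded_operators A"
  shows "\<xi> \<notin> ell2 A \<Longrightarrow> T \<xi> = (\<lambda>_. 0)"
    and "\<xi> \<in> ell2 A \<Longrightarrow> T \<xi> \<in> ell2 A"
    and "\<xi> \<in> ell2 A \<Longrightarrow> \<eta> \<in> ell2 A \<Longrightarrow> T (\<lambda>x. \<xi> x + \<eta> x) = (\<lambda>x. T \<xi> x + T \<eta> x)"
    and "\<xi> \<in> ell2 A \<Longrightarrow> T (\<lambda>x. c * \<xi> x) = (\<lambda>x. c * T \<xi> x)"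
  using assms unfolding bounded_operators_def by blast+

lemma bounded_operators_bound:
  assumes "T \<in> bounded_operators A"
  obtains K where "K \<ge> 0" "\<And>\<xi>. \<xi> \<in> ell2 A \<Longrightarrow> ell2_norm A (T \<xi>) \<le> K * ell2_norm A \<xi>"
proof -
  obtain K where K: "\<And>\<xi>. \<xi> \<in> ell2 A \<Longrightarrow> ell2_norm A (T \<xi>) \<le> K * ell2_norm A \<xi>"
    using assms unfolding bounded_operators_def by blast
  have "ell2_norm A (T \<xi>) \<le> max 0 K * ell2_norm A \<xi>" if "\<xi> \<in> ell2 A" for \<xi>
    using K[OF that] mult_right_mono[of K "max 0 K" "ell2_norm A \<xi>"] ell2_norm_nonneg[of A \<xi>]
    by linarith
  then show ?thesis using that[of "max 0 K"] by simp
qed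

lemma bounded_operators_zero_arg: "T \<in> bounded_operators A \<Longrightarrow> T (\<lambda>_. 0) = (\<lambda>_. 0)"
  using bounded_operatorsD(4)[of T A "\<lambda>_. 0" 0] by (simp add: ell2_zero)

lemma op_norm_le:
  assumes "0 \<le> K" "\<And>\<xi>. \<xi> \<in> ell2 A \<Longrightarrow> ell2_norm A (T \<xi>) \<le> K * ell2_norm A \<xi>"
  shows "op_norm A T \<le> K"
  unfolding op_norm_def
proof (rule cSUP_least)
  show "{\<xi> \<in> ell2 A. ell2_norm A \<xi> \<le> 1} \<noteq> {}"
    using ell2_zero[of A] by (auto intro!: exI[of _ "\<lambda>_. 0"])
  fix \<xi> assume "\<xi> \<in> {\<xi> \<in> ell2 A. ell2_norm A \<xi> \<le> 1}"
  then show "ell2_norm A (T \<xi>) \<le> K"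
    using assms(2)[of \<xi>] mult_left_mono[OF _ assms(1), of "ell2_norm A \<xi>" 1] by simp
qed

lemma le_op_norm:
  assumes T: "T \<in> bounded_operators A" and "\<xi> \<in> ell2 A"
  shows "ell2_norm A (T \<xi>) \<le> op_norm A T * ell2_norm A \<xi>"
proof -
  obtain K where K: "K \<ge> 0" "\<And>\<xi>. \<xi> \<in> ell2 A \<Longrightarrow> ell2_norm A (T \<xi>) \<le> K * ell2_norm A \<xi>"
    using bounded_operators_bound[OF T] by blast
  show ?thesis
  proof (cases "ell2_norm A \<xi> = 0")
    case True
    then show ?thesis using K(2)[OF assms(2)] by simp
  next
    case False
    let ?n = "ell2_norm A \<xi>"
    define \<eta> where "\<eta> = (\<lambda>x. complex_of_real (1 / ?n) * \<xi> x)"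
    have n: "?n > 0" using False ell2_norm_nonneg[of A \<xi>] by linarith
    have \<eta>: "\<eta> \<in> ell2 A" "ell2_norm A \<eta> = 1"
      unfolding \<eta>_def using ell2_scale[OF assms(2), of "complex_of_real (1 / ?n)"] n
      by (simp_all add: norm_divide)
    have "bdd_above ((\<lambda>\<xi>. ell2_norm A (T \<xi>)) ` {\<xi> \<in> ell2 A. ell2_norm A \<xi> \<le> 1})"
    proof (rule bdd_aboveI[of _ K], clarify)
      fix \<xi> assume "\<xi> \<in> ell2 A" "ell2_norm A \<xi> \<le> 1"
      then show "ell2_norm A (T \<xi>) \<le> K"
        using K(2)[of \<xi>] mult_left_mono[OF _ K(1), of "ell2_norm A \<xi>" 1] by simp
    qed
    then have "ell2_norm A (T \<eta>) \<le> op_norm A T"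
      unfolding op_norm_def using \<eta> by (intro cSUP_upper) auto
    moreover have "ell2_norm A (T \<eta>) = ell2_norm A (T \<xi>) / ?n"
      unfolding \<eta>_def bounded_operatorsD(4)[OF T assms(2)]
      using ell2_scale(2)[OF bounded_operatorsD(2)[OF T assms(2)], of "complex_of_real (1 / ?n)"] n
      by (simp add: norm_divide)
    ultimately show ?thesis using n by (simp add: field_simps)
  qed
qed

lemma op_norm_nonneg: "T \<in> bounded_operators A \<Longrightarrow> 0 \<le> op_norm A T"
proof -
  assume T: "T \<in> bounded_operators A"
  obtain K where K: "K \<ge> 0" "\<And>\<xi>. \<xi> \<in> ell2 A \<Longrightarrow> ell2_norm A (T \<xi>) \<le> K * ell2_norm A \<xi>"
    using bounded_operators_bound[OF T] by blast
  have "bdd_above ((\<lambda>\<xi>. ell2_norm A (T \<xi>)) ` {\<xi> \<in> ell2 A. ell2_norm A \<xi> \<le> 1})"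
  proof (rule bdd_aboveI[of _ K], clarify)
    fix \<xi> assume "\<xi> \<in> ell2 A" "ell2_norm A \<xi> \<le> 1"
    then show "ell2_norm A (T \<xi>) \<le> K"
      using K(2)[of \<xi>] mult_left_mono[OF _ K(1), of "ell2_norm A \<xi>" 1] by simp
  qed
  then have "ell2_norm A (T (\<lambda>_. 0)) \<le> op_norm A T"
    unfolding op_norm_def using ell2_zero[of A] by (intro cSUP_upper) auto
  then show ?thesis using ell2_norm_nonneg order_trans by blast
qed

lemma bounded_operators_scale:
  assumes S: "S \<in> bounded_operators A"
  shows "(\<lambda>\<xi> x. c * S \<xi> x) \<in> bounded_operators A"
    "op_norm A (\<lambda>\<xi> x. c * S \<xi> x) \<le> cmod c * op_norm A S"
proof -
  have b: "ell2_norm A (\<lambda>x. c * S \<xi> x) \<le> (cmod c * op_norm A S) * ell2_norm A \<xi>"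
    if "\<xi> \<in> ell2 A" for \<xi>
    using ell2_scale(2)[OF bounded_operatorsD(2)[OF S that], of c]
      mult_left_mono[OF le_op_norm[OF S that], of "cmod c"] by (simp add: mult.assoc)
  show "(\<lambda>\<xi> x. c * S \<xi> x) \<in> bounded_operators A"
    by (rule bounded_operatorsI[where K = "cmod c * op_norm A S"])
      (use b in \<open>auto simp: bounded_operatorsD[OF S] algebra_simps intro: ell2_scale\<close>)
  show "op_norm A (\<lambda>\<xi> x. c * S \<xi> x) \<le> cmod c * op_norm A S"
    by (rule op_norm_le) (use b op_norm_nonneg[OF S] in auto)
qed

lemma bounded_operators_add:
  assumes S: "S \<in> bounded_operators A" and T: "T \<in> bounded_operators A"
  shows "(\<lambda>\<xi> x. S \<xi> x + T \<xi> x) \<in> bounded_operators A"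
    "op_norm A (\<lambda>\<xi> x. S \<xi> x + T \<xi> x) \<le> op_norm A S + op_norm A T"
proof -
  have b: "ell2_norm A (\<lambda>x. S \<xi> x + T \<xi> x) \<le> (op_norm A S + op_norm A T) * ell2_norm A \<xi>"
    if "\<xi> \<in> ell2 A" for \<xi>
    using ell2_add(2)[OF bounded_operatorsD(2)[OF S that] bounded_operatorsD(2)[OF T that]]
      le_op_norm[OF S that] le_op_norm[OF T that] by (simp add: distrib_right)
  show "(\<lambda>\<xi> x. S \<xi> x + T \<xi> x) \<in> bounded_operators A"
    by (rule bounded_operatorsI[where K = "op_norm A S + op_norm A T"])
      (use b in \<open>auto simp: bounded_operatorsD[OF S] bounded_operatorsD[OF T] algebra_simps
        intro: ell2_add\<close>)
  show "op_norm A (\<lambda>\<xi> x. S \<xi> x + T \<xi> x) \<le> op_norm A S + op_norm A T"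
    by (rule op_norm_le) (use b op_norm_nonneg[OF S] op_norm_nonneg[OF T] in auto)
qed

lemma bounded_operators_diff:
  assumes S: "S \<in> bounded_operators A" and T: "T \<in> bounded_operators A"
  shows "(\<lambda>\<xi> x. S \<xi> x - T \<xi> x) \<in> bounded_operators A"
  using bounded_operators_add(1)[OF S bounded_operators_scale(1)[OF T, of "-1"]] by simp

lemma bounded_operators_comp:
  assumes S: "S \<in> bounded_operators A" and T: "T \<in> bounded_operators A"
  shows "(\<lambda>\<xi>. S (T \<xi>)) \<in> bounded_operators A"
    "op_norm A (\<lambda>\<xi>. S (T \<xi>)) \<le> op_norm A S * op_norm A T"
proof -
  have b: "ell2_norm A (S (T \<xi>)) \<le> (op_norm A S * op_norm A T) * ell2_norm A \<xi>"
    if "\<xi> \<in> ell2 A" for \<xi>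
    using le_op_norm[OF S bounded_operatorsD(2)[OF T that]]
      mult_left_mono[OF le_op_norm[OF T that] op_norm_nonneg[OF S]] by (simp add: mult.assoc)
  show "(\<lambda>\<xi>. S (T \<xi>)) \<in> bounded_operators A"
    by (rule bounded_operatorsI[where K = "op_norm A S * op_norm A T"])
      (use b in \<open>auto simp: bounded_operatorsD[OF S] bounded_operatorsD[OF T]
        bounded_operators_zero_arg[OF S]\<close>)
  show "op_norm A (\<lambda>\<xi>. S (T \<xi>)) \<le> op_norm A S * op_norm A T"
    by (rule op_norm_le) (use b op_norm_nonneg[OF S] op_norm_nonneg[OF T] in auto)
qed

lemma bounded_operators_zero: "(\<lambda>\<xi> x. 0) \<in> bounded_operators A" "op_norm A (\<lambda>\<xi> x. 0) \<le> 0"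
  by (rule bounded_operatorsI[where K = 0]; simp add: ell2_zero)
    (rule op_norm_le; simp add: ell2_zero)

context
  fixes G (structure)
  assumes group: "group G"
begin

interpretation group G by (rule group)

lemma left_translate_ell2:
  assumes \<gamma>: "\<gamma> \<in> carrier G" and \<xi>: "\<xi> \<in> ell2 (carrier G)"
  shows "left_translate G \<gamma> \<xi> \<in> ell2 (carrier G)"
    "ell2_norm (carrier G) (left_translate G \<gamma> \<xi>) \<le> ell2_norm (carrier G) \<xi>"
proof -
  have bound: "L2_set (\<lambda>x. cmod (left_translate G \<gamma> \<xi> x)) F \<le> ell2_norm (carrier G) \<xi>"
    if F: "finite F" "F \<subseteq> carrier G" for F
  proof -
    have inj: "inj_on (\<lambda>x. inv \<gamma> \<otimes> x) F"
      using F \<gamma> by (intro inj_onI) (metis inv_closed l_cancel subsetD)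
    have "L2_set (\<lambda>x. cmod (left_translate G \<gamma> \<xi> x)) F = L2_set (\<lambda>x. cmod (\<xi> x)) ((\<lambda>x. inv \<gamma> \<otimes> x) ` F)"
      unfolding L2_set_def sum.reindex[OF inj] using F
      by (intro arg_cong[where f = sqrt] sum.cong) (auto simp: left_translate_def)
    also have "\<dots> \<le> ell2_norm (carrier G) \<xi>"
      using F \<gamma> by (intro ell2_normD[OF \<xi>]) auto
    finally show ?thesis .
  qed
  have supp: "left_translate G \<gamma> \<xi> x = 0" if "x \<notin> carrier G" for x
    using that by (simp add: left_translate_def)
  show "left_translate G \<gamma> \<xi> \<in> ell2 (carrier G)"
    "ell2_norm (carrier G) (left_translate G \<gamma> \<xi>) \<le> ell2_norm (carrier G) \<xi>"
    by (rule ell2_normI[OF supp bound]; assumption)+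
qed

lemma left_regular_zero: "left_regular G 0 = (\<lambda>\<xi> x. 0)"
  by (auto simp: left_regular_def)

lemma left_regular_superset:
  assumes "finite B" "Poly_Mapping.keys a \<subseteq> B" "\<xi> \<in> ell2 (carrier G)"
  shows "left_regular G a \<xi> x = (\<Sum>\<gamma>\<in>B. Poly_Mapping.lookup a \<gamma> * left_translate G \<gamma> \<xi> x)"
  using assms by (auto simp: left_regular_def in_keys_iff intro!: sum.mono_neutral_left)

lemma left_regular_add:
  "left_regular G (a + b) = (\<lambda>\<xi> x. left_regular G a \<xi> x + left_regular G b \<xi> x)"
proof (intro ext)
  fix \<xi> x
  let ?B = "Poly_Mapping.keys a \<union> Poly_Mapping.keys b"
  show "left_regular G (a + b) \<xi> x = left_regular G a \<xi> x + left_regular G b \<xi> x"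
  proof (cases "\<xi> \<in> ell2 (carrier G)")
    case True
    then show ?thesis
      using left_regular_superset[of ?B "a + b" \<xi> x] left_regular_superset[of ?B a \<xi> x]
        left_regular_superset[of ?B b \<xi> x] Poly_Mapping.keys_add[of a b]
      by (simp add: lookup_add distrib_right sum.distrib)
  qed (simp add: left_regular_def)
qed

lemma left_regular_single:
  "left_regular G (Poly_Mapping.single \<gamma> c) =
    (\<lambda>\<xi> x. if \<xi> \<in> ell2 (carrier G) then c * left_translate G \<gamma> \<xi> x else 0)"
proof (intro ext)
  fix \<xi> x
  show "left_regular G (Poly_Mapping.single \<gamma> c) \<xi> x =
      (if \<xi> \<in> ell2 (carrier G) then c * left_translate G \<gamma> \<xi> x else 0)"
    using left_regular_superset[of "{\<gamma>}" "Poly_Mapping.single \<gamma> c" \<xi> x]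
    by (auto simp: left_regular_def)
qed

lemma group_algebra_add: "a \<in> group_algebra G \<Longrightarrow> b \<in> group_algebra G \<Longrightarrow> a + b \<in> group_algebra G"
  using Poly_Mapping.keys_add[of a b] by (auto simp: group_algebra_def)

lemma group_algebra_single: "\<gamma> \<in> carrier G \<Longrightarrow> Poly_Mapping.single \<gamma> c \<in> group_algebra G"
  by (auto simp: group_algebra_def)

lemma group_algebra_induct [consumes 1, case_names zero add]:
  assumes "a \<in> group_algebra G" and "P 0"
    and "\<And>\<gamma> c b. \<gamma> \<in> carrier G \<Longrightarrow> b \<in> group_algebra G \<Longrightarrow> P b \<Longrightarrow> P (Poly_Mapping.single \<gamma> c + b)"
  shows "P a"
proof -
  have sum_eq: "a = (\<Sum>\<gamma>\<in>Poly_Mapping.keys a. Poly_Mapping.single \<gamma> (Poly_Mapping.lookup a \<gamma>))" for a :: "'a \<Rightarrow>\<^sub>0 complex"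
    by (rule poly_mapping_eqI) (auto simp: lookup_sum lookup_single when_def in_keys_iff)
  have "P (\<Sum>\<gamma>\<in>F. Poly_Mapping.single \<gamma> (Poly_Mapping.lookup a \<gamma>)) \<and>
      (\<Sum>\<gamma>\<in>F. Poly_Mapping.single \<gamma> (Poly_Mapping.lookup a \<gamma>)) \<in> group_algebra G"
    if "finite F" "F \<subseteq> carrier G" for F
    using that
    by (induction F)
      (auto simp: assms(2) group_algebra_add group_algebra_single intro!: assms(3),
       simp add: group_algebra_def)
  from this[of "Poly_Mapping.keys a"] show ?thesis
    using assms(1) sum_eq[of a] by (simp add: group_algebra_def)
qed

lemma left_regular_bounded:
  assumes "a \<in> group_algebra G"
  shows "left_regular G a \<in> bounded_operators (carrier G)"
  using assms
proof (induction rule: group_algebra_induct)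
  case zero
  show ?case by (simp add: left_regular_zero bounded_operators_zero)
next
  case (add \<gamma> c b)
  let ?T = "\<lambda>\<xi> x. if \<xi> \<in> ell2 (carrier G) then left_translate G \<gamma> \<xi> x else 0"
  have "?T \<in> bounded_operators (carrier G)"
    by (rule bounded_operatorsI[where K = 1])
      (auto simp: left_translate_ell2[OF add(1)] ell2_add ell2_scale,
       auto simp: left_translate_def)
  from bounded_operators_scale(1)[OF this, of c]
  have "left_regular G (Poly_Mapping.single \<gamma> c) \<in> bounded_operators (carrier G)"
    by (simp add: left_regular_single if_distrib[where f = "\<lambda>x. c * x"] cong: if_cong)
  from bounded_operators_add(1)[OF this add(3)] show ?case
    by (simp add: left_regular_add)
qed

lemma left_regular_comp:
  assumes a: "a \<in> group_algebra G" and b: "b \<in> group_algebra G"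
  shows "\<exists>c\<in>group_algebra G. left_regular G c = (\<lambda>\<xi>. left_regular G a (left_regular G b \<xi>))"
  using a
proof (induction rule: group_algebra_induct)
  case zero
  show ?case
    by (rule bexI[of _ 0]) (auto simp: left_regular_zero group_algebra_def)
next
  case (add \<gamma> u a)
  then obtain c where c: "c \<in> group_algebra G"
    "left_regular G c = (\<lambda>\<xi>. left_regular G a (left_regular G b \<xi>))" by blast
  have "\<exists>d\<in>group_algebra G. left_regular G d =
      (\<lambda>\<xi>. left_regular G (Poly_Mapping.single \<gamma> u) (left_regular G b \<xi>))"
    using b
  proof (induction rule: group_algebra_induct)
    case zero
    show ?case
      by (rule bexI[of _ 0])
        (auto simp: left_regular_zero group_algebra_def left_regular_single left_translate_def fun_eq_iff)
  next
    case (add \<delta> v b)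
    let ?T = "left_regular G (Poly_Mapping.single \<gamma> u)"
    have T: "?T \<in> bounded_operators (carrier G)"
      and S: "left_regular G (Poly_Mapping.single \<delta> v) \<in> bounded_operators (carrier G)"
      and B: "left_regular G b \<in> bounded_operators (carrier G)"
      using \<open>\<gamma> \<in> carrier G\<close> add by (auto intro!: left_regular_bounded group_algebra_single)
    from add obtain d where d: "d \<in> group_algebra G"
      "left_regular G d = (\<lambda>\<xi>. ?T (left_regular G b \<xi>))" by blast
    have "left_regular G (Poly_Mapping.single (\<gamma> \<otimes> \<delta>) (u * v)) =
        (\<lambda>\<xi>. ?T (left_regular G (Poly_Mapping.single \<delta> v) \<xi>))"
    proof (intro ext)
      fix \<xi> x
      show "left_regular G (Poly_Mapping.single (\<gamma> \<otimes> \<delta>) (u * v)) \<xi> x =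
        ?T (left_regular G (Poly_Mapping.single \<delta> v) \<xi>) x"
      proof (cases "\<xi> \<in> ell2 (carrier G)")
        case True
        then have "left_regular G (Poly_Mapping.single \<delta> v) \<xi> \<in> ell2 (carrier G)"
          by (rule bounded_operatorsD(2)[OF S])
        then show ?thesis using True \<open>\<gamma> \<in> carrier G\<close> \<open>\<delta> \<in> carrier G\<close>
          by (simp add: left_regular_single left_translate_def inv_mult_group m_assoc)
      qed (simp add: left_regular_single left_translate_def)
    qed
    then have "left_regular G (Poly_Mapping.single (\<gamma> \<otimes> \<delta>) (u * v) + d) =
        (\<lambda>\<xi> x. ?T (left_regular G (Poly_Mapping.single \<delta> v) \<xi>) x + ?T (left_regular G b \<xi>) x)"
      using d by (simp add: left_regular_add)
    also have "\<dots> = (\<lambda>\<xi>. ?T (left_regular G (Poly_Mapping.single \<delta> v + b) \<xi>))"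
    proof
      fix \<xi>
      show "(\<lambda>x. ?T (left_regular G (Poly_Mapping.single \<delta> v) \<xi>) x + ?T (left_regular G b \<xi>) x) =
        ?T (left_regular G (Poly_Mapping.single \<delta> v + b) \<xi>)"
      proof (cases "\<xi> \<in> ell2 (carrier G)")
        case True
        then show ?thesis
          using bounded_operatorsD(3)[OF T bounded_operatorsD(2)[OF S True] bounded_operatorsD(2)[OF B True]]
          by (simp add: left_regular_add)
      next
        case False
        then show ?thesis
          using bounded_operators_zero_arg[OF T] bounded_operatorsD(1)[OF S False]
            bounded_operatorsD(1)[OF B False] by (simp add: left_regular_add)
      qed
    qed
    finally show ?case
      using d(1) \<open>\<gamma> \<in> carrier G\<close> \<open>\<delta> \<in> carrier G\<close>
      by (intro bexI[of _ "Poly_Mapping.single (\<gamma> \<otimes> \<delta>) (u * v) + d"])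
        (auto intro!: group_algebra_add group_algebra_single)
  qed
  then obtain d where "d \<in> group_algebra G" "left_regular G d =
      (\<lambda>\<xi>. left_regular G (Poly_Mapping.single \<gamma> u) (left_regular G b \<xi>))" by blast
  with c show ?case
    by (intro bexI[of _ "d + c"]) (auto simp: left_regular_add intro: group_algebra_add)
qed

lemma reduced_cstar_carrierI:
  assumes "T \<in> bounded_operators (carrier G)"
    and "\<And>\<epsilon>. \<epsilon> > 0 \<Longrightarrow> \<exists>a\<in>group_algebra G.
      op_norm (carrier G) (\<lambda>\<xi> x. T \<xi> x - left_regular G a \<xi> x) < \<epsilon>"
  shows "T \<in> carrier (reduced_cstar_algebra G)"
  using assms by (simp add: reduced_cstar_algebra_def)

lemma reduced_cstar_carrierD:
  assumes "T \<in> carrier (reduced_cstar_algebra G)"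
  shows "T \<in> bounded_operators (carrier G)"
    and "\<epsilon> > 0 \<Longrightarrow> \<exists>a\<in>group_algebra G.
      op_norm (carrier G) (\<lambda>\<xi> x. T \<xi> x - left_regular G a \<xi> x) < \<epsilon>"
  using assms by (simp_all add: reduced_cstar_algebra_def)

lemma left_regular_in_reduced_cstar:
  assumes "a \<in> group_algebra G"
  shows "left_regular G a \<in> carrier (reduced_cstar_algebra G)"
proof (rule reduced_cstar_carrierI[OF left_regular_bounded[OF assms]])
  fix \<epsilon> :: real assume "\<epsilon> > 0"
  then show "\<exists>b\<in>group_algebra G.
      op_norm (carrier G) (\<lambda>\<xi> x. left_regular G a \<xi> x - left_regular G b \<xi> x) < \<epsilon>"
    using assms bounded_operators_zero(2)[of "carrier G"] by (intro bexI[of _ a]) auto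
qed

lemma left_regular_one:
  "left_regular G (Poly_Mapping.single \<one> 1) =
    (\<lambda>\<xi>. if \<xi> \<in> ell2 (carrier G) then \<xi> else (\<lambda>_. 0))"
  by (auto simp: left_regular_single left_translate_def ell2_def fun_eq_iff)

lemma reduced_cstar_add:
  assumes S: "S \<in> carrier (reduced_cstar_algebra G)" and T: "T \<in> carrier (reduced_cstar_algebra G)"
  shows "(\<lambda>\<xi> x. S \<xi> x + T \<xi> x) \<in> carrier (reduced_cstar_algebra G)"
proof (rule reduced_cstar_carrierI)
  note S' = reduced_cstar_carrierD[OF S] and T' = reduced_cstar_carrierD[OF T]
  show "(\<lambda>\<xi> x. S \<xi> x + T \<xi> x) \<in> bounded_operators (carrier G)"
    by (rule bounded_operators_add(1)[OF S'(1) T'(1)])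
  fix \<epsilon> :: real assume "\<epsilon> > 0"
  then obtain a b where ab: "a \<in> group_algebra G" "b \<in> group_algebra G"
    "op_norm (carrier G) (\<lambda>\<xi> x. S \<xi> x - left_regular G a \<xi> x) < \<epsilon> / 2"
    "op_norm (carrier G) (\<lambda>\<xi> x. T \<xi> x - left_regular G b \<xi> x) < \<epsilon> / 2"
    using S'(2)[of "\<epsilon> / 2"] T'(2)[of "\<epsilon> / 2"] by auto
  have "op_norm (carrier G) (\<lambda>\<xi> x. (S \<xi> x - left_regular G a \<xi> x) + (T \<xi> x - left_regular G b \<xi> x)) < \<epsilon>"
    using bounded_operators_add(2)[OF
        bounded_operators_diff[OF S'(1) left_regular_bounded[OF ab(1)]]
        bounded_operators_diff[OF T'(1) left_regular_bounded[OF ab(2)]]] ab(3,4) by linarith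
  then show "\<exists>c\<in>group_algebra G.
      op_norm (carrier G) (\<lambda>\<xi> x. S \<xi> x + T \<xi> x - left_regular G c \<xi> x) < \<epsilon>"
    using ab by (intro bexI[of _ "a + b"])
      (auto simp: left_regular_add group_algebra_add algebra_simps)
qed

lemma reduced_cstar_comp:
  assumes S: "S \<in> carrier (reduced_cstar_algebra G)" and T: "T \<in> carrier (reduced_cstar_algebra G)"
  shows "(\<lambda>\<xi>. S (T \<xi>)) \<in> carrier (reduced_cstar_algebra G)"
proof (rule reduced_cstar_carrierI)
  let ?A = "carrier G"
  note S' = reduced_cstar_carrierD[OF S] and T' = reduced_cstar_carrierD[OF T]
  show "(\<lambda>\<xi>. S (T \<xi>)) \<in> bounded_operators ?A"
    by (rule bounded_operators_comp(1)[OF S'(1) T'(1)])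
  fix \<epsilon> :: real assume \<epsilon>: "\<epsilon> > 0"
  define M where "M = op_norm ?A T + 1"
  have M: "M > 0" "op_norm ?A T \<le> M" using op_norm_nonneg[OF T'(1)] by (auto simp: M_def)
  obtain a where a: "a \<in> group_algebra G"
    "op_norm ?A (\<lambda>\<xi> x. S \<xi> x - left_regular G a \<xi> x) < \<epsilon> / (2 * M)"
    using S'(2)[of "\<epsilon> / (2 * M)"] \<epsilon> M by auto
  let ?a = "left_regular G a"
  note a' = left_regular_bounded[OF a(1)]
  define N where "N = op_norm ?A ?a + 1"
  have N: "N > 0" "op_norm ?A ?a \<le> N" using op_norm_nonneg[OF a'] by (auto simp: N_def)
  obtain b where b: "b \<in> group_algebra G"
    "op_norm ?A (\<lambda>\<xi> x. T \<xi> x - left_regular G b \<xi> x) < \<epsilon> / (2 * N)"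
    using T'(2)[of "\<epsilon> / (2 * N)"] \<epsilon> N by auto
  let ?b = "left_regular G b"
  note b' = left_regular_bounded[OF b(1)]
  note Sa = bounded_operators_diff[OF S'(1) a'] and Tb = bounded_operators_diff[OF T'(1) b']
  obtain c where c: "c \<in> group_algebra G" "left_regular G c = (\<lambda>\<xi>. ?a (?b \<xi>))"
    using left_regular_comp[OF a(1) b(1)] by blast
  have "?a (\<lambda>x. T \<xi> x - ?b \<xi> x) = (\<lambda>x. ?a (T \<xi>) x - ?a (?b \<xi>) x)" for \<xi>
  proof (cases "\<xi> \<in> ell2 ?A")
    case True
    have "(\<lambda>x. (-1) * ?b \<xi> x) \<in> ell2 ?A"
      by (rule ell2_scale(1)[OF bounded_operatorsD(2)[OF b' True]])
    then show ?thesis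
      using bounded_operatorsD(3)[OF a' bounded_operatorsD(2)[OF T'(1) True], of "\<lambda>x. (-1) * ?b \<xi> x"]
        bounded_operatorsD(4)[OF a' bounded_operatorsD(2)[OF b' True], of "-1"] by simp
  next
    case False
    then show ?thesis
      using bounded_operatorsD(1)[OF T'(1)] bounded_operatorsD(1)[OF b']
        bounded_operators_zero_arg[OF a'] by simp
  qed
  then have eq: "(\<lambda>\<xi> x. S (T \<xi>) x - left_regular G c \<xi> x) =
      (\<lambda>\<xi> x. (S (T \<xi>) x - ?a (T \<xi>) x) + ?a (\<lambda>x. T \<xi> x - ?b \<xi> x) x)"
    by (simp add: c(2))
  have "op_norm ?A (\<lambda>\<xi> x. S (T \<xi>) x - left_regular G c \<xi> x) \<le>
      op_norm ?A (\<lambda>\<xi> x. S (T \<xi>) x - ?a (T \<xi>) x) + op_norm ?A (\<lambda>\<xi>. ?a (\<lambda>x. T \<xi> x - ?b \<xi> x))"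
    unfolding eq using bounded_operators_add(2)[OF bounded_operators_comp(1)[OF Sa T'(1)]
        bounded_operators_comp(1)[OF a' Tb]] by simp
  also have "op_norm ?A (\<lambda>\<xi> x. S (T \<xi>) x - ?a (T \<xi>) x) \<le> \<epsilon> / (2 * M) * M"
    by (rule order_trans[OF bounded_operators_comp(2)[OF Sa T'(1)]])
      (use a(2) M op_norm_nonneg[OF T'(1)] op_norm_nonneg[OF Sa] \<epsilon> in \<open>intro mult_mono; simp\<close>)
  also have "op_norm ?A (\<lambda>\<xi>. ?a (\<lambda>x. T \<xi> x - ?b \<xi> x)) \<le>
      op_norm ?A ?a * op_norm ?A (\<lambda>\<xi> x. T \<xi> x - ?b \<xi> x)"
    by (rule bounded_operators_comp(2)[OF a' Tb])
  also have "\<dots> \<le> N * op_norm ?A (\<lambda>\<xi> x. T \<xi> x - ?b \<xi> x)"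
    using N op_norm_nonneg[OF Tb] by (intro mult_right_mono) auto
  also have "\<dots> < N * (\<epsilon> / (2 * N))"
    using b(2) N by (intro mult_strict_left_mono) auto
  also have "\<epsilon> / (2 * M) * M + N * (\<epsilon> / (2 * N)) = \<epsilon>"
    using M N by (simp add: field_simps)
  finally show "\<exists>c\<in>group_algebra G.
      op_norm ?A (\<lambda>\<xi> x. S (T \<xi>) x - left_regular G c \<xi> x) < \<epsilon>"
    using c(1) by auto
qed

lemma reduced_cstar_smult:
  assumes T: "T \<in> carrier (reduced_cstar_algebra G)"
  shows "(\<lambda>\<xi> x. c * T \<xi> x) \<in> carrier (reduced_cstar_algebra G)"
proof -
  note T' = bounded_operatorsD(1,2)[OF reduced_cstar_carrierD(1)[OF T]]
  have "left_regular G (Poly_Mapping.single \<one> c) (T \<xi>) = (\<lambda>x. c * T \<xi> x)" for \<xi>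
  proof (cases "\<xi> \<in> ell2 (carrier G)")
    case True
    then have "T \<xi> \<in> ell2 (carrier G)" by (rule T'(2))
    then show ?thesis by (auto simp: left_regular_single left_translate_def ell2_def fun_eq_iff)
  next
    case False
    then show ?thesis using T'(1) by (simp add: left_regular_single left_translate_def fun_eq_iff)
  qed
  then show ?thesis
    using reduced_cstar_comp[OF left_regular_in_reduced_cstar[OF group_algebra_single[of \<one> c]] T]
    by simp
qed

theorem ring_reduced_cstar_algebra: "ring (reduced_cstar_algebra G)"
proof (rule ringI)
  let ?R = "reduced_cstar_algebra G"
  have zero: "(\<lambda>\<xi> x. 0) \<in> carrier ?R"
    using left_regular_in_reduced_cstar[of 0] by (simp add: left_regular_zero group_algebra_def)
  show "abelian_group ?R"
  proof (rule abelian_groupI)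
    fix T assume T: "T \<in> carrier ?R"
    show "\<exists>S\<in>carrier ?R. S \<oplus>\<^bsub>?R\<^esub> T = \<zero>\<^bsub>?R\<^esub>"
      by (rule bexI[OF _ reduced_cstar_smult[OF T, of "-1"]]) (simp add: reduced_cstar_algebra_def)
  qed (use zero reduced_cstar_add in \<open>auto simp: reduced_cstar_algebra_def add_ac\<close>)
  show "Group.monoid ?R"
  proof (rule monoidI)
    show "\<one>\<^bsub>?R\<^esub> \<in> carrier ?R"
      using left_regular_in_reduced_cstar[OF group_algebra_single[of \<one> 1]]
      by (simp add: left_regular_one) (simp add: reduced_cstar_algebra_def)
    fix S T assume S: "S \<in> carrier ?R" and T: "T \<in> carrier ?R"
    note S' = bounded_operatorsD[OF reduced_cstar_carrierD(1)[OF S]]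
    show "S \<otimes>\<^bsub>?R\<^esub> T \<in> carrier ?R"
      using reduced_cstar_comp[OF S T] by (simp add: reduced_cstar_algebra_def)
    show "\<one>\<^bsub>?R\<^esub> \<otimes>\<^bsub>?R\<^esub> S = S"
      using S'(1,2) by (fastforce simp: reduced_cstar_algebra_def fun_eq_iff)
    show "S \<otimes>\<^bsub>?R\<^esub> \<one>\<^bsub>?R\<^esub> = S"
      using S'(1) bounded_operators_zero_arg[OF reduced_cstar_carrierD(1)[OF S]]
      by (auto simp: reduced_cstar_algebra_def fun_eq_iff)
  qed (simp add: reduced_cstar_algebra_def)
  fix S T U assume S: "S \<in> carrier ?R" and T: "T \<in> carrier ?R" and U: "U \<in> carrier ?R"
  show "(S \<oplus>\<^bsub>?R\<^esub> T) \<otimes>\<^bsub>?R\<^esub> U = S \<otimes>\<^bsub>?R\<^esub> U \<oplus>\<^bsub>?R\<^esub> T \<otimes>\<^bsub>?R\<^esub> U"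
    by (simp add: reduced_cstar_algebra_def)
  note S' = reduced_cstar_carrierD(1)[OF S] and T' = reduced_cstar_carrierD(1)[OF T]
    and U' = reduced_cstar_carrierD(1)[OF U]
  have "U (\<lambda>x. S \<xi> x + T \<xi> x) = (\<lambda>x. U (S \<xi>) x + U (T \<xi>) x)" for \<xi>
  proof (cases "\<xi> \<in> ell2 (carrier G)")
    case True
    then show ?thesis
      by (intro bounded_operatorsD(3)[OF U'] bounded_operatorsD(2)[OF S'] bounded_operatorsD(2)[OF T'])
  next
    case False
    then show ?thesis
      by (simp add: bounded_operatorsD(1)[OF S'] bounded_operatorsD(1)[OF T']
          bounded_operators_zero_arg[OF U'])
  qed
  then show "U \<otimes>\<^bsub>?R\<^esub> (S \<oplus>\<^bsub>?R\<^esub> T) = U \<otimes>\<^bsub>?R\<^esub> S \<oplus>\<^bsub>?R\<^esub> U \<otimes>\<^bsub>?R\<^esub> T"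
    by (simp add: reduced_cstar_algebra_def)
qed

end

end

theory Submission
  imports Defs "HOL-Library.Function_Algebras"
begin

text \<open>
  For every \<open>c\<close> the isomorphism of \<open>G\<close> and the free group \<open>F\<close> modulo the \<open>c\<close>-th terms of the lower
  central series, followed by the Magnus embedding of \<open>F\<close>, represents \<open>G\<close> modulo terms of
  order \<open>c\<close> by noncommutative integral power series. By the theorem of Magnus and Witt this
  representation detects the lower central series: \<open>g\<close> lies in its \<open>m\<close>-th term iff the series
  of \<open>g\<close> is \<open>1\<close> up to terms of order \<open>m\<close>. Elements whose series have right independent
  leading parts generate a free group: substituting these series for the variables of the Magnus
  expansion of a nontrivial reduced word cannot yield \<open>1\<close>.

  Any generating set contains \<open>r\<close> elements whose images in the abelianization are linearly
  independent; their leading parts are independent linear forms, so they generate a free group.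
  For simplicity of the reduced C*-algebra, let finitely many \<open>x \<noteq> 1\<close> be given and take two
  independent elements \<open>t\<close>, \<open>t'\<close>. For all but finitely many \<open>k\<close> the linear form of
  \<open>t t'\<^sup>k\<close> does not divide the leading part of any \<open>x\<close> from the left; the exceptions may depend on
  \<open>c\<close>, but by the pigeonhole principle one \<open>k\<close> is good for infinitely many \<open>c\<close>, and then
  \<open>t t'\<^sup>k\<close> is free from each \<open>x\<close>. Averaging over conjugates by the powers of this element
  (Powers' argument) moves a suitable element of a nonzero ideal close to \<open>1\<close>.
\<close>

section \<open>Noncommutative power series\<close>

text \<open>The isomorphisms for different \<open>c\<close> need not be compatible, so they do not
  assemble to one map of \<open>G\<close> into power series. All statements are therefore made
  modulo order \<open>c\<close>, and whatever is carried from one \<open>c\<close> to another has to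
  be intrinsic: the depth of an element in the lower central series, and relations between linear
  parts. A relation is refuted in the lowest degree that survives in the expansion of its word. This
  degree depends on the word, hence independence is required for unboundedly many \<open>c\<close>.
  Right independence is what makes substitution injective: a relation between products of leading
  parts is stripped of its first factors one by one until integer coefficients remain. It also
  survives the elimination of a generator, since powers of \<open>ad\<close> expand unitriangularly,
  and so it carries the hard half of the Magnus-Witt theorem. In Powers' argument a sum of N
  conjugates of \<open>x\<close> has norm at most 2 sqrt N, so the average tends to 0. As ideals are
  not assumed closed, the average is finally inverted by a Neumann series.\<close>

typedef 'x nc_series = "UNIV :: ('x list \<Rightarrow> int) set"
  morphisms coeff nc_series ..

setup_lifting type_definition_nc_series

lemma nc_series_eqI: "(\<And>w. coeff f w = coeff g w) \<Longrightarrow> f = g"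
  by (metis coeff_inverse ext)

text \<open>The coefficient at \<open>w\<close> is the sum of \<open>f u * g v\<close> over all
  splittings \<open>w = u @ v\<close>. Recursion on the first letter turns the ring laws into
  inductions on words.\<close>

fun cauchy :: "('x list \<Rightarrow> int) \<Rightarrow> ('x list \<Rightarrow> int) \<Rightarrow> 'x list \<Rightarrow> int" where
  "cauchy f g [] = f [] * g []"
| "cauchy f g (x # w) = f [] * g (x # w) + cauchy (\<lambda>v. f (x # v)) g w"

lemma cauchy_add_left: "cauchy (\<lambda>v. f v + f' v) g w = cauchy f g w + cauchy f' g w"
  by (induction w arbitrary: f f') (simp_all add: algebra_simps)

lemma cauchy_scale_left: "cauchy (\<lambda>v. c * f v) g w = c * cauchy f g w"
  by (induction f g w rule: cauchy.induct) (simp_all add: algebra_simps)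

lemma cauchy_add_right: "cauchy f (\<lambda>v. g v + g' v) w = cauchy f g w + cauchy f g' w"
  by (induction f g w rule: cauchy.induct) (simp_all add: algebra_simps)

lemma cauchy_zero_left: "cauchy (\<lambda>v. 0) g w = 0"
  by (induction "\<lambda>v::'a list. 0::int" g w rule: cauchy.induct) simp_all

lemma cauchy_one_left: "cauchy (\<lambda>v. if v = [] then 1 else 0) g w = g w"
  by (cases w) (simp_all add: cauchy_zero_left)

lemma cauchy_one_right: "cauchy f (\<lambda>v. if v = [] then 1 else 0) w = f w"
  by (induction f "\<lambda>v::'a list. if v = [] then 1 else 0 :: int" w rule: cauchy.induct) simp_all

lemma cauchy_assoc: "cauchy (cauchy f g) h w = cauchy f (cauchy g h) w"
proof (induction w arbitrary: f g)
  case (Cons x w)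
  have "cauchy (\<lambda>v. cauchy f g (x # v)) h w =
      f [] * cauchy (\<lambda>v. g (x # v)) h w + cauchy (cauchy (\<lambda>v. f (x # v)) g) h w"
    by (simp add: cauchy_add_left cauchy_scale_left)
  then show ?case
    by (simp add: Cons.IH algebra_simps)
qed simp

text \<open>A separate type is used since \<open>Function_Algebras\<close> makes the pointwise
  product the product of functions.\<close>

instantiation nc_series :: (type) ring_1
begin

lift_definition zero_nc_series :: "'a nc_series" is "\<lambda>_. 0" .
lift_definition one_nc_series :: "'a nc_series" is "\<lambda>w. if w = [] then 1 else 0" .
lift_definition plus_nc_series :: "'a nc_series \<Rightarrow> 'a nc_series \<Rightarrow> 'a nc_series"
  is "\<lambda>f g w. f w + g w" .
lift_definition minus_nc_series :: "'a nc_series \<Rightarrow> 'a nc_series \<Rightarrow> 'a nc_series"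
  is "\<lambda>f g w. f w - g w" .
lift_definition uminus_nc_series :: "'a nc_series \<Rightarrow> 'a nc_series" is "\<lambda>f w. - f w" .
lift_definition times_nc_series :: "'a nc_series \<Rightarrow> 'a nc_series \<Rightarrow> 'a nc_series" is cauchy .

instance
proof
  show "(0::'a nc_series) \<noteq> 1"
    by transfer (auto dest: fun_cong[of _ _ "[]"])
qed (transfer; simp add: fun_eq_iff cauchy_assoc cauchy_one_left cauchy_one_right
    cauchy_add_left cauchy_add_right)+

end

lemma coeff_simps [simp]:
  "coeff 0 w = 0" "coeff (f + g) w = coeff f w + coeff g w"
  "coeff (f - g) w = coeff f w - coeff g w" "coeff (- f) w = - coeff f w"
  by (transfer, simp)+

lemma coeff_1: "coeff 1 w = (if w = [] then 1 else 0)"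
  by transfer simp

lemma coeff_sum: "coeff (sum f A) w = (\<Sum>a\<in>A. coeff (f a) w)"
  by (induction A rule: infinite_finite_induct) simp_all

lemma coeff_of_int_mult [simp]: "coeff (of_int c * f) w = c * coeff f w"
proof -
  have nat: "coeff (of_nat n * f) w = int n * coeff f w" for n
    by (induction n) (simp_all add: algebra_simps)
  show ?thesis
    by (cases c rule: int_cases2) (simp_all add: nat)
qed

text \<open>Left division by the variable \<open>x\<close>, discarding all words with another first
  letter; inductions over products proceed along it.\<close>

lift_definition lquot :: "'x \<Rightarrow> 'x nc_series \<Rightarrow> 'x nc_series" is "\<lambda>x f w. f (x # w)" .

lemma coeff_lquot [simp]: "coeff (lquot x f) w = coeff f (x # w)"
  by transfer simp

lemma coeff_mult_Nil [simp]: "coeff (f * g) [] = coeff f [] * coeff g []"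
  by transfer simp

lemma coeff_mult_Cons: "coeff (f * g) (x # w) = coeff f [] * coeff g (x # w) + coeff (lquot x f * g) w"
  by transfer simp

section \<open>Filtration by order and lowest terms\<close>

definition ord_ge :: "nat \<Rightarrow> 'x nc_series set" where
  "ord_ge n = {f. \<forall>w. length w < n \<longrightarrow> coeff f w = 0}"

lemma ord_geI: "(\<And>w. length w < n \<Longrightarrow> coeff f w = 0) \<Longrightarrow> f \<in> ord_ge n"
  by (simp add: ord_ge_def)

lemma ord_geD: "f \<in> ord_ge n \<Longrightarrow> length w < n \<Longrightarrow> coeff f w = 0"
  by (simp add: ord_ge_def)

lemma ord_ge_0 [simp]: "f \<in> ord_ge 0"
  by (simp add: ord_ge_def)

lemma ord_ge_1: "f \<in> ord_ge 1 \<longleftrightarrow> coeff f [] = 0"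
  by (simp add: ord_ge_def)

lemma ord_ge_anti: "f \<in> ord_ge n \<Longrightarrow> m \<le> n \<Longrightarrow> f \<in> ord_ge m"
  by (simp add: ord_ge_def)

lemma ord_ge_zero [simp]: "0 \<in> ord_ge n"
  by (simp add: ord_ge_def)

lemma ord_ge_add: "f \<in> ord_ge n \<Longrightarrow> g \<in> ord_ge n \<Longrightarrow> f + g \<in> ord_ge n"
  by (simp add: ord_ge_def)

lemma ord_ge_uminus: "f \<in> ord_ge n \<Longrightarrow> - f \<in> ord_ge n"
  by (simp add: ord_ge_def)

lemma ord_ge_diff: "f \<in> ord_ge n \<Longrightarrow> g \<in> ord_ge n \<Longrightarrow> f - g \<in> ord_ge n"
  by (simp add: ord_ge_def)

lemma ord_ge_sum: "(\<And>a. a \<in> A \<Longrightarrow> f a \<in> ord_ge n) \<Longrightarrow> sum f A \<in> ord_ge n"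
  by (simp add: ord_ge_def coeff_sum)

lemma lquot_ord_ge: "f \<in> ord_ge (Suc n) \<Longrightarrow> lquot x f \<in> ord_ge n"
  by (simp add: ord_ge_def)

lemma ord_ge_mult: "f \<in> ord_ge m \<Longrightarrow> g \<in> ord_ge n \<Longrightarrow> f * g \<in> ord_ge (m + n)"
proof (rule ord_geI)
  fix w :: "'a list"
  show "f \<in> ord_ge m \<Longrightarrow> g \<in> ord_ge n \<Longrightarrow> length w < m + n \<Longrightarrow> coeff (f * g) w = 0"
  proof (induction w arbitrary: f m)
    case Nil
    then show ?case by (cases m) (auto dest: ord_geD[of _ _ "[]"])
  next
    case (Cons x w)
    show ?case
    proof (cases m)
      case 0
      have "coeff (lquot x f * g) w = 0"
        using Cons.prems 0 by (intro Cons.IH[of _ 0]) auto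
      then show ?thesis using Cons.prems 0 ord_geD[of g n "x # w"] by (simp add: coeff_mult_Cons)
    next
      case (Suc m')
      then have "coeff (lquot x f * g) w = 0"
        using Cons.prems by (intro Cons.IH[of _ m']) (auto intro: lquot_ord_ge)
      then show ?thesis using Cons.prems Suc ord_geD[of f m "[]"] by (simp add: coeff_mult_Cons)
    qed
  qed
qed

lemma ord_ge_mult_left: "g \<in> ord_ge n \<Longrightarrow> f * g \<in> ord_ge n"
  using ord_ge_mult[of f 0 g n] by simp

lemma ord_ge_mult_right: "f \<in> ord_ge n \<Longrightarrow> f * g \<in> ord_ge n"
  using ord_ge_mult[of f n g 0] by simp

text \<open>Any other splitting of \<open>u @ v\<close> gives one of the factors a word shorter than
  its order, so a single term survives.\<close>

lemma coeff_mult_append: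
  assumes "f \<in> ord_ge (length u)" "g \<in> ord_ge (length v)"
  shows "coeff (f * g) (u @ v) = coeff f u * coeff g v"
  using assms(1)
proof (induction u arbitrary: f)
  case Nil
  show ?case
  proof (cases v)
    case (Cons x v')
    then have "coeff (lquot x f * g) v' = 0"
      using ord_geD[OF ord_ge_mult_left[OF assms(2)], of v'] by simp
    then show ?thesis using Cons by (simp add: coeff_mult_Cons)
  qed simp
next
  case (Cons x u)
  then have "coeff f [] = 0" "lquot x f \<in> ord_ge (length u)"
    using ord_geD[of f "length (x # u)" "[]"] by (auto intro: lquot_ord_ge)
  then show ?case using Cons.IH[of "lquot x f"] by (simp add: coeff_mult_Cons)
qed

lemma ord_ge_exact:
  assumes "f \<noteq> 0"
  obtains n u where "f \<in> ord_ge n" "length u = n" "coeff f u \<noteq> 0"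
proof -
  obtain w where "coeff f w \<noteq> 0" using assms nc_series_eqI[of f 0] by fastforce
  then have ex: "\<exists>n w. length w = n \<and> coeff f w \<noteq> 0" by blast
  define n where "n = (LEAST n. \<exists>w. length w = n \<and> coeff f w \<noteq> 0)"
  obtain u where "length u = n" "coeff f u \<noteq> 0"
    using LeastI_ex[OF ex] unfolding n_def by blast
  moreover have "f \<in> ord_ge n"
    using not_less_Least[of _ "\<lambda>n. \<exists>w. length w = n \<and> coeff f w \<noteq> 0"]
    unfolding n_def by (intro ord_geI) blast
  ultimately show ?thesis using that by blast
qed

lemma nc_series_no_zero_divisors:
  fixes f g :: "'x nc_series"
  assumes "f * g = 0" "g \<noteq> 0" shows "f = 0"
proof (rule ccontr)
  assume "f \<noteq> 0"
  then obtain u v where "f \<in> ord_ge (length u)" "coeff f u \<noteq> 0" "g \<in> ord_ge (length v)" "coeff g v \<noteq> 0"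
    using ord_ge_exact[of f] ord_ge_exact[OF assms(2)] by metis
  then show False using coeff_mult_append[of f u g v] assms(1) by simp
qed

text \<open>If \<open>f\<close> has order \<open>m\<close>, then \<open>u * f\<close> has order
  \<open>Suc m\<close>, and \<open>f = (1 + u) * f - u * f\<close> gains one order as long as
  \<open>m < n\<close>.\<close>

lemma ord_ge_cancel:
  assumes "u \<in> ord_ge 1" "(1 + u) * f \<in> ord_ge n"
  shows "f \<in> ord_ge n"
proof -
  have "f \<in> ord_ge m" if "m \<le> n" for m
    using that
  proof (induction m)
    case (Suc m)
    then have "u * f \<in> ord_ge (Suc m)" using ord_ge_mult[OF assms(1), of f m] by simp
    moreover have "f = (1 + u) * f - u * f" by (simp add: algebra_simps)
    ultimately show ?case
      using ord_ge_anti[OF assms(2) Suc.prems] ord_ge_diff by metis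
  qed simp
  then show ?thesis by blast
qed

lemma eq_0_if_ord_ge: "(\<And>n. f \<in> ord_ge n) \<Longrightarrow> f = 0"
  using ord_geD[of f "Suc (length _)"] by (intro nc_series_eqI) auto

section \<open>Homogeneous parts\<close>

lift_definition hpart :: "nat \<Rightarrow> 'x nc_series \<Rightarrow> 'x nc_series" is
  "\<lambda>n f w. if length w = n then f w else 0" .

lemma coeff_hpart: "coeff (hpart n f) w = (if length w = n then coeff f w else 0)"
  by transfer simp

lemma hpart_simps [simp]:
  "hpart n 0 = 0" "hpart n (f + g) = hpart n f + hpart n g" "hpart n (f - g) = hpart n f - hpart n g"
  "hpart n (- f) = - hpart n f" "hpart n (of_int c * f) = of_int c * hpart n f"
  by (rule nc_series_eqI; simp add: coeff_hpart)+

lemma hpart_sum: "hpart n (sum f A) = (\<Sum>a\<in>A. hpart n (f a))"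
  by (rule nc_series_eqI) (simp add: coeff_hpart coeff_sum)

lemma hpart_eq_0: "f \<in> ord_ge (Suc n) \<Longrightarrow> hpart n f = 0"
  by (rule nc_series_eqI) (simp add: coeff_hpart ord_geD)

lemma ord_ge_SucI: "f \<in> ord_ge n \<Longrightarrow> hpart n f = 0 \<Longrightarrow> f \<in> ord_ge (Suc n)"
  by (rule ord_geI) (metis coeff_hpart coeff_simps(1) less_Suc_eq ord_geD)

lemma hpart_ord_ge: "hpart n f \<in> ord_ge n"
  by (rule ord_geI) (simp add: coeff_hpart)

lemma hpart_cong: "f - g \<in> ord_ge (Suc n) \<Longrightarrow> hpart n f = hpart n g"
  using hpart_eq_0[of "f - g" n] by simp

lemma hpart_mult:
  assumes "f \<in> ord_ge m" "g \<in> ord_ge n"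
  shows "hpart (m + n) (f * g) = hpart m f * hpart n g"
proof (rule nc_series_eqI)
  fix w
  have Z: "coeff (hpart m f * hpart n g) w = 0" if "length w \<noteq> m + n"
    using that
  proof (induction w arbitrary: m f)
    case Nil
    then show ?case by (auto simp: coeff_hpart)
  next
    case (Cons x w)
    show ?case
    proof (cases m)
      case 0
      then have "lquot x (hpart m f) = 0" by (intro nc_series_eqI) (simp add: coeff_hpart)
      then show ?thesis using Cons.prems 0 by (simp add: coeff_mult_Cons coeff_hpart)
    next
      case (Suc m')
      then have "lquot x (hpart m f) = hpart m' (lquot x f)"
        by (intro nc_series_eqI) (simp add: coeff_hpart)
      then show ?thesis using Cons Suc by (simp add: coeff_mult_Cons coeff_hpart)
    qed
  qed
  show "coeff (hpart (m + n) (f * g)) w = coeff (hpart m f * hpart n g) w"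
  proof (cases "length w = m + n")
    case True
    define u v where "u = take m w" and "v = drop m w"
    have w: "w = u @ v" "length u = m" "length v = n" using True by (auto simp: u_def v_def)
    have "coeff (f * g) w = coeff f u * coeff g v"
      "coeff (hpart m f * hpart n g) w = coeff (hpart m f) u * coeff (hpart n g) v"
      unfolding w(1) by (rule coeff_mult_append; use assms w hpart_ord_ge in auto)+
    then show ?thesis using True w by (simp add: coeff_hpart)
  qed (simp add: Z coeff_hpart)
qed

section \<open>The group of series with constant term 1\<close>

definition unit_series :: "'x nc_series monoid" where
  "unit_series = \<lparr>carrier = {f. coeff f [] = 1}, monoid.mult = (*), one = 1\<rparr>"

lemma unit_series_inverse:
  assumes "coeff f [] = 1"
  shows "\<exists>g. coeff g [] = 1 \<and> g * f = 1"
proof -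
  define N where "N = 1 - f"
  have N: "N \<in> ord_ge 1" using assms unfolding ord_ge_1 by (simp add: N_def coeff_1)
  have Nn: "N ^ n \<in> ord_ge n" for n
  proof (induction n)
    case (Suc n)
    then show ?case using ord_ge_mult[OF N Suc] by simp
  qed simp
  define P where "P n = (\<Sum>i<n. N ^ i)" for n
  \<comment> \<open>The coefficient at \<open>w\<close> is stable from the partial sum with
    \<open>Suc (length w)\<close> terms on, because later powers of \<open>N\<close> have larger
    order.\<close>
  define g where "g = nc_series (\<lambda>w. coeff (P (Suc (length w))) w)"
  have P_diff: "P (n + k) - P n \<in> ord_ge n" for n k
  proof (induction k)
    case (Suc k)
    have "N ^ (n + k) \<in> ord_ge n" by (rule ord_ge_anti[OF Nn]) simp
    from ord_ge_add[OF Suc this] show ?case by (simp add: P_def algebra_simps)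
  qed (simp add: P_def)
  have g: "g - P n \<in> ord_ge n" for n
  proof (rule ord_geI)
    fix w :: "'a list" assume "length w < n"
    then obtain k where n: "n = Suc (length w) + k" using less_imp_Suc_add by fastforce
    have "coeff (P n - P (Suc (length w))) w = 0"
      unfolding n by (rule ord_geD[OF P_diff]) simp
    then show "coeff (g - P n) w = 0"
      by (simp add: g_def nc_series_inverse)
  qed
  have tel: "P n * (1 - N) = 1 - N ^ n" for n
  proof (induction n)
    case (Suc n)
    have "P (Suc n) * (1 - N) = P n * (1 - N) + N ^ n * (1 - N)"
      by (simp add: P_def algebra_simps)
    then show ?case by (simp only: Suc power_Suc2) (simp add: algebra_simps)
  qed (simp add: P_def)
  have "g * f - 1 \<in> ord_ge n" for n
  proof -
    have "g * f - 1 = (g - P n) * (1 - N) - N ^ n"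
      using tel[of n] by (simp add: N_def algebra_simps)
    then show ?thesis
      using ord_ge_diff[OF ord_ge_mult_right[OF g] Nn] by metis
  qed
  then have gf: "g * f = 1" using eq_0_if_ord_ge[of "g * f - 1"] by simp
  moreover have "coeff g [] = 1" using arg_cong[OF gf, of "\<lambda>h. coeff h []"] assms by (simp add: coeff_1)
  ultimately show ?thesis by blast
qed

lemma group_unit_series: "group unit_series"
  by (rule groupI) (auto simp: unit_series_def mult.assoc coeff_1 unit_series_inverse)

section \<open>Commutator calculus in the lower central series\<close>

definition commutator :: "('a, 'b) monoid_scheme \<Rightarrow> 'a \<Rightarrow> 'a \<Rightarrow> 'a" where
  "commutator G x y = x \<otimes>\<^bsub>G\<^esub> y \<otimes>\<^bsub>G\<^esub> inv\<^bsub>G\<^esub> x \<otimes>\<^bsub>G\<^esub> inv\<^bsub>G\<^esub> y"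

context group
begin

abbreviation cm where "cm \<equiv> commutator G"
abbreviation lc where "lc \<equiv> lower_central G"

lemma inv_cancel_left: "x \<in> carrier G \<Longrightarrow> z \<in> carrier G \<Longrightarrow> inv x \<otimes> (x \<otimes> z) = z"
  "x \<in> carrier G \<Longrightarrow> z \<in> carrier G \<Longrightarrow> x \<otimes> (inv x \<otimes> z) = z"
  by (simp_all add: m_assoc[symmetric])

lemmas group_simps = m_assoc inv_mult_group inv_cancel_left commutator_def

lemma cm_closed [simp]: "x \<in> carrier G \<Longrightarrow> y \<in> carrier G \<Longrightarrow> cm x y \<in> carrier G"
  by (simp add: commutator_def)

lemma cm_identities:
  assumes "x \<in> carrier G" "y \<in> carrier G" "z \<in> carrier G"
  shows cm_mult_left: "cm (x \<otimes> y) z = x \<otimes> cm y z \<otimes> inv x \<otimes> cm x z"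
    and cm_mult_right: "cm x (y \<otimes> z) = cm x y \<otimes> (y \<otimes> cm x z \<otimes> inv y)"
    and cm_swap: "inv (cm x y) = cm y x"
    and cm_inv_left: "cm (inv x) y = inv x \<otimes> inv (cm x y) \<otimes> x"
    and cm_inv_right: "cm x (inv y) = inv y \<otimes> inv (cm x y) \<otimes> y"
    and conj_eq_cm: "x \<otimes> y \<otimes> inv x = cm x y \<otimes> y"
    and hall_witt: "(inv y \<otimes> cm (cm y (inv x)) (inv z) \<otimes> y) \<otimes>
      ((inv z \<otimes> cm (cm z (inv y)) (inv x) \<otimes> z) \<otimes> (inv x \<otimes> cm (cm x (inv z)) (inv y) \<otimes> x)) = \<one>"
  using assms by (simp_all add: group_simps)

lemma lc_normal: "lc n \<lhd> G"
  by (rule lower_central_normal) (rule is_group)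

lemma lc_subgroup: "subgroup (lc n) G"
  using lc_normal by (rule normal_imp_subgroup)

lemma lc_carrier: "x \<in> lc n \<Longrightarrow> x \<in> carrier G"
  using subgroup.mem_carrier[OF lc_subgroup] .

lemma lc_mult: "x \<in> lc n \<Longrightarrow> y \<in> lc n \<Longrightarrow> x \<otimes> y \<in> lc n"
  using subgroup.m_closed[OF lc_subgroup] .

lemma lc_inv: "x \<in> lc n \<Longrightarrow> inv x \<in> lc n"
  using subgroup.m_inv_closed[OF lc_subgroup] .

lemma lc_one: "\<one> \<in> lc n"
  using subgroup.one_closed[OF lc_subgroup] .

lemma lc_conj: "x \<in> carrier G \<Longrightarrow> h \<in> lc n \<Longrightarrow> x \<otimes> h \<otimes> inv x \<in> lc n"
  using normal.inv_op_closed2[OF lc_normal] .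

lemma lc_conj': "x \<in> carrier G \<Longrightarrow> h \<in> lc n \<Longrightarrow> inv x \<otimes> h \<otimes> x \<in> lc n"
  using normal.inv_op_closed1[OF lc_normal] .

lemma lc_Suc_cm: "x \<in> lc (Suc n) \<Longrightarrow> y \<in> carrier G \<Longrightarrow> cm x y \<in> lc (Suc (Suc n))"
  by (auto simp: commutator_def lower_central.simps(3) intro!: generate.incl)

declare lower_central.simps(3) [simp del]

lemma lc_Suc_subset: "lc (Suc n) \<subseteq> lc n"
proof (cases n)
  case (Suc k)
  have "generate G {x \<otimes> y \<otimes> inv x \<otimes> inv y | x y. x \<in> lc (Suc k) \<and> y \<in> carrier G} \<subseteq> lc (Suc k)"
  proof (rule generate_subgroup_incl[OF _ lc_subgroup], clarify)
    fix x y assume xy: "x \<in> lc (Suc k)" "y \<in> carrier G"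
    then have "x \<otimes> (y \<otimes> inv x \<otimes> inv y) \<in> lc (Suc k)"
      by (intro lc_mult lc_conj lc_inv)
    then show "x \<otimes> y \<otimes> inv x \<otimes> inv y \<in> lc (Suc k)"
      using xy lc_carrier by (simp add: m_assoc)
  qed
  then show ?thesis by (simp add: Suc lower_central.simps(3))
qed simp

lemma lc_anti: "m \<le> n \<Longrightarrow> lc n \<subseteq> lc m"
  using lc_Suc_subset by (rule lift_Suc_antimono_le)

lemma lc_antiD: "x \<in> lc n \<Longrightarrow> m \<le> n \<Longrightarrow> x \<in> lc m"
  using lc_anti by blast

text \<open>Three subgroups argument: on a generator \<open>h = cm a b\<close> the Hall-Witt
  identity trades \<open>cm h g\<close> for double commutators in which \<open>a\<close>, of smaller
  depth, meets \<open>g\<close> or \<open>cm (inv b) g\<close>. The latter is one step deeper than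
  \<open>g\<close>, hence \<open>m\<close> is generalized in the induction.\<close>

lemma cm_lc_Suc:
  "h \<in> lc (Suc n) \<Longrightarrow> g \<in> lc (Suc m) \<Longrightarrow> cm h g \<in> lc (Suc (Suc (m + n)))"
proof (induction n arbitrary: m g h)
  case 0
  then have "cm g h \<in> lc (Suc (Suc m))" by (intro lc_Suc_cm) (auto intro: lc_carrier)
  then have "inv (cm g h) \<in> lc (Suc (Suc m))" by (rule lc_inv)
  then show ?case using 0 lc_carrier[of g] lc_carrier[of h] by (simp add: cm_swap)
next
  case (Suc n)
  let ?K = "lc (Suc (Suc (m + Suc n)))"
  have gc: "g \<in> carrier G" using Suc.prems lc_carrier by blast
  have gen: "cm (cm a b) g \<in> ?K" if a: "a \<in> lc (Suc n)" and b: "b \<in> carrier G" for a b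
  proof -
    have ac: "a \<in> carrier G" using a lc_carrier by blast
    have swap: "cm x y \<in> lc k" if "cm y x \<in> lc k" "x \<in> carrier G" "y \<in> carrier G" for x y k
      using lc_inv[OF that(1)] that by (simp add: cm_swap)
    have "cm (inv g) (inv a) \<in> lc (Suc (Suc (m + n)))"
      using a Suc.prems ac gc by (intro swap[OF Suc.IH]) (auto intro: lc_inv)
    then have "cm (cm (inv g) (inv a)) b \<in> ?K" using lc_Suc_cm[OF _ b] by simp
    then have 1: "g \<otimes> cm (cm (inv g) (inv a)) b \<otimes> inv g \<in> ?K"
      using gc by (rule lc_conj[rotated])
    have "cm (inv b) g \<in> lc (Suc (Suc m))"
      using Suc.prems(2) b gc by (intro swap[OF lc_Suc_cm]) auto
    then have "cm (cm (inv b) g) (inv a) \<in> ?K"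
      using Suc.IH[of "inv a" "cm (inv b) g" "Suc m"] a ac b gc
      by (subst cm_swap[symmetric]) (auto intro!: lc_inv)
    then have 2: "b \<otimes> cm (cm (inv b) g) (inv a) \<otimes> inv b \<in> ?K"
      using b by (rule lc_conj[rotated])
    let ?c = "inv a \<otimes> cm (cm a b) g \<otimes> a"
    \<comment> \<open>Inverses are inserted into the identity so that its first factor is a
      conjugate of \<open>cm (cm a b) g\<close> itself.\<close>
    have "?c \<otimes> ((g \<otimes> cm (cm (inv g) (inv a)) b \<otimes> inv g) \<otimes> (b \<otimes> cm (cm (inv b) g) (inv a) \<otimes> inv b)) = \<one>"
      (is "?c \<otimes> ?d = _")
      using hall_witt[of "inv b" a "inv g"] ac b gc by (simp only: inv_inv inv_closed)
    then have "inv ?d = ?c" by (rule inv_equality) (use ac b gc in simp_all)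
    then have "?c \<in> ?K" using lc_inv[OF lc_mult[OF 1 2]] by simp
    then have "a \<otimes> ?c \<otimes> inv a \<in> ?K" using ac by (rule lc_conj[rotated])
    moreover have "a \<otimes> ?c \<otimes> inv a = cm (cm a b) g"
      using ac b gc by (simp add: m_assoc inv_cancel_left)
    ultimately show ?thesis by simp
  qed
  have "h \<in> generate G {x \<otimes> y \<otimes> inv x \<otimes> inv y | x y. x \<in> lc (Suc n) \<and> y \<in> carrier G}"
    using Suc.prems(1) by (simp add: lower_central.simps(3))
  then have "h \<in> carrier G \<and> cm h g \<in> ?K"
  proof induction
    case one
    then show ?case using gc lc_one by (simp add: commutator_def)
  next
    case (incl h)
    then show ?case using gen lc_carrier by (auto simp: commutator_def[symmetric])
  next
    case (inv h)
    then obtain x y where xy: "h = cm x y" "x \<in> lc (Suc n)" "y \<in> carrier G"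
      by (auto simp: commutator_def)
    then have h: "h \<in> carrier G" "cm h g \<in> ?K" using gen lc_carrier by auto
    then have "inv h \<otimes> inv (cm h g) \<otimes> h \<in> ?K" by (intro lc_conj' lc_inv)
    then show ?case using h gc by (simp add: cm_inv_left)
  next
    case (eng h1 h2)
    then have "h1 \<otimes> cm h2 g \<otimes> inv h1 \<otimes> cm h1 g \<in> ?K" by (intro lc_mult lc_conj) auto
    then show ?case using eng gc by (simp add: cm_mult_left)
  qed
  then show ?case ..
qed

lemma cm_lc: "h \<in> lc n \<Longrightarrow> g \<in> lc m \<Longrightarrow> n \<ge> 1 \<Longrightarrow> m \<ge> 1 \<Longrightarrow> cm h g \<in> lc (n + m)"
  using cm_lc_Suc[of h "n - 1" g "m - 1"] by (cases n; cases m) (simp_all add: add.commute)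

lemma coset_eq_iff:
  assumes "K \<lhd> G" "u \<in> carrier G" "v \<in> carrier G"
  shows "K #> u = K #> v \<longleftrightarrow> u \<otimes> inv v \<in> K"
proof -
  have K: "subgroup K G" using assms(1) by (rule normal_imp_subgroup)
  show ?thesis
  proof
    assume "K #> u = K #> v"
    then have "u \<in> K #> v" using K assms(2) rcos_self by blast
    then show "u \<otimes> inv v \<in> K"
      using assms(3) subgroup.mem_carrier[OF K] by (auto simp: r_coset_def m_assoc)
  next
    assume "u \<otimes> inv v \<in> K"
    then have "u \<otimes> inv v \<otimes> v \<in> K #> v" by (auto simp: r_coset_def)
    then have "u \<in> K #> v" using assms by (simp add: m_assoc)
    then show "K #> u = K #> v" using repr_independence[OF _ _ K] assms by metis
  qed
qed

text \<open>An exact expansion of \<open>cm a (cm b z)\<close> has the factors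
  \<open>cm b B\<close>, \<open>cm b z\<close>, \<open>cm A B\<close>, \<open>cm A z\<close> and
  \<open>inv (cm b z)\<close>, some of them conjugated. Modulo \<open>?K\<close> the conjugations
  disappear and \<open>cm A B\<close> is trivial; then \<open>cm b z\<close> cancels against its
  inverse.\<close>

lemma cm_jacobi:
  assumes a: "a \<in> lc p" "p \<ge> 1" and b: "b \<in> lc m" "m \<ge> 1" and z: "z \<in> lc n" "n \<ge> 1"
  shows "\<exists>e\<in>lc (Suc (p + (m + n))). cm a (cm b z) = e \<otimes> (cm b (cm a z) \<otimes> cm (cm a b) z)"
proof -
  let ?K = "lc (Suc (p + (m + n)))"
  define A where "A = cm a b"
  define B where "B = cm a z"
  have c: "a \<in> carrier G" "b \<in> carrier G" "z \<in> carrier G" using a b z lc_carrier by blast+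
  have AB: "A \<in> lc (p + m)" "B \<in> lc (p + n)" unfolding A_def B_def using a b z cm_lc by blast+
  have ABc: "A \<in> carrier G" "B \<in> carrier G" using AB lc_carrier by blast+
  have deep: "x \<in> ?K" if "x \<in> lc k" "Suc (p + (m + n)) \<le> k" for x k
    using lc_antiD that by blast
  note [simp] = c ABc
  have conj: "?K #> (x \<otimes> y \<otimes> inv x) = ?K #> y" if "cm x y \<in> ?K" "x \<in> carrier G" "y \<in> carrier G" for x y
    using that by (simp add: coset_eq_iff[OF lc_normal] m_assoc) (simp add: commutator_def m_assoc)
  have bB: "cm b B \<in> lc (m + (p + n))" and Az: "cm A z \<in> lc (p + m + n)" and bz: "cm b z \<in> lc (m + n)"
    using cm_lc AB b z by auto
  have 1: "?K #> (A \<otimes> cm b B \<otimes> inv A) = ?K #> cm b B"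
    by (rule conj, rule deep[OF cm_lc[OF AB(1) bB]]) (use b z a in auto)
  have "A \<otimes> B \<in> lc (Suc p)"
    using AB b z by (intro lc_mult) (auto elim!: lc_antiD)
  then have 2: "?K #> (A \<otimes> B \<otimes> cm b z \<otimes> inv (A \<otimes> B)) = ?K #> cm b z"
    by (rule conj[OF deep[OF cm_lc[OF _ bz]]]) (use b z a in auto)
  have 3: "?K #> cm A B = ?K #> \<one>"
    by (subst coset_eq_iff[OF lc_normal]; simp)
      (rule deep[OF cm_lc[OF AB]], use b z a in auto)
  have 4: "?K #> (B \<otimes> cm A z \<otimes> inv B) = ?K #> cm A z"
    by (rule conj, rule deep[OF cm_lc[OF AB(2) Az]]) (use b z a in auto)
  have 5: "?K #> (cm b z \<otimes> cm A z \<otimes> inv (cm b z)) = ?K #> cm A z"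
    by (rule conj, rule deep[OF cm_lc[OF bz Az]]) (use b z a in auto)
  note S = normal.rcos_sum[OF lc_normal]
  have "cm a (cm b z) = (A \<otimes> cm b B \<otimes> inv A) \<otimes> ((A \<otimes> B \<otimes> cm b z \<otimes> inv (A \<otimes> B)) \<otimes>
      (cm A B \<otimes> ((B \<otimes> cm A z \<otimes> inv B) \<otimes> inv (cm b z))))"
    unfolding A_def B_def using c by (simp add: group_simps)
  then have "?K #> cm a (cm b z) = (?K #> (A \<otimes> cm b B \<otimes> inv A)) <#> ((?K #> (A \<otimes> B \<otimes> cm b z \<otimes> inv (A \<otimes> B))) <#>
      ((?K #> cm A B) <#> ((?K #> (B \<otimes> cm A z \<otimes> inv B)) <#> (?K #> inv (cm b z)))))"
    by (simp add: S)
  also have "\<dots> = ?K #> (cm b B \<otimes> (cm b z \<otimes> (\<one> \<otimes> (cm A z \<otimes> inv (cm b z)))))"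
    unfolding 1 2 3 4 by (simp add: S)
  also have "\<dots> = (?K #> cm b B) <#> (?K #> (cm b z \<otimes> cm A z \<otimes> inv (cm b z)))"
    by (simp add: S m_assoc)
  also have "\<dots> = ?K #> (cm b B \<otimes> cm A z)"
    unfolding 5 by (simp add: S)
  finally have "cm a (cm b z) \<otimes> inv (cm b B \<otimes> cm A z) \<in> ?K"
    by (subst (asm) coset_eq_iff[OF lc_normal]) simp_all
  then show ?thesis
    by (intro bexI[of _ "cm a (cm b z) \<otimes> inv (cm b B \<otimes> cm A z)"])
      (simp_all add: A_def[symmetric] B_def[symmetric], simp add: m_assoc)
qed

end

section \<open>Right independence\<close>

text \<open>The right ideal generated by the family is a free right module on it. Coefficients stand
  on the right so that relations between products can be peeled off from the first factor
  on.\<close>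

definition right_indep :: "'i set \<Rightarrow> ('i \<Rightarrow> 'x nc_series) \<Rightarrow> bool" where
  "right_indep I f \<longleftrightarrow>
    (\<forall>J a. finite J \<longrightarrow> J \<subseteq> I \<longrightarrow> (\<Sum>j\<in>J. f j * a j) = 0 \<longrightarrow> (\<forall>j\<in>J. a j = 0))"

lemma right_indepI:
  "(\<And>J a j. finite J \<Longrightarrow> J \<subseteq> I \<Longrightarrow> (\<Sum>j\<in>J. f j * a j) = 0 \<Longrightarrow> j \<in> J \<Longrightarrow> a j = 0) \<Longrightarrow> right_indep I f"
  by (auto simp: right_indep_def)

lemma right_indepD:
  "right_indep I f \<Longrightarrow> (\<Sum>j\<in>J. f j * a j) = 0 \<Longrightarrow> finite J \<Longrightarrow> J \<subseteq> I \<Longrightarrow> j \<in> J \<Longrightarrow> a j = 0"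
  by (auto simp: right_indep_def)

lemma right_indep_image:
  assumes "right_indep I (\<lambda>i. f (\<phi> i))"
  shows "right_indep (\<phi> ` I) f"
proof -
  have inj: "inj_on \<phi> I"
  proof (rule inj_onI, rule ccontr)
    fix i j assume ij: "i \<in> I" "j \<in> I" "\<phi> i = \<phi> j" "i \<noteq> j"
    \<comment> \<open>Equal values at two indices would satisfy a relation with the coefficients 1
      and -1.\<close>
    define a where "a l = (if l = i then 1 else - 1 :: 'b nc_series)" for l
    have s0: "(\<Sum>l\<in>{i, j}. f (\<phi> l) * a l) = 0" using ij by (simp add: a_def)
    have "a i = 0" by (rule right_indepD[OF assms s0]) (use ij in auto)
    then show False by (simp add: a_def)
  qed
  show ?thesis
  proof (rule right_indepI)
    fix J a j assume J: "finite J" "J \<subseteq> \<phi> ` I" "(\<Sum>j\<in>J. f j * a j) = 0" "j \<in> J"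
    then obtain J' where J': "J' \<subseteq> I" "J = \<phi> ` J'" by (meson subset_image_iff)
    have inj': "inj_on \<phi> J'" using inj J'(1) inj_on_subset by blast
    have s0: "(\<Sum>i\<in>J'. f (\<phi> i) * a (\<phi> i)) = 0"
      using J(3) unfolding J'(2) by (simp add: sum.reindex[OF inj'])
    have fin: "finite J'" using J(1) J' inj' finite_imageD by blast
    obtain i where i: "i \<in> J'" "j = \<phi> i" using J(4) J'(2) by blast
    have "a (\<phi> i) = 0" by (rule right_indepD[OF assms s0 fin J'(1) i(1)])
    then show "a j = 0" using i(2) by simp
  qed
qed

definition ad :: "'x nc_series \<Rightarrow> 'x nc_series \<Rightarrow> 'x nc_series" where
  "ad \<alpha> \<eta> = \<alpha> * \<eta> - \<eta> * \<alpha>"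

text \<open>By the binomial formula the \<open>D i\<close> are signed binomial multiples of powers
  of \<alpha>. Only the unitriangular shape is recorded, and that the \<open>D i\<close> do not
  depend on \<eta>.\<close>

lemma ad_pow_expand:
  "\<exists>D. D k = 1 \<and> (\<forall>i>k. D i = 0) \<and> (\<forall>\<eta>. (ad \<alpha> ^^ k) \<eta> = (\<Sum>i\<le>k. \<alpha> ^ i * \<eta> * D i))"
proof (induction k)
  case 0
  show ?case by (intro exI[of _ "\<lambda>i. if i = 0 then 1 else 0"]) simp
next
  case (Suc k)
  then obtain D where D: "D k = 1" "\<forall>i>k. D i = 0"
    "\<And>\<eta>. (ad \<alpha> ^^ k) \<eta> = (\<Sum>i\<le>k. \<alpha> ^ i * \<eta> * D i)" by blast
  define D' where "D' i = (case i of 0 \<Rightarrow> 0 | Suc j \<Rightarrow> D j) - D i * \<alpha>" for i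
  have "(ad \<alpha> ^^ Suc k) \<eta> = (\<Sum>i\<le>Suc k. \<alpha> ^ i * \<eta> * D' i)" for \<eta>
  proof -
    have "(\<Sum>i\<le>Suc k. \<alpha> ^ i * \<eta> * D' i) =
        (\<Sum>i\<le>Suc k. \<alpha> ^ i * \<eta> * (case i of 0 \<Rightarrow> 0 | Suc j \<Rightarrow> D j)) - (\<Sum>i\<le>Suc k. \<alpha> ^ i * \<eta> * D i * \<alpha>)"
      by (simp add: D'_def algebra_simps sum_subtractf)
    also have "(\<Sum>i\<le>Suc k. \<alpha> ^ i * \<eta> * (case i of 0 \<Rightarrow> 0 | Suc j \<Rightarrow> D j)) = \<alpha> * (\<Sum>i\<le>k. \<alpha> ^ i * \<eta> * D i)"
      by (simp add: sum.atMost_Suc_shift sum_distrib_left mult.assoc del: sum.atMost_Suc)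
    also have "(\<Sum>i\<le>Suc k. \<alpha> ^ i * \<eta> * D i * \<alpha>) = (\<Sum>i\<le>k. \<alpha> ^ i * \<eta> * D i) * \<alpha>"
      using D(2) by (simp add: sum_distrib_right)
    finally show ?thesis by (simp add: D(3) ad_def)
  qed
  moreover have "D' (Suc k) = 1" "\<forall>i>Suc k. D' i = 0"
    using D by (auto simp: D'_def split: nat.split)
  ultimately show ?case by blast
qed

text \<open>The terms with \<open>i = 0\<close> begin with some \<open>f y\<close>, all others with
  \<open>f x\<close>. Independence kills the former and leaves a relation of the same kind with one
  power of \<open>f x\<close> less.\<close>

lemma right_indep_powers:
  assumes ri: "right_indep I f" and x: "x \<in> I" and Y: "finite Y" "Y \<subseteq> I - {x}"
  shows "(\<Sum>i<K. \<Sum>y\<in>Y. f x ^ i * f y * c i y) = 0 \<Longrightarrow> i < K \<Longrightarrow> y \<in> Y \<Longrightarrow> c i y = 0"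
proof (induction K arbitrary: c i)
  case 0
  from \<open>i < 0\<close> show ?case by blast
next
  case (Suc K)
  define s where "s = (\<Sum>i<K. \<Sum>y\<in>Y. f x ^ i * f y * c (Suc i) y)"
  have x': "x \<notin> Y" using Y by blast
  have "(\<Sum>i<Suc K. \<Sum>y\<in>Y. f x ^ i * f y * c i y) = (\<Sum>y\<in>Y. f y * c 0 y) + f x * s"
    by (simp add: s_def sum.lessThan_Suc_shift sum_distrib_left mult.assoc del: sum.lessThan_Suc)
  also have "(\<Sum>y\<in>Y. f y * c 0 y) = (\<Sum>y\<in>Y. f y * (if y = x then s else c 0 y))"
    using x' by (intro sum.cong) auto
  also have "\<dots> + f x * s = (\<Sum>y\<in>insert x Y. f y * (if y = x then s else c 0 y))"
    using x' Y by simp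
  finally have s0: "(\<Sum>y\<in>insert x Y. f y * (if y = x then s else c 0 y)) = 0"
    using Suc.prems(1) by simp
  then have z: "(if y = x then s else c 0 y) = 0" if "y \<in> insert x Y" for y
    using that Y x by (intro right_indepD[OF ri s0]) auto
  have "s = 0" using z[of x] by simp
  show ?case
  proof (cases i)
    case 0
    have "y \<noteq> x" using Suc.prems(3) x' by blast
    then show ?thesis using z[of y] Suc.prems(3) 0 by simp
  next
    case (Suc i')
    then show ?thesis using Suc.IH[of "\<lambda>i. c (Suc i)" i'] \<open>s = 0\<close> Suc.prems(2,3) by (simp add: s_def)
  qed
qed

lemma right_indep_ad_sum:
  assumes ri: "right_indep I f" and x: "x \<in> I" and Y: "finite Y" "Y \<subseteq> I - {x}"
  shows "(\<Sum>k<K. \<Sum>y\<in>Y. (ad (f x) ^^ k) (f y) * c k y) = 0 \<Longrightarrow> k < K \<Longrightarrow> y \<in> Y \<Longrightarrow> c k y = 0"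
proof (induction K arbitrary: k y)
  case 0
  from \<open>k < 0\<close> show ?case by blast
next
  case (Suc K)
  have "\<forall>k. \<exists>D. D k = 1 \<and> (\<forall>i>k. D i = 0) \<and>
      (\<forall>\<eta>. (ad (f x) ^^ k) \<eta> = (\<Sum>i\<le>k. f x ^ i * \<eta> * D i))"
    using ad_pow_expand by blast
  from choice[OF this] obtain D where D': "\<forall>k. D k k = 1 \<and> (\<forall>i>k. D k i = 0) \<and>
      (\<forall>\<eta>. (ad (f x) ^^ k) \<eta> = (\<Sum>i\<le>k. f x ^ i * \<eta> * D k i))" by blast
  have D: "\<And>k. D k k = 1" "\<And>k i. i > k \<Longrightarrow> D k i = 0"
    "\<And>k \<eta>. (ad (f x) ^^ k) \<eta> = (\<Sum>i\<le>k. f x ^ i * \<eta> * D k i)"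
    using D' by blast+
  define c' where "c' i y = (\<Sum>k<Suc K. D k i * c k y)" for i y
  have "(\<Sum>i<Suc K. \<Sum>y\<in>Y. f x ^ i * f y * c' i y) = (\<Sum>k<Suc K. \<Sum>y\<in>Y. (ad (f x) ^^ k) (f y) * c k y)"
  proof -
    have "(ad (f x) ^^ k) (f y) * c k y = (\<Sum>i<Suc K. f x ^ i * f y * D k i * c k y)"
      if "k < Suc K" for k y
      unfolding D(3) sum_distrib_right using that
      by (intro sum.mono_neutral_left) (auto simp: D(2))
    then have "(\<Sum>k<Suc K. \<Sum>y\<in>Y. (ad (f x) ^^ k) (f y) * c k y) =
        (\<Sum>k<Suc K. \<Sum>y\<in>Y. \<Sum>i<Suc K. f x ^ i * f y * D k i * c k y)"
      by (intro sum.cong) auto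
    also have "\<dots> = (\<Sum>y\<in>Y. \<Sum>k<Suc K. \<Sum>i<Suc K. f x ^ i * f y * D k i * c k y)"
      by (rule sum.swap)
    also have "\<dots> = (\<Sum>y\<in>Y. \<Sum>i<Suc K. \<Sum>k<Suc K. f x ^ i * f y * D k i * c k y)"
      by (intro sum.cong[OF refl] sum.swap)
    also have "\<dots> = (\<Sum>i<Suc K. \<Sum>y\<in>Y. \<Sum>k<Suc K. f x ^ i * f y * D k i * c k y)"
      by (rule sum.swap)
    finally show ?thesis by (simp only: c'_def sum_distrib_left mult.assoc)
  qed
  then have 0: "(\<Sum>i<Suc K. \<Sum>y\<in>Y. f x ^ i * f y * c' i y) = 0" using Suc.prems(1) by simp
  \<comment> \<open>The change from \<open>c\<close> to \<open>c'\<close> is unitriangular, so the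
    coefficient of top index is the same in both and vanishes first.\<close>
  have top: "c K y = 0" if "y \<in> Y" for y
  proof -
    have "c' K y = 0" using right_indep_powers[OF assms 0 _ that] by simp
    then show ?thesis by (simp add: c'_def D(1,2))
  qed
  then have s0: "(\<Sum>k<K. \<Sum>y\<in>Y. (ad (f x) ^^ k) (f y) * c k y) = 0"
    using Suc.prems(1) by (simp only: sum.lessThan_Suc) simp
  show ?case
  proof (cases "k = K")
    case True
    then show ?thesis using top Suc.prems(3) by simp
  next
    case False
    then have "k < K" using Suc.prems(2) by simp
    from Suc.IH[OF s0 this Suc.prems(3)] show ?thesis .
  qed
qed

text \<open>This carries independence through an elimination step, where the new generators have
  exactly these leading parts.\<close>

lemma right_indep_ad:
  assumes ri: "right_indep I f" and x: "x \<in> I"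
  shows "right_indep (UNIV \<times> (I - {x})) (\<lambda>(k, y). (ad (f x) ^^ k) (f y))"
proof (rule right_indepI)
  fix J a j
  assume J: "finite J" "J \<subseteq> UNIV \<times> (I - {x})" "(\<Sum>j\<in>J. (case j of (k, y) \<Rightarrow> (ad (f x) ^^ k) (f y)) * a j) = 0"
    and j: "j \<in> J"
  obtain K where K: "\<And>j. j \<in> J \<Longrightarrow> fst j < K"
    using finite_nat_set_iff_bounded[of "fst ` J"] J(1) by auto
  define c where "c k y = (if (k, y) \<in> J then a (k, y) else 0)" for k y
  let ?Y = "snd ` J"
  have "(\<Sum>k<K. \<Sum>y\<in>?Y. (ad (f x) ^^ k) (f y) * c k y) = (\<Sum>(k, y)\<in>{..<K} \<times> ?Y. (ad (f x) ^^ k) (f y) * c k y)"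
    by (rule sum.cartesian_product)
  also have "\<dots> = (\<Sum>j\<in>J. (case j of (k, y) \<Rightarrow> (ad (f x) ^^ k) (f y)) * a j)"
    using J(1) K by (intro sum.mono_neutral_cong_right) (force simp: c_def)+
  finally have s0: "(\<Sum>k<K. \<Sum>y\<in>?Y. (ad (f x) ^^ k) (f y) * c k y) = 0"
    using J(3) by simp
  have "c (fst j) (snd j) = 0"
    by (rule right_indep_ad_sum[OF ri x _ _ s0]) (use J j K in auto)
  then show "a j = 0" using j by (simp add: c_def)
qed

text \<open>
  If \<open>\<alpha>\<close> and the \<open>f y\<close> are right independent and of positive order, then this right ideal contains
  \<open>(ad \<alpha> ^^ k) (f y)\<close> for all \<open>k\<close>, but no nonzero integer multiple of \<open>\<alpha>\<close>.
\<close>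

inductive_set aug_rideal :: "'x nc_series \<Rightarrow> 'i set \<Rightarrow> ('i \<Rightarrow> 'x nc_series) \<Rightarrow> 'x nc_series set"
  for \<alpha> Y f where
  gen: "y \<in> Y \<Longrightarrow> f y * c \<in> aug_rideal \<alpha> Y f"
| aug: "d \<in> ord_ge (Suc 0) \<Longrightarrow> \<alpha> * d \<in> aug_rideal \<alpha> Y f"
| add: "r \<in> aug_rideal \<alpha> Y f \<Longrightarrow> s \<in> aug_rideal \<alpha> Y f \<Longrightarrow> r + s \<in> aug_rideal \<alpha> Y f"

lemma aug_rideal_mult: "r \<in> aug_rideal \<alpha> Y f \<Longrightarrow> r * s \<in> aug_rideal \<alpha> Y f"
  by (induction rule: aug_rideal.induct)
    (auto simp: mult.assoc distrib_right intro: aug_rideal.intros ord_ge_mult_right)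

lemma aug_rideal_uminus: "r \<in> aug_rideal \<alpha> Y f \<Longrightarrow> - r \<in> aug_rideal \<alpha> Y f"
  using aug_rideal_mult[of r \<alpha> Y f "- 1"] by simp

lemma aug_rideal_zero: "0 \<in> aug_rideal \<alpha> Y f"
  using aug_rideal.aug[of 0 \<alpha> Y f] by simp

lemma aug_rideal_diff: "r \<in> aug_rideal \<alpha> Y f \<Longrightarrow> s \<in> aug_rideal \<alpha> Y f \<Longrightarrow> r - s \<in> aug_rideal \<alpha> Y f"
  using aug_rideal.add[OF _ aug_rideal_uminus, of r \<alpha> Y f s] by simp

lemma aug_rideal_ad_pow:
  assumes "y \<in> Y" "f y \<in> ord_ge (Suc 0)" shows "(ad \<alpha> ^^ k) (f y) \<in> aug_rideal \<alpha> Y f"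
proof -
  have "(ad \<alpha> ^^ k) (f y) \<in> aug_rideal \<alpha> Y f \<and> (ad \<alpha> ^^ k) (f y) \<in> ord_ge (Suc 0)"
  proof (induction k)
    case 0
    then show ?case using aug_rideal.gen[OF assms(1), of f 1] assms(2) by simp
  next
    case (Suc k)
    let ?a = "(ad \<alpha> ^^ k) (f y)"
    have "\<alpha> * ?a - ?a * \<alpha> \<in> aug_rideal \<alpha> Y f"
      by (rule aug_rideal_diff[OF aug_rideal.aug aug_rideal_mult]) (use Suc in auto)
    moreover have "\<alpha> * ?a - ?a * \<alpha> \<in> ord_ge (Suc 0)"
      by (rule ord_ge_diff[OF ord_ge_mult_left ord_ge_mult_right]) (use Suc in auto)
    ultimately show ?case by (simp add: ad_def[of \<alpha> ?a])
  qed
  then show ?thesis ..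
qed

lemma aug_rideal_normal_form:
  "r \<in> aug_rideal \<alpha> Y f \<Longrightarrow>
    \<exists>Y0 c d. finite Y0 \<and> Y0 \<subseteq> Y \<and> d \<in> ord_ge (Suc 0) \<and> r = (\<Sum>y\<in>Y0. f y * c y) + \<alpha> * d"
proof (induction rule: aug_rideal.induct)
  case (gen y c)
  then show ?case by (intro exI[of _ "{y}"] exI[of _ "\<lambda>_. c"] exI[of _ 0]) simp
next
  case (aug d)
  then show ?case by (intro exI[of _ "{}"] exI[of _ "\<lambda>_. 0"] exI[of _ d]) simp
next
  case (add r s)
  obtain Y0 c d where r: "finite Y0" "Y0 \<subseteq> Y" "d \<in> ord_ge (Suc 0)" "r = (\<Sum>y\<in>Y0. f y * c y) + \<alpha> * d"
    using add.IH(1) by blast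
  obtain Y1 c' d' where s: "finite Y1" "Y1 \<subseteq> Y" "d' \<in> ord_ge (Suc 0)" "s = (\<Sum>y\<in>Y1. f y * c' y) + \<alpha> * d'"
    using add.IH(2) by blast
  have *: "(\<Sum>y\<in>Y0. f y * c y) = (\<Sum>y\<in>Y0 \<union> Y1. f y * (if y \<in> Y0 then c y else 0))"
    "(\<Sum>y\<in>Y1. f y * c' y) = (\<Sum>y\<in>Y0 \<union> Y1. f y * (if y \<in> Y1 then c' y else 0))"
    using r(1) s(1) by (intro sum.mono_neutral_cong_left; auto)+
  have "r + s = (\<Sum>y\<in>Y0 \<union> Y1. f y * ((if y \<in> Y0 then c y else 0) + (if y \<in> Y1 then c' y else 0))) + \<alpha> * (d + d')"
    unfolding r(4) s(4) * distrib_left sum.distrib by simp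
  moreover have "finite (Y0 \<union> Y1)" "Y0 \<union> Y1 \<subseteq> Y" "d + d' \<in> ord_ge (Suc 0)"
    using r(1-3) s(1-3) by (auto intro: ord_ge_add)
  ultimately show ?case
    by (intro exI[of _ "Y0 \<union> Y1"] exI[of _ "\<lambda>y. (if y \<in> Y0 then c y else 0) + (if y \<in> Y1 then c' y else 0)"]
        exI[of _ "d + d'"] conjI)
qed

text \<open>By uniqueness of the coefficient of \<open>f x\<close> the integer \<open>e\<close>
  equals the series \<open>d\<close>, which has no constant term.\<close>

lemma aug_rideal_of_int:
  assumes ri: "right_indep I f" and x: "x \<in> I" and mem: "of_int e * f x \<in> aug_rideal (f x) (I - {x}) f"
  shows "e = 0"
proof -
  obtain Y c d where Y: "finite Y" "Y \<subseteq> I - {x}" "d \<in> ord_ge (Suc 0)" "of_int e * f x = (\<Sum>y\<in>Y. f y * c y) + f x * d"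
    using aug_rideal_normal_form[OF mem] by blast
  define a where "a y = (if y = x then d - of_int e else c y)" for y
  have "x \<notin> Y" using Y by blast
  then have "(\<Sum>y\<in>insert x Y. f y * a y) = f x * a x + (\<Sum>y\<in>Y. f y * a y)"
    using Y(1) by simp
  also have "(\<Sum>y\<in>Y. f y * a y) = (\<Sum>y\<in>Y. f y * c y)"
    using \<open>x \<notin> Y\<close> by (intro sum.cong) (auto simp: a_def)
  also have "f x * a x + \<dots> = f x * (d - of_int e) + (\<Sum>y\<in>Y. f y * c y)"
    by (simp add: a_def)
  also have "\<dots> = 0" using Y(4) by (simp add: algebra_simps mult_of_int_commute)
  finally have s0: "(\<Sum>y\<in>insert x Y. f y * a y) = 0" .
  have "a x = 0" by (rule right_indepD[OF ri s0]) (use Y x in auto)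
  then have "coeff (d - of_int e * 1) [] = 0" by (simp add: a_def)
  then show ?thesis using Y(3) unfolding ord_ge_1[unfolded One_nat_def] coeff_simps coeff_of_int_mult by (simp add: coeff_1)
qed

section \<open>The theorem of Magnus and Witt\<close>

text \<open>
  \<open>lie_span B n\<close> describes the degree \<open>n\<close> part of the Lie subring of the graded Lie ring of the
  lower central series that is generated by \<open>B\<close>; an element of weight \<open>n\<close> in the series stands
  for its class modulo the next term.
\<close>

context group
begin

inductive lie_span :: "(nat \<times> 'a) set \<Rightarrow> nat \<Rightarrow> 'a \<Rightarrow> bool" for B where
  gen: "(n, b) \<in> B \<Longrightarrow> lie_span B n b"
| deep: "g \<in> lc (Suc n) \<Longrightarrow> n \<ge> 1 \<Longrightarrow> lie_span B n g"
| mult: "lie_span B n g \<Longrightarrow> lie_span B n h \<Longrightarrow> lie_span B n (g \<otimes> h)"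
| inv: "lie_span B n g \<Longrightarrow> lie_span B n (inv g)"
| comm: "(m, b) \<in> B \<Longrightarrow> lie_span B n g \<Longrightarrow> lie_span B (m + n) (cm b g)"

definition weighted :: "(nat \<times> 'a) set \<Rightarrow> bool" where
  "weighted B \<longleftrightarrow> (\<forall>(n, b)\<in>B. n \<ge> 1 \<and> b \<in> lc n)"

lemma weightedD: "weighted B \<Longrightarrow> (n, b) \<in> B \<Longrightarrow> n \<ge> 1" "weighted B \<Longrightarrow> (n, b) \<in> B \<Longrightarrow> b \<in> lc n"
  by (auto simp: weighted_def)

lemma lie_span_lc:
  assumes "weighted B"
  shows "lie_span B n g \<Longrightarrow> n \<ge> 1 \<and> g \<in> lc n"
proof (induction rule: lie_span.induct)
  case (deep g n)
  then show ?case using lc_Suc_subset by blast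
next
  case (comm m b n g)
  then show ?case using weightedD[OF assms] cm_lc[of b m g n] by auto
qed (use weightedD[OF assms] in \<open>auto intro: lc_mult lc_inv\<close>)

lemma lie_span_carrier: "weighted B \<Longrightarrow> lie_span B n g \<Longrightarrow> g \<in> carrier G"
  using lie_span_lc lc_carrier by blast

text \<open>Conjugation multiplies by a commutator one step deeper, which the rule
  \<open>deep\<close> absorbs.\<close>

lemma lie_span_conj:
  assumes "weighted B" "lie_span B n g" "x \<in> carrier G"
  shows "lie_span B n (x \<otimes> g \<otimes> inv x)"
proof -
  have g: "n \<ge> 1" "g \<in> lc n" "g \<in> carrier G"
    using lie_span_lc lie_span_carrier assms by auto
  then have "cm g x \<in> lc (Suc n)" using lc_Suc_cm[of g "n - 1" x] assms(3) by simp
  then have "inv (cm g x) \<in> lc (Suc n)" by (rule lc_inv)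
  then have "lie_span B n (cm x g)" using g assms(3) by (intro lie_span.deep) (simp_all add: cm_swap)
  then have "lie_span B n (cm x g \<otimes> g)" using assms(2) by (rule lie_span.mult)
  then show ?thesis using g assms(3) by (simp add: conj_eq_cm)
qed

lemma lie_span_low:
  assumes "\<And>q b. (q, b) \<in> B \<Longrightarrow> m \<le> q"
  shows "lie_span B n g \<Longrightarrow> n < m \<Longrightarrow> g \<in> lc (Suc n)"
proof (induction rule: lie_span.induct)
  case (gen n b)
  then show ?case using assms[of n b] by simp
next
  case (comm q b n g)
  then show ?case using assms[of q b] by simp
qed (auto intro: lc_mult lc_inv)

text \<open>
  Lazard elimination: up to powers of \<open>a\<close>, the Lie subring generated by \<open>B\<close> is generated by the
  iterated commutators of \<open>a\<close> with the other elements of \<open>B\<close>. Eliminating elements of least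
  weight again and again raises all weights above any given \<open>n\<close>, so that nothing is left in
  degree \<open>n\<close>.
\<close>

definition lazard_elim :: "(nat \<times> 'a) set \<Rightarrow> nat \<Rightarrow> 'a \<Rightarrow> (nat \<times> 'a) set" where
  "lazard_elim B p a = (\<lambda>(k, q, y). (q + k * p, (cm a ^^ k) y)) ` (UNIV \<times> (B - {(p, a)}))"

lemma lazard_elim_memI: "(q, y) \<in> B \<Longrightarrow> (q, y) \<noteq> (p, a) \<Longrightarrow> (q + k * p, (cm a ^^ k) y) \<in> lazard_elim B p a"
  unfolding lazard_elim_def by (rule image_eqI[of _ _ "(k, q, y)"]) auto

lemma cm_pow_lc:
  assumes "a \<in> lc p" "p \<ge> 1" "y \<in> lc q" "q \<ge> 1"
  shows "(cm a ^^ k) y \<in> lc (q + k * p)"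
proof (induction k)
  case (Suc k)
  then have "cm a ((cm a ^^ k) y) \<in> lc (p + (q + k * p))" using assms by (intro cm_lc) auto
  then show ?case by (simp add: ac_simps)
qed (simp add: assms)

context
  fixes B :: "(nat \<times> 'a) set" and p :: nat and a :: 'a
  assumes B: "weighted B" and a: "(p, a) \<in> B"
begin

abbreviation (input) B' where "B' \<equiv> lazard_elim B p a"

lemma a_lc: "p \<ge> 1" "a \<in> lc p" "a \<in> carrier G"
  using weightedD[OF B a] lc_carrier by auto

lemma weighted_elim: "weighted B'"
  using cm_pow_lc[OF a_lc(2,1)] weightedD[OF B]
  by (fastforce simp: weighted_def lazard_elim_def)

lemma elim_ad:
  assumes "(m, b) \<in> B'" shows "(p + m, cm a b) \<in> B'"
proof -
  obtain k q y where "(q, y) \<in> B" "(q, y) \<noteq> (p, a)" "m = q + k * p" "b = (cm a ^^ k) y"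
    using assms by (auto simp: lazard_elim_def)
  then show ?thesis using lazard_elim_memI[of q y B p a "Suc k"] by (simp add: ac_simps)
qed

text \<open>Bracketing with \<open>a\<close> maps new generators to new generators
  (\<open>elim_ad\<close>) and is a derivation up to deeper terms
  (\<open>cm_jacobi\<close>).\<close>

lemma lie_span_elim_ad: "lie_span B' n z \<Longrightarrow> lie_span B' (p + n) (cm a z)"
proof (induction rule: lie_span.induct)
  case (gen n b)
  then show ?case by (intro lie_span.gen elim_ad)
next
  case (deep g n)
  then have "cm a g \<in> lc (p + Suc n)" using a_lc by (intro cm_lc) auto
  then show ?case using deep by (intro lie_span.deep) auto
next
  case (mult n g h)
  then have c: "g \<in> carrier G" "h \<in> carrier G" using lie_span_carrier[OF weighted_elim] by blast+
  show ?case unfolding cm_mult_right[OF a_lc(3) c]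
    using mult c by (intro lie_span.mult lie_span_conj[OF weighted_elim])
next
  case (inv n g)
  then have c: "g \<in> carrier G" using lie_span_carrier[OF weighted_elim] by blast
  have "lie_span B' (p + n) (inv g \<otimes> inv (cm a g) \<otimes> inv (inv g))"
    using inv c by (intro lie_span_conj[OF weighted_elim] lie_span.inv) auto
  then show ?case using c a_lc by (simp add: cm_inv_right)
next
  case (comm m b n g)
  note b = weightedD[OF weighted_elim comm(1)] and g = lie_span_lc[OF weighted_elim comm(2)]
  obtain e where e: "e \<in> lc (Suc (p + (m + n)))" "cm a (cm b g) = e \<otimes> (cm b (cm a g) \<otimes> cm (cm a b) g)"
    using cm_jacobi[OF a_lc(2,1) b(2,1)] g by blast
  have "lie_span B' (p + (m + n)) e" using e(1) b by (intro lie_span.deep) auto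
  moreover have "lie_span B' (p + (m + n)) (cm b (cm a g))"
    using lie_span.comm[OF comm(1,3)] by (simp add: ac_simps)
  moreover have "lie_span B' (p + (m + n)) (cm (cm a b) g)"
    using lie_span.comm[OF elim_ad[OF comm(1)] comm(2)] by (simp add: ac_simps)
  ultimately show ?case unfolding e(2) by (intro lie_span.mult)
qed

lemma lie_span_elim_ad_pow:
  assumes z: "lie_span B' n z" shows "lie_span B' (p + n) (cm (a [^] (e::int)) z)"
proof -
  have zc: "z \<in> carrier G" "n \<ge> 1" using z lie_span_carrier[OF weighted_elim] lie_span_lc[OF weighted_elim] by auto
  have nat: "lie_span B' (p + n) (cm (a [^] k) z)" for k :: nat
  proof (induction k)
    case 0
    have "cm \<one> z = \<one>" using zc by (simp add: commutator_def)
    then show ?case using zc lc_one by (auto intro: lie_span.deep)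
  next
    case (Suc k)
    have "cm (a [^] Suc k) z = a [^] k \<otimes> cm a z \<otimes> inv (a [^] k) \<otimes> cm (a [^] k) z"
      using cm_mult_left[of "a [^] k" a z] zc a_lc by simp
    then show ?case using Suc lie_span_elim_ad[OF z] a_lc
      by (simp only:) (intro lie_span.mult lie_span_conj[OF weighted_elim]; simp)
  qed
  show ?thesis
  proof (cases e rule: int_cases2)
    case (nonneg k)
    then show ?thesis using nat by (simp add: int_pow_int)
  next
    case (nonpos k)
    let ?u = "a [^] k"
    have u: "?u \<in> carrier G" using a_lc by simp
    have "lie_span B' (p + n) (inv ?u \<otimes> inv (cm ?u z) \<otimes> inv (inv ?u))"
      using nat u by (intro lie_span_conj[OF weighted_elim] lie_span.inv) auto
    then show ?thesis using u zc a_lc nonpos by (simp add: cm_inv_left int_pow_neg int_pow_int)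
  qed
qed

text \<open>The old Lie ring is the sum of the integer multiples of \<open>a\<close> and the Lie
  ring of the new generators. The former live in degree \<open>p\<close> alone, whence the condition
  on \<open>e\<close>.\<close>

lemma lie_span_elim:
  "lie_span B n g \<Longrightarrow> \<exists>h e. lie_span B' n h \<and> g = a [^] (e::int) \<otimes> h \<and> (e \<noteq> 0 \<longrightarrow> n = p)"
proof (induction rule: lie_span.induct)
  case (gen n b)
  show ?case
  proof (cases "(n, b) = (p, a)")
    case True
    have "lie_span B' p \<one>" using a_lc lc_one by (intro lie_span.deep) auto
    then show ?thesis using True a_lc by (intro exI[of _ \<one>] exI[of _ 1]) simp
  next
    case False
    then have "lie_span B' n b"
      using lazard_elim_memI[OF gen, of p a 0] by (intro lie_span.gen) simp
    then show ?thesis using lie_span_carrier[OF weighted_elim] by (intro exI[of _ b] exI[of _ 0]) simp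
  qed
next
  case (deep g n)
  then show ?case using lc_carrier by (intro exI[of _ g] exI[of _ 0]) (auto intro: lie_span.deep)
next
  case (mult n g1 g2)
  then obtain h1 e1 h2 e2 where h: "lie_span B' n h1" "g1 = a [^] (e1::int) \<otimes> h1" "e1 \<noteq> 0 \<longrightarrow> n = p"
    "lie_span B' n h2" "g2 = a [^] (e2::int) \<otimes> h2" "e2 \<noteq> 0 \<longrightarrow> n = p" by blast
  let ?h = "inv (a [^] e2) \<otimes> h1 \<otimes> inv (inv (a [^] e2)) \<otimes> h2"
  have c: "h1 \<in> carrier G" "h2 \<in> carrier G" using h lie_span_carrier[OF weighted_elim] by blast+
  have "lie_span B' n ?h"
    using h a_lc by (intro lie_span.mult lie_span_conj[OF weighted_elim]) auto
  moreover have "g1 \<otimes> g2 = a [^] (e1 + e2) \<otimes> ?h"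
    using c a_lc by (simp add: h(2,5) int_pow_mult group_simps)
  ultimately show ?case using h(3,6) by (intro exI[of _ ?h] exI[of _ "e1 + e2"]) auto
next
  case (inv n g)
  then obtain h e where h: "lie_span B' n h" "g = a [^] (e::int) \<otimes> h" "e \<noteq> 0 \<longrightarrow> n = p" by blast
  let ?h = "a [^] e \<otimes> inv h \<otimes> inv (a [^] e)"
  have c: "h \<in> carrier G" using h lie_span_carrier[OF weighted_elim] by blast
  have "lie_span B' n ?h"
    using h a_lc by (intro lie_span.inv lie_span_conj[OF weighted_elim]) auto
  moreover have "inv g = a [^] (- e) \<otimes> ?h"
    using c a_lc by (simp add: h(2) int_pow_neg group_simps)
  ultimately show ?case using h(3) by (intro exI[of _ ?h] exI[of _ "- e"]) auto
next
  case (comm m b n g)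
  then obtain h e where h: "lie_span B' n h" "g = a [^] (e::int) \<otimes> h" "e \<noteq> 0 \<longrightarrow> n = p" by blast
  have c: "h \<in> carrier G" "b \<in> carrier G" "n \<ge> 1"
    using h lie_span_carrier[OF weighted_elim] lie_span_lc[OF weighted_elim] weightedD(2)[OF B comm(1)] lc_carrier
    by auto
  have "lie_span B' (m + n) (cm b g)"
  proof (cases "(m, b) = (p, a)")
    case True
    have "a \<otimes> a [^] e = a [^] e \<otimes> a"
      using int_pow_mult[OF a_lc(3), of 1 e] int_pow_mult[OF a_lc(3), of e 1] a_lc by (simp add: add.commute)
    then have "cm a g = a [^] e \<otimes> cm a h \<otimes> inv (a [^] e)"
      using c a_lc unfolding h(2)
      by (subst cm_mult_right) (simp_all add: commutator_def, simp add: m_assoc)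
    then show ?thesis
      using True lie_span_conj[OF weighted_elim lie_span_elim_ad[OF h(1)]] a_lc by auto
  next
    case False
    then have b: "(m, b) \<in> B'" using lazard_elim_memI[OF comm(1), of p a 0] by simp
    \<comment> \<open>For \<open>e \<noteq> 0\<close> the degree \<open>n\<close> is
      \<open>p\<close>, so up to inversion this is the bracket of a power of \<open>a\<close> with a
      new generator.\<close>
    have "lie_span B' (m + n) (cm b (a [^] e))"
    proof (cases "e = 0")
      case True
      have "cm b \<one> = \<one>" using c by (simp add: commutator_def)
      then show ?thesis using True c lc_one by (auto intro: lie_span.deep)
    next
      case False
      then have "lie_span B' (m + n) (inv (cm (a [^] e) b))"
        using lie_span.inv[OF lie_span_elim_ad_pow[OF lie_span.gen[OF b], of e]] h(3) by (simp add: add.commute)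
      then show ?thesis using c a_lc by (simp add: cm_swap)
    qed
    moreover have "lie_span B' (m + n) (a [^] e \<otimes> cm b h \<otimes> inv (a [^] e))"
      using lie_span_conj[OF weighted_elim lie_span.comm[OF b h(1)]] a_lc by simp
    ultimately show ?thesis
      unfolding h(2) using c a_lc by (subst cm_mult_right) (auto intro: lie_span.mult)
  qed
  moreover have "cm b g \<in> carrier G" using c a_lc by (simp add: h(2))
  ultimately show ?case by (intro exI[of _ "cm b g"] exI[of _ 0]) simp
qed

end

end

lemma right_indep_cong:
  assumes "\<And>i. i \<in> I \<Longrightarrow> f i = g i" "right_indep I f"
  shows "right_indep I g"
proof (rule right_indepI)
  fix J a j assume J: "finite J" "J \<subseteq> I" "(\<Sum>j\<in>J. g j * a j) = 0" "j \<in> J"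
  have "(\<Sum>j\<in>J. f j * a j) = (\<Sum>j\<in>J. g j * a j)"
    using assms(1) J(2) by (intro sum.cong) auto
  then show "a j = 0" using J by (intro right_indepD[OF assms(2)]) auto
qed

section \<open>Leading parts along the lower central series\<close>

locale series_rep = group G for G (structure) +
  fixes \<mu> :: "'a \<Rightarrow> 'x nc_series"
  assumes \<mu>_mult: "g \<in> carrier G \<Longrightarrow> h \<in> carrier G \<Longrightarrow> \<mu> (g \<otimes> h) = \<mu> g * \<mu> h"
    and \<mu>_const: "g \<in> carrier G \<Longrightarrow> coeff (\<mu> g) [] = 1"
begin

definition lead :: "nat \<Rightarrow> 'a \<Rightarrow> 'x nc_series" where
  "lead n g = hpart n (\<mu> g - 1)"

lemma \<mu>_one: "\<mu> \<one> = 1"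
proof -
  have "(\<mu> \<one> - 1) * \<mu> \<one> = 0" using \<mu>_mult[of \<one> \<one>] by (simp add: algebra_simps)
  moreover have "\<mu> \<one> \<noteq> 0" using \<mu>_const[of \<one>] by auto
  ultimately show ?thesis using nc_series_no_zero_divisors by (metis eq_iff_diff_eq_0)
qed

lemma \<mu>_ord_1: "g \<in> carrier G \<Longrightarrow> \<mu> g - 1 \<in> ord_ge 1"
  by (simp add: ord_ge_def \<mu>_const coeff_1)

text \<open>Write \<open>cm g h\<close> as \<open>g \<otimes> h\<close> times the inverse of
  \<open>h \<otimes> g\<close>. Subtracting 1 leaves a ring commutator times that inverse, and a
  ring commutator does not see constant terms.\<close>

lemma \<mu>_cm:
  assumes "g \<in> carrier G" "h \<in> carrier G"
  shows "\<mu> (cm g h) - 1 =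
    ((\<mu> g - 1) * (\<mu> h - 1) - (\<mu> h - 1) * (\<mu> g - 1)) * \<mu> (inv (h \<otimes> g))"
proof -
  have "\<mu> (h \<otimes> g) * \<mu> (inv (h \<otimes> g)) = 1"
    using assms by (simp add: \<mu>_mult[symmetric] \<mu>_one)
  moreover have "\<mu> (cm g h) = \<mu> (g \<otimes> h) * \<mu> (inv (h \<otimes> g))"
    using assms by (simp add: \<mu>_mult[symmetric] group_simps)
  ultimately have "\<mu> (cm g h) - 1 = (\<mu> (g \<otimes> h) - \<mu> (h \<otimes> g)) * \<mu> (inv (h \<otimes> g))"
    by (simp add: algebra_simps)
  then show ?thesis using assms by (simp add: \<mu>_mult algebra_simps)
qed

lemma \<mu>_inv_dev:
  assumes "g \<in> carrier G" shows "\<mu> (inv g) - 1 = - (\<mu> g - 1) * \<mu> (inv g)"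
proof -
  have "\<mu> g * \<mu> (inv g) = 1" using assms by (simp add: \<mu>_mult[symmetric] \<mu>_one)
  then show ?thesis by (simp add: algebra_simps)
qed

lemma \<mu>_mult_dev:
  assumes "g \<in> carrier G" "h \<in> carrier G"
  shows "\<mu> (g \<otimes> h) - 1 = (\<mu> g - 1) + (\<mu> h - 1) + (\<mu> g - 1) * (\<mu> h - 1)"
  using assms by (simp add: \<mu>_mult algebra_simps)

lemma ord_lc_Suc: "g \<in> lc (Suc n) \<Longrightarrow> \<mu> g - 1 \<in> ord_ge (Suc n)"
proof (induction n arbitrary: g)
  case 0
  then show ?case using \<mu>_ord_1 by simp
next
  case (Suc n)
  have gen: "\<mu> (cm x y) - 1 \<in> ord_ge (Suc (Suc n))" if "x \<in> lc (Suc n)" "y \<in> carrier G" for x y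
  proof -
    have x: "x \<in> carrier G" using that lc_carrier by blast
    have "(\<mu> x - 1) * (\<mu> y - 1) \<in> ord_ge (Suc (Suc n))" "(\<mu> y - 1) * (\<mu> x - 1) \<in> ord_ge (Suc (Suc n))"
      using ord_ge_mult[OF Suc.IH[OF that(1)] \<mu>_ord_1[OF that(2)]]
        ord_ge_mult[OF \<mu>_ord_1[OF that(2)] Suc.IH[OF that(1)]] by simp_all
    then show ?thesis unfolding \<mu>_cm[OF x that(2)] by (rule ord_ge_mult_right[OF ord_ge_diff])
  qed
  have "g \<in> generate G {x \<otimes> y \<otimes> inv x \<otimes> inv y | x y. x \<in> lc (Suc n) \<and> y \<in> carrier G}"
    using Suc.prems by (simp add: lower_central.simps(3))
  then have "g \<in> carrier G \<and> \<mu> g - 1 \<in> ord_ge (Suc (Suc n))"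
  proof induction
    case one
    then show ?case by (simp add: \<mu>_one)
  next
    case (incl h)
    then show ?case using gen lc_carrier by (auto simp: commutator_def[symmetric])
  next
    case (inv h)
    then obtain x y where xy: "h = cm x y" "x \<in> lc (Suc n)" "y \<in> carrier G"
      by (auto simp: commutator_def)
    then have h: "h \<in> carrier G" "\<mu> h - 1 \<in> ord_ge (Suc (Suc n))" using gen lc_carrier by auto
    then show ?case
      using ord_ge_mult_right[OF ord_ge_uminus[OF h(2)]] unfolding \<mu>_inv_dev[OF h(1)] by blast
  next
    case (eng h1 h2)
    then show ?case by (auto simp: \<mu>_mult_dev intro: ord_ge_add ord_ge_mult_right)
  qed
  then show ?case ..
qed

lemma ord_lc: "g \<in> lc n \<Longrightarrow> \<mu> g - 1 \<in> ord_ge n"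
  using ord_lc_Suc[of g "n - 1"] by (cases n) auto

lemma lead_lc_Suc: "g \<in> lc (Suc n) \<Longrightarrow> lead n g = 0"
  unfolding lead_def by (intro hpart_eq_0 ord_lc)

text \<open>The cross term of the two deviations has order at least
  \<open>n + n > n\<close>.\<close>

lemma lead_mult:
  assumes "g \<in> lc n" "h \<in> lc n" "n \<ge> 1"
  shows "lead n (g \<otimes> h) = lead n g + lead n h"
proof -
  have "(\<mu> g - 1) * (\<mu> h - 1) \<in> ord_ge (Suc n)"
    by (rule ord_ge_anti[OF ord_ge_mult[OF ord_lc[OF assms(1)] ord_lc[OF assms(2)]]]) (use assms(3) in simp)
  then have "hpart n ((\<mu> g - 1) * (\<mu> h - 1)) = 0" by (rule hpart_eq_0)
  then show ?thesis
    unfolding lead_def \<mu>_mult_dev[OF assms(1,2)[THEN lc_carrier]] hpart_simps(2) by simp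
qed

lemma lead_inv:
  assumes "g \<in> lc n" "n \<ge> 1"
  shows "lead n (inv g) = - lead n g"
proof -
  have "lead n (g \<otimes> inv g) = lead n g + lead n (inv g)"
    using assms by (intro lead_mult lc_inv)
  moreover have "lead n (g \<otimes> inv g) = 0"
    using assms lc_carrier[OF assms(1)] by (simp add: lead_def \<mu>_one)
  ultimately show ?thesis by (simp add: eq_neg_iff_add_eq_0 add.commute)
qed

lemma lead_one: "lead n \<one> = 0"
  by (simp add: lead_def \<mu>_one)

lemma lead_int_pow:
  assumes "g \<in> lc n" "n \<ge> 1"
  shows "lead n (g [^] (e::int)) = of_int e * lead n g"
proof -
  have g: "g \<in> carrier G" using assms lc_carrier by blast
  have nat: "g [^] k \<in> lc n \<and> lead n (g [^] k) = of_nat k * lead n g" for k :: nat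
  proof (induction k)
    case 0
    then show ?case by (simp add: lc_one lead_one)
  next
    case (Suc k)
    then show ?case using assms by (simp add: lead_mult lc_mult algebra_simps)
  qed
  show ?thesis
  proof (cases e rule: int_cases2)
    case (nonneg k)
    then show ?thesis using nat[of k] by (simp add: int_pow_int)
  next
    case (nonpos k)
    then show ?thesis using nat[of k] assms g by (simp add: int_pow_neg int_pow_int lead_inv)
  qed
qed

lemma lead_cm:
  assumes "g \<in> lc m" "h \<in> lc n"
  shows "lead (m + n) (cm g h) = lead m g * lead n h - lead n h * lead m g"
proof -
  have c: "g \<in> carrier G" "h \<in> carrier G" using assms lc_carrier by auto
  let ?c = "(\<mu> g - 1) * (\<mu> h - 1) - (\<mu> h - 1) * (\<mu> g - 1)"
  note gh = ord_lc[OF assms(1)] ord_lc[OF assms(2)]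
  have o: "?c \<in> ord_ge (m + n)"
    using ord_ge_mult[OF gh] ord_ge_mult[OF gh(2,1)] by (intro ord_ge_diff) (simp_all add: add.commute)
  have "(\<mu> (cm g h) - 1) - ?c = ?c * (\<mu> (inv (h \<otimes> g)) - 1)"
    using c by (simp add: \<mu>_cm algebra_simps)
  also have "\<dots> \<in> ord_ge (Suc (m + n))"
    using ord_ge_mult[OF o \<mu>_ord_1[of "inv (h \<otimes> g)"]] c by simp
  finally have "lead (m + n) (cm g h) = hpart (m + n) ?c"
    unfolding lead_def by (rule hpart_cong)
  also have "\<dots> = hpart (m + n) ((\<mu> g - 1) * (\<mu> h - 1)) - hpart (n + m) ((\<mu> h - 1) * (\<mu> g - 1))"
    by (simp only: hpart_simps(3) add.commute[of m n])
  also have "\<dots> = lead m g * lead n h - lead n h * lead m g"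
    unfolding lead_def by (simp only: hpart_mult[OF gh] hpart_mult[OF gh(2,1)])
  finally show ?thesis .
qed

lemma lead_cm_pow:
  assumes "a \<in> lc p" "p \<ge> 1" "y \<in> lc q" "q \<ge> 1"
  shows "lead (q + k * p) ((cm a ^^ k) y) = (ad (lead p a) ^^ k) (lead q y)"
proof (induction k)
  case (Suc k)
  have "lead (p + (q + k * p)) (cm a ((cm a ^^ k) y)) = ad (lead p a) (lead (q + k * p) ((cm a ^^ k) y))"
    unfolding ad_def by (rule lead_cm[OF assms(1) cm_pow_lc[OF assms]])
  then show ?case using Suc by (simp add: ac_simps)
qed simp

abbreviation lead' :: "nat \<times> 'a \<Rightarrow> 'x nc_series" where
  "lead' \<equiv> (\<lambda>(n, b). lead n b)"

text \<open>Iterated commutators with \<open>a\<close> have as leading parts iterated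
  \<open>ad\<close> of the leading part of \<open>a\<close>, so \<open>right_indep_ad\<close>
  applies.\<close>

lemma right_indep_elim:
  assumes B: "weighted B" and a: "(p, a) \<in> B" and ri: "right_indep B lead'"
  shows "right_indep (lazard_elim B p a) lead'"
  unfolding lazard_elim_def
proof (rule right_indep_image)
  show "right_indep (UNIV \<times> (B - {(p, a)})) (\<lambda>z. lead' (case z of (k, q, y) \<Rightarrow> (q + k * p, (cm a ^^ k) y)))"
  proof (rule right_indep_cong[OF _ right_indep_ad[OF ri a]])
    fix z :: "nat \<times> nat \<times> 'a" assume "z \<in> UNIV \<times> (B - {(p, a)})"
    then show "(case z of (k, y) \<Rightarrow> (ad (lead' (p, a)) ^^ k) (lead' y)) =
        lead' (case z of (k, q, y) \<Rightarrow> (q + k * p, (cm a ^^ k) y))"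
      using weightedD[OF B] a by (auto simp: lead_cm_pow)
  qed
qed

text \<open>New generators have \<open>ad\<close> powers as leading parts, and a right ideal
  contains the ring commutator of any two of its members.\<close>

lemma lie_span_elim_lead:
  assumes B: "weighted B" and a: "(p, a) \<in> B"
  shows "lie_span (lazard_elim B p a) n g \<Longrightarrow> lead n g \<in> aug_rideal (lead p a) (B - {(p, a)}) lead'"
proof (induction rule: lie_span.induct)
  let ?R = "aug_rideal (lead p a) (B - {(p, a)}) lead'"
  note B' = weighted_elim[OF B a]
  have gen_lead: "lead n b \<in> ?R" if nb: "(n, b) \<in> lazard_elim B p a" for n b
  proof -
    obtain k q y where y: "(q, y) \<in> B" "(q, y) \<noteq> (p, a)" "n = q + k * p" "b = (cm a ^^ k) y"
      using nb by (auto simp: lazard_elim_def)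
    have "lead' (q, y) \<in> ord_ge (Suc 0)"
      unfolding prod.case lead_def by (rule ord_ge_anti[OF hpart_ord_ge]) (use weightedD(1)[OF B y(1)] in simp)
    then have "(ad (lead p a) ^^ k) (lead' (q, y)) \<in> ?R"
      using y(1,2) by (intro aug_rideal_ad_pow) auto
    then show ?thesis using y(3,4) weightedD[OF B] y(1) a by (simp add: lead_cm_pow)
  qed
  {
    case (gen n b)
    then show ?case by (rule gen_lead)
  next
    case (deep g n)
    then show ?case by (simp add: lead_lc_Suc aug_rideal_zero)
  next
    case (mult n g h)
    then show ?case using lie_span_lc[OF B'] by (metis aug_rideal.add lead_mult)
  next
    case (inv n g)
    then show ?case using lie_span_lc[OF B'] by (metis aug_rideal_uminus lead_inv)
  next
    case (comm m b n g)
    then have "lead (m + n) (cm b g) = lead m b * lead n g - lead n g * lead m b"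
      using lie_span_lc[OF B' comm(2)] weightedD[OF B' comm(1)] by (intro lead_cm) auto
    then show ?case
      using comm(3) gen_lead[OF comm(1)] by (simp add: aug_rideal_diff aug_rideal_mult)
  }
qed

text \<open>This is injectivity of the leading part in degree \<open>n\<close>. Each elimination of
  an element of least weight \<open>m\<close> lowers their number (inner induction). When none is
  left the bound \<open>m\<close> rises (outer induction), until it exceeds \<open>n\<close> and
  \<open>lie_span_low\<close> applies.\<close>

lemma lie_span_lead_eq_0:
  assumes "lie_span B n g" "weighted B" "right_indep B lead'"
    and "\<And>q. finite {b. (q, b) \<in> B}" "\<And>q b. (q, b) \<in> B \<Longrightarrow> m \<le> q" and "lead n g = 0"
  shows "g \<in> lc (Suc n)"
  using assms
proof (induction "Suc n - m" arbitrary: m B g rule: less_induct)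
  case less
  note outer = less.hyps
  show ?case
  proof (cases "n < m")
    case True
    then show ?thesis using lie_span_low[of B m n g] less.prems by blast
  next
    case False
    from less.prems show ?thesis
    proof (induction "card {b. (m, b) \<in> B}" arbitrary: B g rule: less_induct)
      case less
      show ?case
      proof (cases "\<exists>a. (m, a) \<in> B")
        case False
        have "Suc m \<le> q" if "(q, b) \<in> B" for q b
          using less.prems(5)[OF that] False that by (metis Suc_leI le_neq_implies_less)
        then show ?thesis
          using outer[of "Suc m" B g] less.prems \<open>\<not> n < m\<close> by simp
      next
        case True
        then obtain a where a: "(m, a) \<in> B" by blast
        let ?B' = "lazard_elim B m a"
        note B = less.prems(2) and B' = weighted_elim[OF less.prems(2) a]
        have m: "m \<ge> 1" "a \<in> lc m" using weightedD[OF B a] by auto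
        obtain h e where h: "lie_span ?B' n h" "g = a [^] (e::int) \<otimes> h" "e \<noteq> 0 \<longrightarrow> n = m"
          using lie_span_elim[OF B a less.prems(1)] by blast
        have hc: "h \<in> carrier G" "h \<in> lc n" "n \<ge> 1" using lie_span_carrier[OF B'] lie_span_lc[OF B'] h by auto
        \<comment> \<open>Otherwise \<open>n = m\<close>, and a nonzero multiple of the leading part
          of \<open>a\<close> would be minus that of \<open>h\<close>, which lies in the right ideal
          of \<open>lie_span_elim_lead\<close>.\<close>
        have "e = 0"
        proof (rule ccontr)
          assume "e \<noteq> 0"
          then have n: "n = m" using h(3) by simp
          have "a [^] e \<in> lc m" by (rule subgroup_int_pow_closed[OF lc_subgroup m(2)])
          then have "of_int e * lead m a + lead m h = 0"
            using less.prems(6) h(2) m hc n by (simp add: lead_mult lead_int_pow)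
          then have "of_int e * lead' (m, a) = - lead m h" by (simp add: eq_neg_iff_add_eq_0)
          also have "\<dots> \<in> aug_rideal (lead' (m, a)) (B - {(m, a)}) lead'"
            using lie_span_elim_lead[OF B a h(1)] n by (simp add: aug_rideal_uminus)
          finally show False using aug_rideal_of_int[OF less.prems(3) a] \<open>e \<noteq> 0\<close> by blast
        qed
        then have g: "g = h" using h(2) hc by simp
        \<comment> \<open>Since \<open>m \<ge> 1\<close>, the weight \<open>q = q' + k * m\<close>
          bounds both \<open>k\<close> and \<open>q'\<close>, so finiteness in each weight is
          inherited.\<close>
        have sub: "{b. (q, b) \<in> ?B'} \<subseteq> (\<Union>k\<in>{..q}. \<Union>q'\<in>{..q}. (cm a ^^ k) ` {b. (q', b) \<in> B})" for q
        proof clarify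
          fix b assume "(q, b) \<in> ?B'"
          then obtain k q' y where y: "(q', y) \<in> B" "q = q' + k * m" "b = (cm a ^^ k) y"
            by (auto simp: lazard_elim_def)
          moreover have "k \<le> q" using y(2) m(1) by (metis One_nat_def le_add2 le_trans mult.right_neutral mult_le_mono2)
          moreover have "q' \<le> q" using y(2) by simp
          ultimately show "b \<in> (\<Union>k\<in>{..q}. \<Union>q'\<in>{..q}. (cm a ^^ k) ` {b. (q', b) \<in> B})" by blast
        qed
        have fin: "finite {b. (q, b) \<in> ?B'}" for q
          by (rule finite_subset[OF sub]) (use less.prems(4) in auto)
        have low: "m \<le> q" if qb: "(q, b) \<in> ?B'" for q b
        proof -
          obtain k q' y where "(q', y) \<in> B" "q = q' + k * m" using qb by (auto simp: lazard_elim_def)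
          then show ?thesis using less.prems(5)[of q' y] by simp
        qed
        \<comment> \<open>In the least weight only \<open>k = 0\<close> is possible, and
          \<open>a\<close> itself is gone.\<close>
        have "{b. (m, b) \<in> ?B'} \<subseteq> {b. (m, b) \<in> B} - {a}"
        proof
          fix b assume "b \<in> {b. (m, b) \<in> ?B'}"
          then obtain k q' y where y: "(q', y) \<in> B" "(q', y) \<noteq> (m, a)" "m = q' + k * m" "b = (cm a ^^ k) y"
            by (auto simp: lazard_elim_def)
          have "m \<le> q'" using less.prems(5) y(1) by blast
          then have "k * m = 0" "q' = m" using y(3) by linarith+
          then show "b \<in> {b. (m, b) \<in> B} - {a}" using y m(1) by simp
        qed
        then have "card {b. (m, b) \<in> ?B'} < card {b. (m, b) \<in> B}"
          using a less.prems(4)[of m] by (intro psubset_card_mono) auto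
        then have "h \<in> lc (Suc n)"
          using less.hyps[of ?B' h] h(1) B' right_indep_elim[OF B a less.prems(3)] fin low less.prems(6) g by blast
        then show ?thesis using g by simp
      qed
    qed
  qed
qed

text \<open>The hard direction raises the depth of \<open>g\<close> one step at a time: an element
  of \<open>lc (Suc k)\<close> is in the span of brackets of generators, and it lies one step deeper
  once its leading part vanishes.\<close>

theorem lc_iff_ord_ge:
  assumes E: "finite E" "E \<subseteq> carrier G" "generate G E = carrier G" and ri: "right_indep E (lead 1)"
    and g: "g \<in> carrier G" "n \<ge> 1"
  shows "g \<in> lc n \<longleftrightarrow> \<mu> g - 1 \<in> ord_ge n"
proof
  assume "\<mu> g - 1 \<in> ord_ge n"
  define B where "B = Pair (1::nat) ` E"
  have B: "weighted B" using E(2) by (auto simp: B_def weighted_def)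
  have riB: "right_indep B lead'" unfolding B_def by (rule right_indep_image) (use ri in simp)
  have fin: "finite {b. (q, b) \<in> B}" for q
    by (rule finite_subset[of _ E]) (use E(1) in \<open>auto simp: B_def\<close>)
  \<comment> \<open>Every element of depth \<open>Suc k\<close> is, up to deeper terms, a product of
    iterated brackets of elements of \<open>E\<close>. In a commutator \<open>cm x y\<close> with
    \<open>x\<close> deep, the other entry \<open>y\<close> is decomposed along
    \<open>generate G E\<close>.\<close>
  have span: "lie_span B (Suc k) g" if "g \<in> lc (Suc k)" for g k
    using that
  proof (induction k arbitrary: g)
    case 0
    then have "g \<in> generate G E" using E(3) by simp
    then have "lie_span B 1 g"
    proof induction
      case one
      then show ?case using lc_one by (intro lie_span.deep) auto
    next
      case (incl h)
      then show ?case by (intro lie_span.gen) (auto simp: B_def)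
    next
      case (inv h)
      then show ?case by (intro lie_span.inv lie_span.gen) (auto simp: B_def)
    qed (rule lie_span.mult)
    then show ?case by simp
  next
    case (Suc k)
    have gen: "lie_span B (Suc (Suc k)) (cm x y)" if x: "x \<in> lc (Suc k)" and "y \<in> carrier G" for x y
    proof -
      have xc: "x \<in> carrier G" using x lc_carrier by blast
      have "y \<in> generate G E" using that E(3) by simp
      then have "y \<in> carrier G \<and> lie_span B (Suc (Suc k)) (cm y x)"
      proof induction
        case one
        have "cm \<one> x = \<one>" using xc by (simp add: commutator_def)
        then show ?case using lc_one by (auto intro: lie_span.deep)
      next
        case (incl h)
        then have "lie_span B (1 + Suc k) (cm h x)" by (intro lie_span.comm Suc.IH x) (auto simp: B_def)
        then show ?case using incl E(2) by auto
      next
        case (inv h)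
        then have h: "h \<in> carrier G" using E(2) by blast
        have "lie_span B (1 + Suc k) (cm h x)" using inv by (intro lie_span.comm Suc.IH x) (auto simp: B_def)
        then have "lie_span B (1 + Suc k) (inv h \<otimes> inv (cm h x) \<otimes> inv (inv h))"
          using h by (intro lie_span_conj[OF B] lie_span.inv) auto
        then show ?case using h xc by (simp add: cm_inv_left)
      next
        case (eng h1 h2)
        then have "lie_span B (Suc (Suc k)) (h1 \<otimes> cm h2 x \<otimes> inv h1 \<otimes> cm h1 x)"
          by (intro lie_span.mult lie_span_conj[OF B]) auto
        then show ?case using eng xc by (simp add: cm_mult_left)
      qed
      then have "lie_span B (Suc (Suc k)) (inv (cm y x))" by (blast intro: lie_span.inv)
      then show ?thesis using xc that(2) by (simp add: cm_swap)
    qed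
    have "g \<in> generate G {x \<otimes> y \<otimes> inv x \<otimes> inv y | x y. x \<in> lc (Suc k) \<and> y \<in> carrier G}"
      using Suc.prems by (simp add: lower_central.simps(3))
    then show ?case
    proof induction
      case one
      then show ?case using lc_one by (auto intro: lie_span.deep)
    next
      case (incl h)
      then show ?case using gen by (auto simp: commutator_def)
    next
      case (inv h)
      then show ?case using gen by (auto simp: commutator_def intro: lie_span.inv)
    qed (rule lie_span.mult)
  qed
  have "g \<in> lc (Suc k)" if "\<mu> g - 1 \<in> ord_ge (Suc k)" for k
    using that
  proof (induction k)
    case 0
    then show ?case using g by simp
  next
    case (Suc k)
    have *: "g \<in> lc (Suc k)" "lead (Suc k) g = 0"
      unfolding lead_def by (intro Suc.IH ord_ge_anti[OF Suc.prems], simp) (rule hpart_eq_0[OF Suc.prems])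
    show ?case
      by (rule lie_span_lead_eq_0[OF span[OF *(1)] B riB fin, of 1]) (auto simp: B_def *)
  qed
  from this[of "n - 1"] show "g \<in> lc n" using \<open>\<mu> g - 1 \<in> ord_ge n\<close> g(2) by simp
qed (rule ord_lc)

end

subsection \<open>The Magnus embedding of a free group\<close>

definition var_series :: "'x \<Rightarrow> 'x nc_series" where
  "var_series x = nc_series (\<lambda>w. if w = [x] then 1 else 0)"

lemma coeff_var_series: "coeff (var_series x) w = (if w = [x] then 1 else 0)"
  by (simp add: var_series_def nc_series_inverse)

lemma coeff_var_mult_Cons: "coeff (var_series x * f) (y # w) = (if x = y then coeff f w else 0)"
proof -
  have "lquot y (var_series x) = (if x = y then 1 else 0)"
    by (rule nc_series_eqI) (auto simp: coeff_var_series coeff_1)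
  then show ?thesis by (simp add: coeff_mult_Cons coeff_var_series)
qed

lemma right_indep_var_series: "right_indep I var_series"
proof (rule right_indepI, rule nc_series_eqI)
  fix J a j w
  assume J: "finite J" "(\<Sum>j\<in>J. var_series j * a j) = 0" "j \<in> (J::'a set)"
  have "coeff (\<Sum>i\<in>J. var_series i * a i) (j # w) = (\<Sum>i\<in>J. if i = j then coeff (a i) w else 0)"
    by (simp add: coeff_sum coeff_var_mult_Cons)
  then show "coeff (a j) w = coeff 0 w" using J by simp
qed

lemma generate_free_group:
  "generate (free_group B) ((\<lambda>x. [(x, True)]) ` B) = carrier (free_group B)" (is "generate ?F ?X = _")
proof -
  interpret F: group ?F by (rule group_free_group)
  have X: "?X \<subseteq> carrier ?F" by (auto simp: free_group_def)
  have letter: "[a] \<in> generate ?F ?X" if a: "fst a \<in> B" for a :: "'a letter"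
  proof (cases a)
    case (Pair x b)
    have c: "[(x, b)] \<in> carrier ?F" for b using a Pair by (simp add: free_group_def)
    have "[(x, False)] \<otimes>\<^bsub>?F\<^esub> [(x, True)] = \<one>\<^bsub>?F\<^esub>"
      by (simp add: free_group_def reduce_word_def inv_letter_def)
    then have "[(x, False)] = inv\<^bsub>?F\<^esub> [(x, True)]" using F.inv_equality[OF _ c c] by metis
    moreover have "[(x, True)] \<in> ?X" using a Pair by auto
    ultimately show ?thesis using Pair by (cases b) (auto intro: generate.incl generate.inv)
  qed
  have "w \<in> generate ?F ?X" if "w \<in> lists (B \<times> UNIV)" "reduced_word w" for w
    using that
  proof (induction w)
    case Nil
    have "\<one>\<^bsub>?F\<^esub> \<in> generate ?F ?X" by (rule generate.one)
    then show ?case by (simp add: free_group_def)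
  next
    case (Cons a w)
    have "[a] \<otimes>\<^bsub>?F\<^esub> w = a # w" using Cons.prems by (simp add: free_group_def reduce_eq)
    moreover have "[a] \<otimes>\<^bsub>?F\<^esub> w \<in> generate ?F ?X"
      using Cons letter[of a] by (intro generate.eng) (auto dest: reduced_tl)
    ultimately show ?case by simp
  qed
  then have "carrier ?F \<subseteq> generate ?F ?X" by (auto simp: free_group_def)
  then show ?thesis using F.generate_incl[OF X] by blast
qed

theorem magnus_witt:
  assumes "finite B"
  shows "\<exists>\<mu>. series_rep (free_group B) \<mu> \<and> (\<forall>x\<in>B. \<mu> [(x, True)] = 1 + var_series x) \<and>
    (\<forall>w\<in>carrier (free_group B). \<forall>n\<ge>1. w \<in> lower_central (free_group B) n \<longleftrightarrow> \<mu> w - 1 \<in> ord_ge n)"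
proof -
  let ?F = "free_group B"
  have "(\<lambda>x. 1 + var_series x) \<in> B \<rightarrow> carrier unit_series"
    by (auto simp: unit_series_def coeff_1 coeff_var_series)
  then obtain \<mu> where \<mu>: "\<mu> \<in> hom ?F unit_series" "\<forall>x\<in>B. \<mu> [(x, True)] = 1 + var_series x"
    using free_group_universal[OF group_unit_series] by blast
  interpret group ?F by (rule group_free_group)
  interpret series_rep ?F \<mu>
    using \<mu>(1) by unfold_locales (auto simp: hom_def unit_series_def Pi_iff)
  let ?X = "(\<lambda>x. [(x, True)]) ` B"
  have lead: "lead 1 [(x, True)] = var_series x" if "x \<in> B" for x
    using \<mu>(2) that by (simp add: lead_def) (rule nc_series_eqI, auto simp: coeff_hpart coeff_var_series)
  have "right_indep B (\<lambda>x. lead 1 [(x, True)])"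
    by (rule right_indep_cong[OF _ right_indep_var_series]) (simp only: lead)
  then have "right_indep ?X (lead 1)" by (rule right_indep_image)
  then have "w \<in> lower_central ?F n \<longleftrightarrow> \<mu> w - 1 \<in> ord_ge n" if "w \<in> carrier ?F" "n \<ge> 1" for w n
    using that assms by (intro lc_iff_ord_ge[OF _ _ generate_free_group]) (auto simp: free_group_def)
  then show ?thesis using \<mu>(2) series_rep_axioms by blast
qed

section \<open>Approximate power series representations\<close>

text \<open>Multiplicativity holds only up to order \<open>c\<close> because values come from
  arbitrarily chosen lifts to the free group. The case \<open>m = 1\<close> of the second clause
  forces constant term 1.\<close>

definition approx_rep :: "('a, 'b) monoid_scheme \<Rightarrow> nat \<Rightarrow> ('a \<Rightarrow> 'x nc_series) \<Rightarrow> bool" where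
  "approx_rep G c \<psi> \<longleftrightarrow>
    (\<forall>g\<in>carrier G. \<forall>h\<in>carrier G. \<psi> (g \<otimes>\<^bsub>G\<^esub> h) - \<psi> g * \<psi> h \<in> ord_ge c) \<and>
    (\<forall>g\<in>carrier G. \<forall>m\<ge>1. m \<le> c \<longrightarrow> (g \<in> lower_central G m \<longleftrightarrow> \<psi> g - 1 \<in> ord_ge m))"

lemma approx_repD:
  assumes "approx_rep G c \<psi>"
  shows "g \<in> carrier G \<Longrightarrow> h \<in> carrier G \<Longrightarrow> \<psi> (g \<otimes>\<^bsub>G\<^esub> h) - \<psi> g * \<psi> h \<in> ord_ge c"
    and "g \<in> carrier G \<Longrightarrow> m \<ge> 1 \<Longrightarrow> m \<le> c \<Longrightarrow> g \<in> lower_central G m \<longleftrightarrow> \<psi> g - 1 \<in> ord_ge m"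
  using assms by (auto simp: approx_rep_def)

lemma (in group_hom) lower_central_image:
  assumes "h ` carrier G = carrier H"
  shows "h ` lower_central G n = lower_central H n"
proof -
  have "h ` lower_central G (Suc n) = lower_central H (Suc n)" for n
  proof (induction n)
    case (Suc n)
    let ?C = "{x \<otimes> y \<otimes> inv x \<otimes> inv y | x y. x \<in> lower_central G (Suc n) \<and> y \<in> carrier G}"
    have sub: "lower_central G (Suc n) \<subseteq> carrier G" by (rule subsetI) (rule G.lc_carrier)
    have "h ` ?C = {x \<otimes>\<^bsub>H\<^esub> y \<otimes>\<^bsub>H\<^esub> inv\<^bsub>H\<^esub> x \<otimes>\<^bsub>H\<^esub> inv\<^bsub>H\<^esub> y | x y. x \<in> lower_central H (Suc n) \<and> y \<in> carrier H}"
      (is "_ = ?D")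
    proof
      have "h (x \<otimes> y \<otimes> inv x \<otimes> inv y) \<in> ?D" if "x \<in> lower_central G (Suc n)" "y \<in> carrier G" for x y
      proof -
        have "h (x \<otimes> y \<otimes> inv x \<otimes> inv y) = h x \<otimes>\<^bsub>H\<^esub> h y \<otimes>\<^bsub>H\<^esub> inv\<^bsub>H\<^esub> h x \<otimes>\<^bsub>H\<^esub> inv\<^bsub>H\<^esub> h y"
          using that sub by (simp add: subset_iff)
        moreover have "h x \<in> lower_central H (Suc n)"
          using imageI[OF that(1), of h] unfolding Suc.IH .
        ultimately show ?thesis using hom_closed[OF that(2)] by blast
      qed
      then show "h ` ?C \<subseteq> ?D" by blast
      show "?D \<subseteq> h ` ?C"
      proof
        fix z assume "z \<in> ?D"
        then obtain x' y' where z: "z = x' \<otimes>\<^bsub>H\<^esub> y' \<otimes>\<^bsub>H\<^esub> inv\<^bsub>H\<^esub> x' \<otimes>\<^bsub>H\<^esub> inv\<^bsub>H\<^esub> y'"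
          "x' \<in> lower_central H (Suc n)" "y' \<in> carrier H" by blast
        then obtain x y where xy: "x \<in> lower_central G (Suc n)" "x' = h x" "y \<in> carrier G" "y' = h y"
          unfolding Suc.IH[symmetric] assms[symmetric] by blast
        then have "z = h (x \<otimes> y \<otimes> inv x \<otimes> inv y)" using z sub by (simp add: subset_iff)
        then show "z \<in> h ` ?C" using xy by blast
      qed
    qed
    moreover have "?C \<subseteq> carrier G" using sub by auto
    ultimately show ?case by (simp only: lower_central.simps(3) generate_img[symmetric])
  qed (simp add: assms)
  then show ?thesis using assms by (cases n) simp_all
qed

text \<open>Both \<open>G\<close> and the free group map onto \<open>?QF\<close>, the former through
  \<phi>. The value of \<psi> at \<open>g\<close> is the Magnus series of any word with the same
  image; different choices agree up to order \<open>c\<close>.\<close>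

lemma approx_rep_exists:
  assumes G: "group G" and B: "finite B" and c: "c \<ge> 1"
    and iso: "(G Mod lower_central G c) \<cong> (free_group B Mod lower_central (free_group B) c)"
  shows "\<exists>\<psi>. approx_rep G c \<psi> \<and> (\<forall>x\<in>B. \<exists>g\<in>carrier G. \<psi> g - (1 + var_series x) \<in> ord_ge c)"
proof -
  let ?F = "free_group B"
  interpret G: group G by fact
  interpret F: group ?F by (rule group_free_group)
  obtain \<mu> where "series_rep ?F \<mu>" and \<mu>_var: "\<And>x. x \<in> B \<Longrightarrow> \<mu> [(x, True)] = 1 + var_series x"
    and \<mu>_lc: "\<And>w n. w \<in> carrier ?F \<Longrightarrow> n \<ge> 1 \<Longrightarrow> w \<in> F.lc n \<longleftrightarrow> \<mu> w - 1 \<in> ord_ge n"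
    using magnus_witt[OF B] by blast
  interpret \<mu>: series_rep ?F \<mu> by fact
  let ?QG = "G Mod G.lc c" and ?QF = "?F Mod F.lc c"
  let ?\<pi>G = "\<lambda>g. G.lc c #>\<^bsub>G\<^esub> g" and ?\<pi>F = "\<lambda>w. F.lc c #>\<^bsub>?F\<^esub> w"
  obtain \<phi> where \<phi>: "\<phi> \<in> hom ?QG ?QF" "bij_betw \<phi> (carrier ?QG) (carrier ?QF)"
    using iso by (auto simp: is_iso_def iso_def)
  have grQF: "group ?QF" and grQG: "group ?QG"
    using normal.factorgroup_is_group[OF F.lc_normal] normal.factorgroup_is_group[OF G.lc_normal] .
  have homF: "?\<pi>F \<in> hom ?F ?QF" and homG: "?\<pi>G \<in> hom G ?QG"
    using normal.r_coset_hom_Mod[OF F.lc_normal] normal.r_coset_hom_Mod[OF G.lc_normal] .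
  have surjF: "?\<pi>F ` carrier ?F = carrier ?QF" and surjG: "?\<pi>G ` carrier G = carrier ?QG"
    by (auto simp: FactGroup_def RCOSETS_def)
  define p where "p g = \<phi> (?\<pi>G g)" for g
  have p: "p \<in> hom G ?QF" using hom_compose[OF homG \<phi>(1)] by (simp add: p_def[abs_def] comp_def)
  have surjp: "p ` carrier G = carrier ?QF"
    using surjG \<phi>(2) by (simp add: p_def[abs_def] bij_betw_def image_image[symmetric])
  interpret QF: group ?QF by (rule grQF)
  interpret p: group_hom G ?QF p by unfold_locales (rule p)
  interpret \<pi>: group_hom ?F ?QF ?\<pi>F by unfold_locales (rule homF)
  \<comment> \<open>Both sides are the lower central series of the common quotient, since surjective
    homomorphisms map these series onto each other.\<close>
  have pF: "p ` G.lc m = ?\<pi>F ` F.lc m" for m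
    using p.lower_central_image[OF surjp] \<pi>.lower_central_image[OF surjF] by simp
  have p_eq: "g \<otimes>\<^bsub>G\<^esub> inv\<^bsub>G\<^esub> g' \<in> G.lc c" if "p g = p g'" "g \<in> carrier G" "g' \<in> carrier G" for g g'
  proof -
    have "?\<pi>G g \<in> carrier ?QG" "?\<pi>G g' \<in> carrier ?QG"
      using that(2,3)[THEN imageI, of ?\<pi>G] unfolding surjG .
    then have "?\<pi>G g = ?\<pi>G g'"
      by (rule inj_onD[OF bij_betw_imp_inj_on[OF \<phi>(2)] that(1)[unfolded p_def]])
    then show ?thesis by (rule iffD1[OF G.coset_eq_iff[OF G.lc_normal that(2,3)]])
  qed
  have lift: "\<exists>w. w \<in> carrier ?F \<and> ?\<pi>F w = p g" if "g \<in> carrier G" for g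
  proof -
    have "p g \<in> ?\<pi>F ` carrier ?F" using imageI[OF that, of p] unfolding surjp surjF .
    then show ?thesis by (rule imageE) (intro exI conjI; simp)
  qed
  define f where "f g = (SOME w. w \<in> carrier ?F \<and> ?\<pi>F w = p g)" for g
  have f: "f g \<in> carrier ?F" "?\<pi>F (f g) = p g" if "g \<in> carrier G" for g
    using someI_ex[OF lift[OF that]] unfolding f_def by simp_all
  have \<mu>_eq: "\<mu> v - \<mu> w \<in> ord_ge c" if "?\<pi>F v = ?\<pi>F w" "v \<in> carrier ?F" "w \<in> carrier ?F" for v w
  proof -
    have "v \<otimes>\<^bsub>?F\<^esub> inv\<^bsub>?F\<^esub> w \<in> F.lc c"
      by (rule iffD1[OF F.coset_eq_iff[OF F.lc_normal that(2,3)] that(1)])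
    then have "\<mu> (v \<otimes>\<^bsub>?F\<^esub> inv\<^bsub>?F\<^esub> w) - 1 \<in> ord_ge c" by (rule \<mu>.ord_lc)
    then have "(\<mu> (v \<otimes>\<^bsub>?F\<^esub> inv\<^bsub>?F\<^esub> w) - 1) * \<mu> w \<in> ord_ge c" by (rule ord_ge_mult_right)
    moreover have "\<mu> (v \<otimes>\<^bsub>?F\<^esub> inv\<^bsub>?F\<^esub> w) * \<mu> w = \<mu> v"
      using that by (simp add: \<mu>.\<mu>_mult[symmetric] F.m_assoc)
    ultimately show ?thesis by (simp add: algebra_simps)
  qed
  define \<psi> where "\<psi> g = \<mu> (f g)" for g
  have "\<psi> (g \<otimes>\<^bsub>G\<^esub> h) - \<psi> g * \<psi> h \<in> ord_ge c" if "g \<in> carrier G" "h \<in> carrier G" for g h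
  proof -
    have "?\<pi>F (f (g \<otimes>\<^bsub>G\<^esub> h)) = ?\<pi>F (f g \<otimes>\<^bsub>?F\<^esub> f h)"
      using that f by simp
    then show ?thesis
      using \<mu>_eq[of "f (g \<otimes>\<^bsub>G\<^esub> h)" "f g \<otimes>\<^bsub>?F\<^esub> f h"] that f by (simp add: \<psi>_def \<mu>.\<mu>_mult)
  qed
  moreover have "g \<in> G.lc m \<longleftrightarrow> \<psi> g - 1 \<in> ord_ge m" if g: "g \<in> carrier G" and m: "m \<ge> 1" "m \<le> c" for g m
  proof -
    have "g \<in> G.lc m \<longleftrightarrow> f g \<in> F.lc m"
    proof
      assume "g \<in> G.lc m"
      then have "?\<pi>F (f g) \<in> ?\<pi>F ` F.lc m" unfolding pF[symmetric] f(2)[OF g] by (rule imageI)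
      then obtain w where w: "?\<pi>F (f g) = ?\<pi>F w" "w \<in> F.lc m" by (rule imageE)
      have wc: "w \<in> carrier ?F" using w(2) by (rule F.lc_carrier)
      have "f g \<otimes>\<^bsub>?F\<^esub> inv\<^bsub>?F\<^esub> w \<in> F.lc c"
        by (rule iffD1[OF F.coset_eq_iff[OF F.lc_normal f(1)[OF g] wc] w(1)])
      then have "f g \<otimes>\<^bsub>?F\<^esub> inv\<^bsub>?F\<^esub> w \<otimes>\<^bsub>?F\<^esub> w \<in> F.lc m"
        by (rule F.lc_mult[OF F.lc_antiD[OF _ m(2)] w(2)])
      then show "f g \<in> F.lc m" using wc f(1)[OF g] by (simp add: F.m_assoc)
    next
      assume "f g \<in> F.lc m"
      then have "p g \<in> p ` G.lc m" unfolding pF f(2)[OF g, symmetric] by (rule imageI)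
      then obtain g' where g': "p g = p g'" "g' \<in> G.lc m" by (rule imageE)
      have g'c: "g' \<in> carrier G" using g'(2) by (rule G.lc_carrier)
      have "g \<otimes>\<^bsub>G\<^esub> inv\<^bsub>G\<^esub> g' \<otimes>\<^bsub>G\<^esub> g' \<in> G.lc m"
        by (rule G.lc_mult[OF G.lc_antiD[OF p_eq[OF g'(1) g g'c] m(2)] g'(2)])
      then show "g \<in> G.lc m" using g g'c by (simp add: G.m_assoc)
    qed
    then show ?thesis using \<mu>_lc[OF f(1)[OF g] m(1)] by (simp add: \<psi>_def)
  qed
  ultimately have "approx_rep G c \<psi>" by (simp add: approx_rep_def)
  moreover have "\<exists>g\<in>carrier G. \<psi> g - (1 + var_series x) \<in> ord_ge c" if x: "x \<in> B" for x
  proof -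
    have xc: "[(x, True)] \<in> carrier ?F" using x by (simp add: free_group_def)
    then have "?\<pi>F [(x, True)] \<in> p ` carrier G" unfolding surjp surjF[symmetric] by (rule imageI)
    then obtain g where g: "p g = ?\<pi>F [(x, True)]" "g \<in> carrier G" by (metis imageE)
    have "\<mu> (f g) - \<mu> [(x, True)] \<in> ord_ge c"
      by (rule \<mu>_eq[OF _ f(1)[OF g(2)] xc]) (simp add: f(2)[OF g(2)] g(1))
    then show ?thesis using g(2) \<mu>_var[OF x] by (auto simp: \<psi>_def)
  qed
  ultimately show ?thesis by blast
qed

section \<open>Detecting free subgroups\<close>

definition word_eval :: "('a, 'b) monoid_scheme \<Rightarrow> ('i \<Rightarrow> 'a) \<Rightarrow> 'i letter list \<Rightarrow> 'a" where
  "word_eval G g w = foldr (\<lambda>(i, b) y. (if b then g i else inv\<^bsub>G\<^esub> g i) \<otimes>\<^bsub>G\<^esub> y) w \<one>\<^bsub>G\<^esub>"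

lemma word_eval_Nil [simp]: "word_eval G g [] = \<one>\<^bsub>G\<^esub>"
  by (simp add: word_eval_def)

lemma word_eval_Cons [simp]:
  "word_eval G g ((i, b) # w) = (if b then g i else inv\<^bsub>G\<^esub> g i) \<otimes>\<^bsub>G\<^esub> word_eval G g w"
  by (simp add: word_eval_def)

text \<open>
  The coefficient of the monomial \<open>z\<close> in the Magnus expansion of the word \<open>w\<close>, where the letter
  \<open>(i, True)\<close> stands for \<open>1 + X\<^sub>i\<close> and \<open>(i, False)\<close> for its inverse.
\<close>

fun magnus_coeff :: "'i letter list \<Rightarrow> 'i list \<Rightarrow> int" where
  "magnus_coeff [] z = (if z = [] then 1 else 0)"
| "magnus_coeff ((i, True) # w) [] = magnus_coeff w []"
| "magnus_coeff ((i, True) # w) (j # z) = magnus_coeff w (j # z) + (if j = i then magnus_coeff w z else 0)"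
| "magnus_coeff ((i, False) # w) [] = magnus_coeff w []"
| "magnus_coeff ((i, False) # w) (j # z) =
    magnus_coeff w (j # z) - (if j = i then magnus_coeff ((i, False) # w) z else 0)"

text \<open>In a monomial without adjacent repetitions a single letter contributes at most one
  variable. Hence the inverse of \<open>1 + X\<close> acts like \<open>1 - X\<close>, and higher
  powers are invisible.\<close>

lemma magnus_coeff_Cons:
  assumes "distinct_adj z"
  shows "magnus_coeff ((i, b) # w) z = magnus_coeff w z +
    (if z \<noteq> [] \<and> hd z = i then (if b then 1 else - 1) * magnus_coeff w (tl z) else 0)"
proof (cases b)
  case True
  then show ?thesis by (cases z) auto
next
  case False
  have *: "magnus_coeff ((i, False) # w) z' = magnus_coeff w z'" if "z' = [] \<or> hd z' \<noteq> i" for z'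
    using that by (cases z') auto
  show ?thesis
  proof (cases z)
    case (Cons j z')
    then have "z' = [] \<or> hd z' \<noteq> j" using assms by (cases z') auto
    then show ?thesis using False Cons *[of z'] by auto
  qed (simp add: False)
qed

abbreviation syllables :: "'i letter list \<Rightarrow> 'i list" where
  "syllables w \<equiv> remdups_adj (map fst w)"

text \<open>Such a monomial draws at most one variable from each syllable of \<open>w\<close>. It
  cannot be longer than the number of syllables, and at equal length its first variable must come
  from the first syllable.\<close>

lemma magnus_coeff_eq_0:
  assumes "distinct_adj z"
    and "length z > length (syllables w) \<or>
      length z = length (syllables w) \<and> w \<noteq> [] \<and> hd z \<noteq> fst (hd w)"
  shows "magnus_coeff w z = 0"
  using assms
proof (induction w arbitrary: z)
  case (Cons a w)
  obtain i b where a: "a = (i, b)" by fastforce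
  have "length (syllables (a # w)) > 0" by (simp del: remdups_adj.simps)
  then have "length z > 0" using Cons.prems(2) by (elim disjE conjE) linarith+
  then have zne: "z \<noteq> []" by simp
  then obtain j z' where z: "z = j # z'" by (cases z) auto
  have dz: "distinct_adj z'" "z' \<noteq> [] \<Longrightarrow> hd z' \<noteq> j" using Cons.prems(1) unfolding z distinct_adj_Cons by auto
  show ?case
  proof (cases w)
    case Nil
    then show ?thesis using Cons.prems a z by (cases z') (auto simp: magnus_coeff_Cons)
  next
    case (Cons a' w')
    note w = this
    obtain i' b' where a': "a' = (i', b')" by fastforce
    have len: "length (syllables (a # w)) = (if i = i' then length (syllables w) else Suc (length (syllables w)))"
      using w a a' by simp
    have pos: "length (syllables w) \<ge> 1" using w by (simp add: Suc_le_eq)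
    have 1: "magnus_coeff w z = 0"
    proof (rule Cons.IH[OF Cons.prems(1)])
    qed (use Cons.prems(2) len w a a' in \<open>auto split: if_splits\<close>)
    have 2: "magnus_coeff w z' = 0" if "j = i"
    proof (rule Cons.IH[OF dz(1)])
      have "length z > length (syllables (a # w))" using Cons.prems(2) that a z by auto
      then show "length z' > length (syllables w) \<or>
          length z' = length (syllables w) \<and> w \<noteq> [] \<and> hd z' \<noteq> fst (hd w)"
        using len pos z that dz(2) w a' by (cases "i = i'"; cases z') auto
    qed
    show ?thesis using 1 2 Cons.prems(1) by (auto simp: a z magnus_coeff_Cons)
  qed
qed simp

text \<open>If the syllables have exponents e_1, ..., e_k, the coefficient of the syllable monomial
  is their product. Here \<open>n\<close> is the absolute value of e_1, its sign is that of the
  first letter, and the tail carries the other exponents. In a reduced word the letters of one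
  syllable have the same sign, so none of the exponents is 0.\<close>

lemma magnus_coeff_syllables:
  assumes "reduced_word w" "w \<noteq> []"
  shows "\<exists>n\<ge>1. magnus_coeff w (syllables w) =
      (if snd (hd w) then 1 else - 1) * int n * magnus_coeff w (tl (syllables w)) \<and>
    magnus_coeff w (tl (syllables w)) \<noteq> 0"
  using assms
proof (induction w)
  case (Cons a w)
  obtain i b where a: "a = (i, b)" by fastforce
  have dsa: "distinct_adj (syllables v)" for v :: "'a letter list" by simp
  show ?case
  proof (cases w)
    case Nil
    then show ?thesis by (intro exI[of _ 1]) (auto simp: a magnus_coeff_Cons)
  next
    case w: (Cons a' w')
    obtain i' b' where a': "a' = (i', b')" by fastforce
    have red: "reduced_word w" using Cons.prems(1) by (auto dest: reduced_tl)
    then obtain n where n: "n \<ge> 1"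
      "magnus_coeff w (syllables w) = (if snd (hd w) then 1 else - 1) * int n * magnus_coeff w (tl (syllables w))"
      "magnus_coeff w (tl (syllables w)) \<noteq> 0" using Cons.IH w by blast
    have hs: "syllables w \<noteq> []" "hd (syllables w) = i'" using w a' by simp_all
    show ?thesis
    proof (cases "i = i'")
      case True
      have b: "b = b'" using Cons.prems(1) True by (auto simp: a a' w inv_letter_def)
      have s: "syllables (a # w) = syllables w" using w a a' True by simp
      obtain t where t: "syllables w = i # t" using hs True by (cases "syllables w") auto
      have dt: "distinct_adj t" "t \<noteq> [] \<Longrightarrow> hd t \<noteq> i"
        using dsa[of w] unfolding t distinct_adj_Cons by auto
      have "magnus_coeff (a # w) t = magnus_coeff w t"
        using dt by (auto simp: a magnus_coeff_Cons)
      moreover have "magnus_coeff (a # w) (i # t) = magnus_coeff w (i # t) + (if b then 1 else - 1) * magnus_coeff w t"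
        using dsa[of w] unfolding t by (simp add: a magnus_coeff_Cons)
      ultimately show ?thesis
        using n unfolding s t by (intro exI[of _ "Suc n"]) (simp add: a b a' w algebra_simps)
    next
      case False
      have s: "syllables (a # w) = i # syllables w" using w a a' False by simp
      have "magnus_coeff (a # w) (syllables w) = magnus_coeff w (syllables w)"
        using hs False by (simp add: a magnus_coeff_Cons)
      moreover have "magnus_coeff w (i # syllables w) = 0"
        using hs False w a' by (intro magnus_coeff_eq_0) (auto simp: distinct_adj_Cons)
      then have "magnus_coeff (a # w) (i # syllables w) = (if b then 1 else - 1) * magnus_coeff w (syllables w)"
        using hs False by (simp add: a magnus_coeff_Cons distinct_adj_Cons)
      moreover have "magnus_coeff w (syllables w) \<noteq> 0" using n by auto
      ultimately show ?thesis unfolding s by (intro exI[of _ 1]) (simp add: a)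
    qed
  qed
qed simp

corollary magnus_coeff_syllables_neq_0:
  "reduced_word w \<Longrightarrow> w \<noteq> [] \<Longrightarrow> magnus_coeff w (syllables w) \<noteq> 0"
  using magnus_coeff_syllables[of w] by (auto split: if_splits)

text \<open>Group the products by their first factor: right independence gives the same kind of
  relation, of smaller weight, for each first letter. Weights at least 1 make the sum finite and the
  induction terminate.\<close>

lemma right_indep_words:
  fixes f :: "'i \<Rightarrow> 'x nc_series" and k :: "'i list \<Rightarrow> int"
  assumes I: "finite I" and m: "\<And>i. i \<in> I \<Longrightarrow> m i \<ge> (1::nat)" and ri: "right_indep I f"
  shows "(\<Sum>z\<in>{z \<in> lists I. sum_list (map m z) = d}. of_int (k z) * prod_list (map f z)) = 0 \<Longrightarrow>
    z \<in> lists I \<Longrightarrow> sum_list (map m z) = d \<Longrightarrow> k z = 0"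
proof (induction d arbitrary: k z rule: less_induct)
  case (less d)
  define S where "S d = {z \<in> lists I. sum_list (map m z) = d}" for d
  have len: "length z \<le> sum_list (map m z)" if "z \<in> lists I" for z
    using that m by (induction z) force+
  have fin: "finite (S d)" for d
    by (rule finite_subset[OF _ finite_lists_length_le[OF I, of d]]) (use len in \<open>auto simp: S_def in_lists_conv_set\<close>)
  show ?case
  proof (cases "d = 0")
    case True
    have S0: "S 0 = {[]}"
    proof -
      have "z = []" if z: "z \<in> S 0" for z
      proof -
        have "length z \<le> 0" using len[of z] z unfolding S_def by (simp del: sum_list_eq_0_iff)
        then show ?thesis by simp
      qed
      then show ?thesis by (auto simp: S_def)
    qed
    have "(\<Sum>z\<in>S 0. of_int (k z) * prod_list (map f z)) = 0"
      using less.prems(1) True by (simp only: S_def)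
    then have "of_int (k []) * (1 :: 'x nc_series) = 0" by (simp add: S0)
    then have "coeff (of_int (k []) * (1 :: 'x nc_series)) [] = 0" by (simp only: coeff_simps)
    then have "k [] = 0" unfolding coeff_of_int_mult by (simp add: coeff_1)
    moreover have "z \<in> S 0" using less.prems True by (simp add: S_def)
    ultimately show ?thesis by (simp add: S0)
  next
    case False
    \<comment> \<open>Letters heavier than \<open>d\<close> cannot occur; leaving them out keeps the
      truncated subtraction \<open>d - m i\<close> exact.\<close>
    define I' where "I' = {i \<in> I. m i \<le> d}"
    have I': "finite I'" "I' \<subseteq> I" using I by (auto simp: I'_def)
    have "(\<Sum>z\<in>S d. of_int (k z) * prod_list (map f z)) =
        (\<Sum>(i, z)\<in>(SIGMA i:I'. S (d - m i)). of_int (k (i # z)) * (f i * prod_list (map f z)))"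
    proof (rule sum.reindex_bij_witness[where i = "\<lambda>(i, z). i # z" and j = "\<lambda>z. (hd z, tl z)"])
      fix z assume z: "z \<in> S d"
      then have "z \<noteq> []" using False by (auto simp: S_def)
      then show "(case (hd z, tl z) of (i, z) \<Rightarrow> i # z) = z"
        "(hd z, tl z) \<in> (SIGMA i:I'. S (d - m i))"
        "(case (hd z, tl z) of (i, z) \<Rightarrow> of_int (k (i # z)) * (f i * prod_list (map f z))) =
          of_int (k z) * prod_list (map f z)"
        using z by (cases z; auto simp: S_def I'_def)+
    qed (auto simp: S_def I'_def)
    also have "\<dots> = (\<Sum>i\<in>I'. \<Sum>z\<in>S (d - m i). of_int (k (i # z)) * (f i * prod_list (map f z)))"
      using I' fin by (simp add: sum.Sigma)
    also have "\<dots> = (\<Sum>i\<in>I'. f i * (\<Sum>z\<in>S (d - m i). of_int (k (i # z)) * prod_list (map f z)))"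
      unfolding sum_distrib_left
      by (intro sum.cong refl) (metis mult.assoc mult_of_int_commute)
    finally have 0: "(\<Sum>i\<in>I'. f i * (\<Sum>z\<in>S (d - m i). of_int (k (i # z)) * prod_list (map f z))) = 0"
      using less.prems(1) by (simp only: S_def)
    obtain i z' where z: "z = i # z'" using less.prems False by (cases z) auto
    have i: "i \<in> I'" "z' \<in> lists I" "sum_list (map m z') = d - m i"
      using less.prems by (auto simp: z I'_def)
    have "(\<Sum>z\<in>S (d - m i). of_int (k (i # z)) * prod_list (map f z)) = 0"
      by (rule right_indepD[OF ri 0 I' i(1)])
    moreover have "d - m i < d" using m[of i] i(1) I' False by force
    ultimately show ?thesis
      using less.IH[of "d - m i" "\<lambda>z. k (i # z)" z'] i(2,3) unfolding S_def z by blast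
  qed
qed

lemma prod_list_ord_ge:
  fixes u :: "'i \<Rightarrow> 'x nc_series"
  assumes "\<And>i. i \<in> set z \<Longrightarrow> u i \<in> ord_ge (m i)"
  shows "prod_list (map u z) \<in> ord_ge (sum_list (map m z))"
    and "hpart (sum_list (map m z)) (prod_list (map u z)) = prod_list (map (\<lambda>i. hpart (m i) (u i)) z)"
proof -
  have "prod_list (map u z) \<in> ord_ge (sum_list (map m z)) \<and>
    hpart (sum_list (map m z)) (prod_list (map u z)) = prod_list (map (\<lambda>i. hpart (m i) (u i)) z)"
    using assms
  proof (induction z)
    case Nil
    have "hpart 0 1 = (1 :: 'x nc_series)" by (rule nc_series_eqI) (simp add: coeff_hpart coeff_1)
    then show ?case by simp
  next
    case (Cons i z)
    then show ?case by (auto simp: hpart_mult ord_ge_mult)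
  qed
  then show "prod_list (map u z) \<in> ord_ge (sum_list (map m z))"
    "hpart (sum_list (map m z)) (prod_list (map u z)) = prod_list (map (\<lambda>i. hpart (m i) (u i)) z)"
    by blast+
qed

lemma cong_trans: "a - b \<in> ord_ge n \<Longrightarrow> b - c \<in> ord_ge n \<Longrightarrow> a - c \<in> ord_ge n"
  using ord_ge_add[of "a - b" n "b - c"] by simp

lemma cong_sym: "a - b \<in> ord_ge n \<Longrightarrow> b - a \<in> ord_ge n"
  using ord_ge_uminus[of "a - b" n] by simp

context
  fixes I :: "'i set" and u :: "'i \<Rightarrow> 'x nc_series" and D :: nat
  assumes I: "finite I" and u: "\<And>i. i \<in> I \<Longrightarrow> u i \<in> ord_ge 1"
begin

text \<open>The Magnus expansion with \<open>u i\<close> substituted for the variables, cut off at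
  length \<open>D\<close>. As every \<open>u i\<close> has positive order, only terms of order at
  least \<open>D\<close> are affected.\<close>

definition expansion :: "('i list \<Rightarrow> int) \<Rightarrow> 'x nc_series" where
  "expansion k = (\<Sum>z\<in>{z. set z \<subseteq> I \<and> length z \<le> D}. of_int (k z) * prod_list (map u z))"

lemma expansion_add: "expansion (\<lambda>z. k z + k' z) = expansion k + expansion k'"
  by (simp add: expansion_def distrib_right sum.distrib)

lemma expansion_shift:
  assumes i: "i \<in> I"
  shows "expansion (\<lambda>z. case z of [] \<Rightarrow> 0 | j # z' \<Rightarrow> if j = i then k z' else 0) - u i * expansion k \<in> ord_ge D"
proof -
  let ?Z = "{z. set z \<subseteq> I \<and> length z \<le> D}" and ?Y = "{z. set z \<subseteq> I \<and> length z < D}"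
  let ?s = "\<lambda>z. case z of [] \<Rightarrow> 0 | j # z' \<Rightarrow> if j = i then k z' else 0"
  have fin: "finite ?Z" by (rule finite_lists_length_le[OF I])
  have finY: "finite ?Y" by (rule finite_subset[OF _ fin]) auto
  have "expansion ?s = (\<Sum>z\<in>(#) i ` ?Y. of_int (?s z) * prod_list (map u z))"
    unfolding expansion_def
  proof (rule sum.mono_neutral_right[OF fin])
    show "(#) i ` ?Y \<subseteq> ?Z" using i by auto
    show "\<forall>z\<in>?Z - (#) i ` ?Y. of_int (?s z) * prod_list (map u z) = 0"
    proof
      fix z assume "z \<in> ?Z - (#) i ` ?Y"
      then have "?s z = 0" by (cases z) auto
      then show "of_int (?s z) * prod_list (map u z) = 0" by simp
    qed
  qed
  also have "\<dots> = (\<Sum>z\<in>?Y. of_int (k z) * (u i * prod_list (map u z)))"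
    by (subst sum.reindex) auto
  also have "\<dots> = u i * (\<Sum>z\<in>?Y. of_int (k z) * prod_list (map u z))"
    unfolding sum_distrib_left by (intro sum.cong refl) (metis mult.assoc mult_of_int_commute)
  \<comment> \<open>The truncation loses exactly the monomials whose tail has the full length
    \<open>D\<close>.\<close>
  finally have "expansion ?s - u i * expansion k = - (u i * (\<Sum>z\<in>?Z - ?Y. of_int (k z) * prod_list (map u z)))"
    unfolding expansion_def using sum.subset_diff[of ?Y ?Z "\<lambda>z. of_int (k z) * prod_list (map u z)"] fin
    by (simp add: algebra_simps subset_iff)
  also have "\<dots> \<in> ord_ge D"
  proof (intro ord_ge_uminus ord_ge_mult_left ord_ge_sum)
    fix z assume z: "z \<in> ?Z - ?Y"
    then have "prod_list (map u z) \<in> ord_ge (sum_list (map (\<lambda>_. 1) z))"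
      using u by (intro prod_list_ord_ge(1)) auto
    moreover have "sum_list (map (\<lambda>_. 1) z) = length z" by (induction z) auto
    moreover have "D \<le> length z" using z by auto
    ultimately show "prod_list (map u z) \<in> ord_ge D" using ord_ge_anti by metis
  qed
  finally show ?thesis .
qed

lemma word_eval_expansion:
  assumes G: "group G" and \<psi>: "approx_rep G c \<psi>" and D: "D \<le> c" "c \<ge> 1"
    and g: "\<And>i. i \<in> I \<Longrightarrow> g i \<in> carrier G" "\<And>i. i \<in> I \<Longrightarrow> u i = \<psi> (g i) - 1"
    and w: "w \<in> lists (I \<times> UNIV)"
  shows "\<psi> (word_eval G g w) - expansion (magnus_coeff w) \<in> ord_ge D"
proof -
  interpret group G by fact
  have \<psi>_mult: "\<psi> (x \<otimes>\<^bsub>G\<^esub> y) - \<psi> x * \<psi> y \<in> ord_ge D" if "x \<in> carrier G" "y \<in> carrier G" for x y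
    by (rule ord_ge_anti[OF approx_repD(1)[OF \<psi> that] D(1)])
  have "word_eval G g w \<in> carrier G \<and> \<psi> (word_eval G g w) - expansion (magnus_coeff w) \<in> ord_ge D"
    using w
  proof (induction w)
    case Nil
    have "(\<Sum>z\<in>{z. set z \<subseteq> I \<and> length z \<le> D}. of_int (magnus_coeff [] z) * prod_list (map u z)) =
        (\<Sum>z\<in>{[]}. of_int (magnus_coeff [] z) * prod_list (map u z))"
      by (rule sum.mono_neutral_right[OF finite_lists_length_le[OF I]]) auto
    then have e: "expansion (magnus_coeff []) = 1"
      by (simp add: expansion_def)
    have "\<psi> \<one>\<^bsub>G\<^esub> - 1 \<in> ord_ge c"
      using approx_repD(2)[OF \<psi>, of "\<one>\<^bsub>G\<^esub>" c] D lc_one by simp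
    then show ?case using ord_ge_anti[OF _ D(1)] by (simp only: word_eval_Nil e one_closed simp_thms)
  next
    case (Cons a w)
    obtain i b where a: "a = (i, b)" by fastforce
    have i: "i \<in> I" "g i \<in> carrier G" using Cons.hyps a g by auto
    let ?v = "word_eval G g w"
    have v: "?v \<in> carrier G" and IH: "\<psi> ?v - expansion (magnus_coeff w) \<in> ord_ge D" using Cons.IH by auto
    have \<psi>g: "\<psi> (g i) = 1 + u i" using g(2)[OF i(1)] by simp
    show ?case
    proof (cases b)
      case True
      have "magnus_coeff (a # w) = (\<lambda>z. magnus_coeff w z +
          (case z of [] \<Rightarrow> 0 | j # z' \<Rightarrow> if j = i then magnus_coeff w z' else 0))"
        by (rule ext) (simp add: a True split: list.split)
      then have "(1 + u i) * expansion (magnus_coeff w) - expansion (magnus_coeff (a # w)) \<in> ord_ge D"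
        using cong_sym[OF expansion_shift[OF i(1), of "magnus_coeff w"]]
        by (simp add: expansion_add algebra_simps)
      moreover have "(1 + u i) * \<psi> ?v - (1 + u i) * expansion (magnus_coeff w) \<in> ord_ge D"
        using ord_ge_mult_left[OF IH, of "1 + u i"] by (simp add: right_diff_distrib)
      ultimately show ?thesis
        using \<psi>_mult[OF i(2) v] i v True unfolding a \<psi>g by (auto intro: cong_trans)
    next
      case False
      let ?v' = "inv\<^bsub>G\<^esub> g i \<otimes>\<^bsub>G\<^esub> ?v"
      have v': "?v' \<in> carrier G" using i v by simp
      have gv': "g i \<otimes>\<^bsub>G\<^esub> ?v' = ?v" using i v by (simp add: inv_cancel_left)
      let ?E = "expansion (magnus_coeff (a # w))"
      \<comment> \<open>For an inverse letter the recursion is read backwards: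
        \<open>(1 + u i) * ?E\<close> is congruent to the expansion of \<open>w\<close>. The factor
        \<open>1 + u i\<close> is then cancelled, which avoids an explicit inverse series.\<close>
      have "magnus_coeff w = (\<lambda>z. magnus_coeff (a # w) z +
          (case z of [] \<Rightarrow> 0 | j # z' \<Rightarrow> if j = i then magnus_coeff (a # w) z' else 0))"
        by (rule ext) (simp add: a False split: list.split)
      then have "expansion (magnus_coeff w) = ?E +
          expansion (\<lambda>z. case z of [] \<Rightarrow> 0 | j # z' \<Rightarrow> if j = i then magnus_coeff (a # w) z' else 0)"
        using expansion_add by metis
      then have "expansion (magnus_coeff w) - (1 + u i) * ?E \<in> ord_ge D"
        using expansion_shift[OF i(1), of "magnus_coeff (a # w)"] by (simp add: algebra_simps)
      then have "\<psi> ?v - (1 + u i) * ?E \<in> ord_ge D" by (rule cong_trans[OF IH])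
      moreover have "(1 + u i) * \<psi> ?v' - \<psi> ?v \<in> ord_ge D"
        using cong_sym[OF \<psi>_mult[OF i(2) v']] unfolding gv' \<psi>g .
      ultimately have "(1 + u i) * \<psi> ?v' - (1 + u i) * ?E \<in> ord_ge D" by (rule cong_trans[rotated])
      then have "(1 + u i) * (\<psi> ?v' - ?E) \<in> ord_ge D" by (simp only: right_diff_distrib)
      then have "\<psi> ?v' - ?E \<in> ord_ge D" by (rule ord_ge_cancel[OF u[OF i(1)]])
      then show ?thesis using v' False by (simp add: a)
    qed
  qed
  then show ?thesis ..
qed

end

text \<open>Let \<open>d\<close> be the least weight of a nonempty monomial with nonzero Magnus
  coefficient; the syllable monomial shows that there is one. If the word evaluates to the identity,
  the part of degree \<open>d\<close> is a vanishing combination of products of leading parts,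
  against \<open>right_indep_words\<close>. Since \<open>d\<close> depends on \<open>w\<close>,
  approximations of unbounded precision are assumed.\<close>

theorem word_eval_neq_one:
  assumes G: "group G" and I: "finite I" and g: "\<And>i. i \<in> I \<Longrightarrow> g i \<in> carrier G"
    and m: "\<And>i. i \<in> I \<Longrightarrow> m i \<ge> (1::nat)"
    and approx: "\<And>N. \<exists>c\<ge>N. \<exists>\<psi>::'a \<Rightarrow> 'x nc_series. approx_rep G c \<psi> \<and>
      (\<forall>i\<in>I. \<psi> (g i) - 1 \<in> ord_ge (m i)) \<and> right_indep I (\<lambda>i. hpart (m i) (\<psi> (g i) - 1))"
    and w: "w \<in> lists (I \<times> UNIV)" "reduced_word w" "w \<noteq> []"
  shows "word_eval G g w \<noteq> \<one>\<^bsub>G\<^esub>"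
proof
  assume one: "word_eval G g w = \<one>\<^bsub>G\<^esub>"
  interpret group G by fact
  let ?W = "\<lambda>z. sum_list (map m z)"
  have len: "length z \<le> ?W z" if "set z \<subseteq> I" for z
    using that m by (induction z) force+
  define P where "P d \<longleftrightarrow> (\<exists>z. set z \<subseteq> I \<and> z \<noteq> [] \<and> magnus_coeff w z \<noteq> 0 \<and> ?W z = d)" for d
  have "P (?W (syllables w))"
    unfolding P_def using w magnus_coeff_syllables_neq_0[OF w(2,3)]
    by (intro exI[of _ "syllables w"]) (auto simp: in_lists_conv_set)
  then have P: "P (Least P)" by (rule LeastI)
  define d where "d = Least P"
  obtain z where z: "set z \<subseteq> I" "z \<noteq> []" "magnus_coeff w z \<noteq> 0" "?W z = d"
    using P unfolding d_def P_def by blast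
  \<comment> \<open>Degree \<open>d\<close> is visible modulo order \<open>Suc d\<close>, and
    monomials of weight \<open>d\<close> have length at most \<open>d\<close>, so the truncation
    keeps all of them.\<close>
  define D where "D = Suc d"
  have dpos: "d > 0" using len[OF z(1)] z(2,4) by (cases z) auto
  obtain c \<psi> where c: "c \<ge> D" and \<psi>: "approx_rep G c (\<psi> :: 'a \<Rightarrow> 'x nc_series)"
    and ord: "\<And>i. i \<in> I \<Longrightarrow> \<psi> (g i) - 1 \<in> ord_ge (m i)"
    and ri: "right_indep I (\<lambda>i. hpart (m i) (\<psi> (g i) - 1))"
    using approx[of D] by blast
  define u where "u i = \<psi> (g i) - 1" for i
  have u1: "u i \<in> ord_ge 1" if "i \<in> I" for i
    using ord_ge_anti[OF ord[OF that] m[OF that]] by (simp add: u_def)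
  let ?k = "magnus_coeff w"
  let ?Z = "{z. set z \<subseteq> I \<and> length z \<le> D}"
  have finZ: "finite ?Z" by (rule finite_lists_length_le[OF I])
  have c1: "c \<ge> 1" using c by (simp add: D_def)
  have "\<psi> \<one>\<^bsub>G\<^esub> - expansion I u D ?k \<in> ord_ge D"
    using word_eval_expansion[where u = u and g = g and I = I and D = D, OF I u1 G \<psi> c c1 g u_def w(1)]
    unfolding one .
  moreover have "\<psi> \<one>\<^bsub>G\<^esub> - 1 \<in> ord_ge c"
    using approx_repD(2)[OF \<psi>, of "\<one>\<^bsub>G\<^esub>" c] c lc_one by (simp add: D_def)
  then have "1 - \<psi> \<one>\<^bsub>G\<^esub> \<in> ord_ge D" using cong_sym ord_ge_anti c by blast
  ultimately have "1 - expansion I u D ?k \<in> ord_ge D" by (rule cong_trans[rotated])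
  then have "hpart d 1 - hpart d (expansion I u D ?k) = 0" using hpart_cong[of 1 "expansion I u D ?k" d] by (simp add: D_def)
  moreover have "hpart d 1 = (0 :: 'x nc_series)"
    using dpos by (intro nc_series_eqI) (auto simp: coeff_hpart coeff_1)
  ultimately have "hpart d (expansion I u D ?k) = 0" by simp
  moreover have "hpart d (expansion I u D ?k) = (\<Sum>z\<in>?Z. of_int (?k z) * hpart d (prod_list (map u z)))"
    by (simp add: expansion_def[OF I u1] hpart_sum)
  \<comment> \<open>Weight below \<open>d\<close>: the coefficient is 0, except for the empty
    monomial, whose value 1 has no part of degree \<open>d\<close>. Weight above \<open>d\<close>:
    the order is too large. In weight \<open>d\<close> only the leading parts of the factors
    count.\<close>
  moreover have "\<dots> = (\<Sum>z\<in>{z \<in> lists I. ?W z = d}. of_int (?k z) * prod_list (map (\<lambda>i. hpart (m i) (u i)) z))"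
  proof (rule sum.mono_neutral_cong_right[OF finZ])
    show "{z \<in> lists I. ?W z = d} \<subseteq> ?Z" using len by (force simp: in_lists_conv_set D_def)
    show "\<forall>z\<in>?Z - {z \<in> lists I. ?W z = d}. of_int (?k z) * hpart d (prod_list (map u z)) = 0"
    proof
      fix z assume "z \<in> ?Z - {z \<in> lists I. ?W z = d}"
      then have z: "set z \<subseteq> I" "?W z \<noteq> d" by auto
      show "of_int (?k z) * hpart d (prod_list (map u z)) = 0"
      proof (cases "?W z < d")
        case True
        show ?thesis
        proof (cases "z = []")
          case True
          have "hpart d 1 = (0 :: 'x nc_series)"
            using dpos by (intro nc_series_eqI) (auto simp: coeff_hpart coeff_1)
          then show ?thesis using True by simp
        next
          case False
          have "\<not> P (?W z)" using True not_less_Least unfolding d_def by blast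
          then have "?k z = 0" using z False unfolding P_def by blast
          then show ?thesis by simp
        qed
      next
        case False
        have "prod_list (map u z) \<in> ord_ge (?W z)"
          using z ord by (intro prod_list_ord_ge(1)) (auto simp: u_def)
        then have "prod_list (map u z) \<in> ord_ge (Suc d)" using False z(2) by (elim ord_ge_anti) simp
        then show ?thesis by (simp add: hpart_eq_0)
      qed
    qed
    fix z assume z: "z \<in> {z \<in> lists I. ?W z = d}"
    then have "hpart (?W z) (prod_list (map u z)) = prod_list (map (\<lambda>i. hpart (m i) (u i)) z)"
      using ord by (intro prod_list_ord_ge(2)) (auto simp: u_def in_lists_conv_set)
    then show "of_int (?k z) * hpart d (prod_list (map u z)) =
        of_int (?k z) * prod_list (map (\<lambda>i. hpart (m i) (u i)) z)" using z by simp
  qed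
  ultimately have "(\<Sum>z\<in>{z \<in> lists I. ?W z = d}. of_int (?k z) * prod_list (map (\<lambda>i. hpart (m i) (u i)) z)) = 0"
    by simp
  then have "?k z = 0"
    using right_indep_words[where k = ?k and z = z and d = d and m = m, OF I m ri[folded u_def]] z
    by (auto simp: in_lists_conv_set)
  then show False using z(3) by simp
qed

lemma free_group_hom_word_eval:
  assumes G: "group G" and h: "h \<in> hom (free_group I) G" and g: "\<And>i. i \<in> I \<Longrightarrow> h [(i, True)] = g i"
    and w: "w \<in> carrier (free_group I)"
  shows "h w = word_eval G g w"
proof -
  interpret F: group "free_group I" by (rule group_free_group)
  interpret group G by fact
  interpret group_hom "free_group I" G h by unfold_locales (rule h)
  have "w \<in> lists (I \<times> UNIV)" "reduced_word w" using w by (auto simp: free_group_def)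
  then show ?thesis
  proof (induction w)
    case Nil
    have "h \<one>\<^bsub>free_group I\<^esub> = \<one>\<^bsub>G\<^esub>" by (rule hom_one)
    then show ?case by (simp add: free_group_def)
  next
    case (Cons a w)
    obtain i b where a: "a = (i, b)" by fastforce
    then have i: "i \<in> I" using Cons.hyps by auto
    have c: "[(i, b)] \<in> carrier (free_group I)" for b using i by (simp add: free_group_def)
    have wc: "w \<in> carrier (free_group I)" using Cons.hyps Cons.prems by (auto simp: free_group_def dest: reduced_tl)
    have "[(i, False)] \<otimes>\<^bsub>free_group I\<^esub> [(i, True)] = \<one>\<^bsub>free_group I\<^esub>"
      by (simp add: free_group_def reduce_word_def inv_letter_def)
    then have "[(i, False)] = inv\<^bsub>free_group I\<^esub> [(i, True)]" using F.inv_equality[OF _ c c] by metis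
    then have "h [(i, False)] = inv\<^bsub>G\<^esub> g i" using g[OF i] c by simp
    then have "h [a] = (if b then g i else inv\<^bsub>G\<^esub> g i)" using g[OF i] a by simp
    moreover have "a # w = [a] \<otimes>\<^bsub>free_group I\<^esub> w" using Cons.prems by (simp add: free_group_def reduce_eq)
    then have "h (a # w) = h [a] \<otimes>\<^bsub>G\<^esub> h w" using hom_mult[OF c[of b] wc] a by (simp only:)
    moreover have "h w = word_eval G g w" using Cons.IH Cons.prems by (auto dest: reduced_tl)
    ultimately show ?case by (simp add: a)
  qed
qed

theorem free_group_embedding:
  assumes G: "group G" and g: "\<And>i. i \<in> I \<Longrightarrow> g i \<in> carrier G"
    and free: "\<And>w. w \<in> lists (I \<times> UNIV) \<Longrightarrow> reduced_word w \<Longrightarrow> w \<noteq> [] \<Longrightarrow> word_eval G g w \<noteq> \<one>\<^bsub>G\<^esub>"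
  shows "\<exists>h\<in>hom (free_group I) G. inj_on h (carrier (free_group I)) \<and> (\<forall>i\<in>I. h [(i, True)] = g i)"
proof -
  interpret group G by fact
  have "g \<in> I \<rightarrow> carrier G" using g by blast
  from free_group_universal[OF G this]
  obtain h where h: "h \<in> hom (free_group I) G" "\<forall>i\<in>I. h [(i, True)] = g i"
    by (elim bexE conjE) (rule that)
  interpret F: group "free_group I" by (rule group_free_group)
  interpret h: group_hom "free_group I" G h by unfold_locales (rule h(1))
  have "w = \<one>\<^bsub>free_group I\<^esub>" if w: "w \<in> carrier (free_group I)" "h w = \<one>\<^bsub>G\<^esub>" for w
  proof (rule ccontr)
    assume "w \<noteq> \<one>\<^bsub>free_group I\<^esub>"
    then have "word_eval G g w \<noteq> \<one>\<^bsub>G\<^esub>" using w by (intro free) (auto simp: free_group_def)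
    moreover have "h w = word_eval G g w" by (rule free_group_hom_word_eval[OF G h(1) _ w(1)]) (use h(2) in blast)
    ultimately show False using w(2) by simp
  qed
  then have "inj_on h (carrier (free_group I))" unfolding h.inj_on_one_iff by blast
  then show ?thesis using h by (intro bexI[of _ h] conjI)
qed

section \<open>Powers' averaging argument\<close>

lemma ell2_coord_le:
  assumes "\<xi> \<in> ell2 A" shows "cmod (\<xi> x) \<le> ell2_norm A \<xi>"
proof (cases "x \<in> A")
  case True
  then show ?thesis using ell2_normD[OF assms, of "{x}"] by (simp add: L2_set_def)
next
  case False
  then show ?thesis using assms ell2_norm_nonneg by (simp add: ell2_def)
qed

lemma ell2_diff:
  assumes "\<xi> \<in> ell2 A" "\<eta> \<in> ell2 A"
  shows "(\<lambda>x. \<xi> x - \<eta> x) \<in> ell2 A" "ell2_norm A (\<lambda>x. \<xi> x - \<eta> x) \<le> ell2_norm A \<xi> + ell2_norm A \<eta>"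
  using ell2_add[OF assms(1) ell2_scale(1)[OF assms(2), of "-1"]] ell2_scale(2)[OF assms(2), of "-1"] by simp_all

lemma ell2_sum:
  assumes "\<And>j. j \<in> J \<Longrightarrow> f j \<in> ell2 A"
  shows "(\<lambda>x. \<Sum>j\<in>J. f j x) \<in> ell2 A \<and> ell2_norm A (\<lambda>x. \<Sum>j\<in>J. f j x) \<le> (\<Sum>j\<in>J. ell2_norm A (f j))"
  using assms
proof (induction J rule: infinite_finite_induct)
  case (insert j J)
  then have IH: "(\<lambda>x. \<Sum>j\<in>J. f j x) \<in> ell2 A" "ell2_norm A (\<lambda>x. \<Sum>j\<in>J. f j x) \<le> (\<Sum>j\<in>J. ell2_norm A (f j))"
    and j: "f j \<in> ell2 A" by auto
  show ?case using ell2_add[OF j IH(1)] IH(2) insert.hyps by simp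
qed (simp_all add: ell2_zero)

definition delta :: "'a \<Rightarrow> 'a \<Rightarrow> complex" where
  "delta g = (\<lambda>x. if x = g then 1 else 0)"

lemma delta_ell2:
  assumes "g \<in> A" shows "delta g \<in> ell2 A" "ell2_norm A (delta g) \<le> 1"
proof -
  have b: "L2_set (\<lambda>x. cmod (delta g x)) F \<le> 1" if "finite F" "F \<subseteq> A" for F
  proof -
    have "(\<Sum>x\<in>F. (cmod (delta g x))\<^sup>2) = (\<Sum>x\<in>F. if x = g then 1 else 0)"
      by (intro sum.cong) (auto simp: delta_def)
    also have "\<dots> \<le> 1" using that by (simp add: sum.delta)
    finally show ?thesis by (simp add: L2_set_def)
  qed
  have z: "delta g x = 0" if "x \<notin> A" for x using that assms by (auto simp: delta_def)
  show "delta g \<in> ell2 A" "ell2_norm A (delta g) \<le> 1" by (rule ell2_normI[OF z b]; assumption)+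
qed

lemma ell2_finite_approx:
  assumes \<xi>: "\<xi> \<in> ell2 A" and \<epsilon>: "\<epsilon> > 0"
  obtains F where "finite F" "F \<subseteq> A"
    "(\<lambda>x. if x \<in> F then 0 else \<xi> x) \<in> ell2 A" "ell2_norm A (\<lambda>x. if x \<in> F then 0 else \<xi> x) \<le> \<epsilon>"
proof -
  let ?f = "\<lambda>x. (cmod (\<xi> x))\<^sup>2"
  have s: "?f summable_on A" using \<xi> by (simp add: ell2_def)
  then have "(sum ?f \<longlongrightarrow> infsum ?f A) (finite_subsets_at_top A)"
    using has_sum_infsum by (simp add: has_sum_def)
  then have "\<forall>\<^sub>F F in finite_subsets_at_top A. dist (sum ?f F) (infsum ?f A) < \<epsilon>\<^sup>2"
    by (rule tendstoD) (use \<epsilon> in simp)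
  then obtain F where F: "finite F" "F \<subseteq> A" "dist (sum ?f F) (infsum ?f A) < \<epsilon>\<^sup>2"
    unfolding eventually_finite_subsets_at_top by blast
  let ?\<eta> = "\<lambda>x. if x \<in> F then 0 else \<xi> x"
  have b: "L2_set (\<lambda>x. cmod (?\<eta> x)) E \<le> \<epsilon>" if "finite E" "E \<subseteq> A" for E
  proof -
    have "(\<Sum>x\<in>E. (cmod (?\<eta> x))\<^sup>2) = (\<Sum>x\<in>E - F. ?f x)"
      using that by (intro sum.mono_neutral_cong_right) auto
    also have "\<dots> = (\<Sum>x\<in>F \<union> (E - F). ?f x) - sum ?f F"
      using that F by (subst sum.union_disjoint) auto
    also have "(\<Sum>x\<in>F \<union> (E - F). ?f x) \<le> infsum ?f A"
      using that F s by (intro finite_sum_le_infsum) auto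
    finally have "(\<Sum>x\<in>E. (cmod (?\<eta> x))\<^sup>2) \<le> \<epsilon>\<^sup>2" using F(3) by (simp add: dist_real_def)
    then show ?thesis unfolding L2_set_def using \<epsilon> by (intro real_le_lsqrt) (auto intro: sum_nonneg)
  qed
  have z: "?\<eta> x = 0" if "x \<notin> A" for x using that \<xi> by (simp add: ell2_def)
  show ?thesis
    by (rule that[OF F(1,2)]; rule ell2_normI[OF z b]; assumption)
qed

lemma bounded_operators_sum:
  assumes T: "T \<in> bounded_operators A" and "finite F" "\<And>g. g \<in> F \<Longrightarrow> \<xi> g \<in> ell2 A"
  shows "T (\<lambda>x. \<Sum>g\<in>F. c g * \<xi> g x) = (\<lambda>x. \<Sum>g\<in>F. c g * T (\<xi> g) x)"
  using assms(2,3)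
proof (induction F)
  case empty
  then show ?case using bounded_operators_zero_arg[OF T] by simp
next
  case (insert g F)
  have "(\<lambda>x. \<Sum>g\<in>F. c g * \<xi> g x) \<in> ell2 A"
    using ell2_sum[of F "\<lambda>g x. c g * \<xi> g x"] insert.prems ell2_scale(1) by blast
  have g: "\<xi> g \<in> ell2 A" using insert.prems by simp
  have "T (\<lambda>x. c g * \<xi> g x + (\<Sum>g\<in>F. c g * \<xi> g x)) =
      (\<lambda>x. T (\<lambda>x. c g * \<xi> g x) x + T (\<lambda>x. \<Sum>g\<in>F. c g * \<xi> g x) x)"
    by (rule bounded_operatorsD(3)[OF T ell2_scale(1)[OF g]]) fact
  then show ?case
    using insert bounded_operatorsD(4)[OF T g, of "c g"] by simp
qed

lemma bounded_operators_eqI_delta: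
  assumes T: "T \<in> bounded_operators A" and z: "\<And>g x. g \<in> A \<Longrightarrow> T (delta g) x = 0"
  shows "T = (\<lambda>\<xi> x. 0)"
proof (intro ext, rule ccontr)
  fix \<xi> x assume n: "T \<xi> x \<noteq> 0"
  then have \<xi>: "\<xi> \<in> ell2 A" using bounded_operatorsD(1)[OF T] by fastforce
  obtain K where K: "K \<ge> 0" "\<And>\<xi>. \<xi> \<in> ell2 A \<Longrightarrow> ell2_norm A (T \<xi>) \<le> K * ell2_norm A \<xi>"
    using bounded_operators_bound[OF T] by blast
  \<comment> \<open>Chosen so that \<open>K * \<epsilon>\<close> is smaller than the nonzero value;
    \<open>K + 1\<close> excludes a zero denominator.\<close>
  define \<epsilon> where "\<epsilon> = cmod (T \<xi> x) / (2 * (K + 1))"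
  have \<epsilon>: "\<epsilon> > 0" using n K(1) by (simp add: \<epsilon>_def)
  obtain F where F: "finite F" "F \<subseteq> A" "(\<lambda>x. if x \<in> F then 0 else \<xi> x) \<in> ell2 A"
    "ell2_norm A (\<lambda>x. if x \<in> F then 0 else \<xi> x) \<le> \<epsilon>"
    by (rule ell2_finite_approx[OF \<xi> \<epsilon>]) (rule that)
  let ?\<eta> = "\<lambda>x. if x \<in> F then 0 else \<xi> x" and ?\<zeta> = "\<lambda>x. \<Sum>g\<in>F. \<xi> g * delta g x"
  have \<zeta>: "?\<zeta> \<in> ell2 A"
    by (rule ell2_sum[THEN conjunct1], rule ell2_scale(1), rule delta_ell2(1)) (use F(2) in blast)
  have "\<xi> = (\<lambda>x. ?\<eta> x + ?\<zeta> x)"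
    using F(1) by (intro ext) (auto simp: delta_def if_distrib[of "\<lambda>c. _ * c"] cong: if_cong)
  then have "T \<xi> = T (\<lambda>x. ?\<eta> x + ?\<zeta> x)" by (rule arg_cong)
  also have "\<dots> = (\<lambda>x. T ?\<eta> x + T ?\<zeta> x)" by (rule bounded_operatorsD(3)[OF T F(3) \<zeta>])
  also have "T ?\<zeta> = (\<lambda>x. \<Sum>g\<in>F. \<xi> g * T (delta g) x)"
    by (rule bounded_operators_sum[OF T F(1)], rule delta_ell2(1)) (use F(2) in blast)
  finally have "T \<xi> x = T ?\<eta> x" using F(2) z by (simp add: subset_iff)
  then have "cmod (T \<xi> x) \<le> ell2_norm A (T ?\<eta>)"
    using ell2_coord_le[OF bounded_operatorsD(2)[OF T F(3)]] by simp
  also have "\<dots> \<le> K * \<epsilon>" using K(2)[OF F(3)] mult_left_mono[OF F(4) K(1)] by linarith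
  also have "\<dots> < cmod (T \<xi> x)" using n K(1) by (auto simp: \<epsilon>_def field_simps intro!: add_nonneg_pos)
  finally show False by simp
qed

lemma sum_at_most_one:
  fixes a :: "'j \<Rightarrow> complex"
  assumes "finite J" "\<And>i j. i \<in> J \<Longrightarrow> j \<in> J \<Longrightarrow> a i \<noteq> 0 \<Longrightarrow> a j \<noteq> 0 \<Longrightarrow> i = j"
  shows "(cmod (\<Sum>j\<in>J. a j))\<^sup>2 = (\<Sum>j\<in>J. (cmod (a j))\<^sup>2)"
proof (cases "\<exists>i\<in>J. a i \<noteq> 0")
  case True
  then obtain i where i: "i \<in> J" "a i \<noteq> 0" by blast
  have "(\<Sum>j\<in>J. a j) = (\<Sum>j\<in>{i}. a j)"
    using assms i by (intro sum.mono_neutral_right) auto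
  moreover have "(\<Sum>j\<in>J. (cmod (a j))\<^sup>2) = (\<Sum>j\<in>{i}. (cmod (a j))\<^sup>2)"
    using assms i by (intro sum.mono_neutral_right) auto
  ultimately show ?thesis by simp
qed (auto intro!: sum.neutral)

section \<open>The norm of a sum of conjugate translations\<close>

context group
begin

text \<open>The element \<open>h j = y j \<otimes> x \<otimes> inv (y j)\<close> maps the complement
  of the translate \<open>y j <# D\<close> into that translate, and the translates are disjoint.
  Splitting each translated vector at its own translate, one half has disjoint supports
  (\<open>f1\<close>), while the other comes from the restrictions of \<xi> to disjoint sets
  (\<open>f2\<close>). Each half contributes \<open>sqrt N\<close>.\<close>

lemma powers_bound:
  fixes N :: nat
  assumes x: "x \<in> carrier G" and y: "\<And>j. y j \<in> carrier G" and D: "D \<subseteq> carrier G"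
    and xD: "\<And>z. z \<in> carrier G - D \<Longrightarrow> x \<otimes> z \<in> D"
    and disj: "\<And>i j. i \<noteq> j \<Longrightarrow> (y i <# D) \<inter> (y j <# D) = {}"
    and \<xi>: "\<xi> \<in> ell2 (carrier G)"
  shows "ell2_norm (carrier G) (\<lambda>z. \<Sum>j<N. left_translate G (y j \<otimes> x \<otimes> inv (y j)) \<xi> z)
    \<le> 2 * sqrt N * ell2_norm (carrier G) \<xi>"
proof -
  let ?n = "ell2_norm (carrier G) \<xi>"
  define h where "h j = y j \<otimes> x \<otimes> inv (y j)" for j
  have h: "h j \<in> carrier G" for j using x y by (simp add: h_def)
  have inj: "inj_on (\<lambda>z. inv (h j) \<otimes> z) E" if "E \<subseteq> carrier G" for j E
    using that h by (intro inj_onI) (metis inv_closed l_cancel subsetD)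
  define f1 where "f1 j z = (if z \<in> y j <# D then \<xi> (inv (h j) \<otimes> z) else 0)" for j z
  define f2 where "f2 j z = (if z \<in> y j <# D then 0 else \<xi> (inv (h j) \<otimes> z))" for j z
  \<comment> \<open>The contrapositive of \<open>xD\<close>, conjugated by
    \<open>y j\<close>.\<close>
  have move: "inv (h j) \<otimes> z \<in> y j <# D" if z: "z \<in> carrier G" "z \<notin> y j <# D" for j z
  proof -
    let ?v = "inv x \<otimes> (inv (y j) \<otimes> z)"
    have v: "?v \<in> carrier G" "x \<otimes> ?v = inv (y j) \<otimes> z"
      using x y z by (simp_all add: m_assoc[symmetric])
    have "inv (y j) \<otimes> z \<notin> D"
    proof
      assume "inv (y j) \<otimes> z \<in> D"
      then have "y j \<otimes> (inv (y j) \<otimes> z) \<in> y j <# D" by (auto simp: l_coset_def)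
      then show False using z y by (simp add: m_assoc[symmetric])
    qed
    then have "?v \<in> D" using xD[of ?v] v by auto
    moreover have "inv (h j) \<otimes> z = y j \<otimes> ?v"
      using x y z by (simp add: h_def inv_mult_group m_assoc)
    ultimately show ?thesis by (auto simp: l_coset_def)
  qed
  have "L2_set (\<lambda>z. cmod (\<Sum>j<N. left_translate G (h j) \<xi> z)) F \<le> 2 * sqrt N * ?n"
    if F: "finite F" "F \<subseteq> carrier G" for F
  proof -
    have eq: "(\<Sum>j<N. left_translate G (h j) \<xi> z) = (\<Sum>j<N. f1 j z) + (\<Sum>j<N. f2 j z)" if "z \<in> F" for z
      unfolding sum.distrib[symmetric] using that F
      by (intro sum.cong) (auto simp: f1_def f2_def left_translate_def)
    have "L2_set (\<lambda>z. cmod (\<Sum>j<N. left_translate G (h j) \<xi> z)) F =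
        L2_set (\<lambda>z. cmod ((\<Sum>j<N. f1 j z) + (\<Sum>j<N. f2 j z))) F"
      by (rule L2_set_cong) (simp_all add: eq)
    also have "\<dots> \<le> L2_set (\<lambda>z. cmod (\<Sum>j<N. f1 j z) + (\<Sum>j<N. cmod (f2 j z))) F"
      by (intro L2_set_mono order_trans[OF norm_triangle_ineq] add_left_mono norm_sum) auto
    also have "\<dots> \<le> L2_set (\<lambda>z. cmod (\<Sum>j<N. f1 j z)) F + L2_set (\<lambda>z. \<Sum>j<N. cmod (f2 j z)) F"
      by (rule L2_set_triangle_ineq)
    \<comment> \<open>Disjoint supports make the summands orthogonal, so the squared norms add
      up.\<close>
    also have "L2_set (\<lambda>z. cmod (\<Sum>j<N. f1 j z)) F \<le> sqrt N * ?n"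
    proof -
      have "(\<Sum>z\<in>F. (cmod (\<Sum>j<N. f1 j z))\<^sup>2) = (\<Sum>z\<in>F. \<Sum>j<N. (cmod (f1 j z))\<^sup>2)"
      proof (intro sum.cong refl sum_at_most_one)
        fix z i j assume "f1 i z \<noteq> 0" "f1 j z \<noteq> 0"
        then have "z \<in> (y i <# D) \<inter> (y j <# D)" by (auto simp: f1_def split: if_splits)
        then show "i = j" using disj by blast
      qed simp
      also have "\<dots> = (\<Sum>j<N. \<Sum>z\<in>F. (cmod (f1 j z))\<^sup>2)" by (rule sum.swap)
      also have "\<dots> \<le> (\<Sum>j<N. ?n\<^sup>2)"
      proof (rule sum_mono)
        fix j
        have "(\<Sum>z\<in>F. (cmod (f1 j z))\<^sup>2) \<le> (\<Sum>z\<in>F. (cmod (\<xi> (inv (h j) \<otimes> z)))\<^sup>2)"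
          by (intro sum_mono) (simp add: f1_def)
        also have "\<dots> = (\<Sum>z\<in>(\<lambda>z. inv (h j) \<otimes> z) ` F. (cmod (\<xi> z))\<^sup>2)"
          by (simp add: sum.reindex[OF inj[OF F(2)]])
        also have "\<dots> = (L2_set (\<lambda>z. cmod (\<xi> z)) ((\<lambda>z. inv (h j) \<otimes> z) ` F))\<^sup>2"
          by (simp add: L2_set_def sum_nonneg)
        also have "\<dots> \<le> ?n\<^sup>2"
          using F h by (intro power_mono ell2_normD[OF \<xi>]) auto
        finally show "(\<Sum>z\<in>F. (cmod (f1 j z))\<^sup>2) \<le> ?n\<^sup>2" .
      qed
      also have "\<dots> = (sqrt N * ?n)\<^sup>2" by (simp add: power_mult_distrib)
      finally show ?thesis
        unfolding L2_set_def by (intro real_le_lsqrt) (auto simp: ell2_norm_nonneg sum_nonneg)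
    qed
    \<comment> \<open>The summands may overlap, but their norms are those of \<xi> on the disjoint
      sets \<open>W j\<close>; Cauchy-Schwarz bounds the sum of these norms.\<close>
    also have "L2_set (\<lambda>z. \<Sum>j<N. cmod (f2 j z)) F \<le> sqrt N * ?n"
    proof -
      define W where "W j = (\<lambda>z. inv (h j) \<otimes> z) ` (F - (y j <# D))" for j
      define s where "s j = (\<Sum>w\<in>W j. (cmod (\<xi> w))\<^sup>2)" for j
      have W: "finite (W j)" "W j \<subseteq> y j <# D" "W j \<subseteq> carrier G" for j
        using F h move by (auto simp: W_def)
      have s0: "s j \<ge> 0" for j by (simp add: s_def sum_nonneg)
      have f2s: "L2_set (\<lambda>z. cmod (f2 j z)) F = sqrt (s j)" for j
      proof -
        have "(\<Sum>z\<in>F. (cmod (f2 j z))\<^sup>2) = (\<Sum>z\<in>F - (y j <# D). (cmod (\<xi> (inv (h j) \<otimes> z)))\<^sup>2)"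
          using F by (intro sum.mono_neutral_cong_right) (auto simp: f2_def)
        also have "\<dots> = s j"
          unfolding s_def W_def using F by (subst sum.reindex[OF inj]) auto
        finally show ?thesis by (simp add: L2_set_def)
      qed
      have "L2_set (\<lambda>z. \<Sum>j<n. cmod (f2 j z)) F \<le> (\<Sum>j<n. L2_set (\<lambda>z. cmod (f2 j z)) F)" for n
      proof (induction n)
        case (Suc n)
        then show ?case
          using L2_set_triangle_ineq[of "\<lambda>z. \<Sum>j<n. cmod (f2 j z)" "\<lambda>z. cmod (f2 n z)" F] by simp
      qed (simp add: L2_set_def)
      then have "L2_set (\<lambda>z. \<Sum>j<N. cmod (f2 j z)) F \<le> (\<Sum>j<N. \<bar>1\<bar> * \<bar>sqrt (s j)\<bar>)"
        using f2s s0 by simp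
      also have "\<dots> \<le> L2_set (\<lambda>j. 1) {..<N} * L2_set (\<lambda>j. sqrt (s j)) {..<N}"
        by (rule L2_set_mult_ineq)
      also have "L2_set (\<lambda>j. 1) {..<N} = sqrt N" by (simp add: L2_set_def)
      also have "L2_set (\<lambda>j. sqrt (s j)) {..<N} \<le> ?n"
      proof -
        have "(\<Sum>j<N. s j) = (\<Sum>w\<in>(\<Union>j<N. W j). (cmod (\<xi> w))\<^sup>2)"
          unfolding s_def using W disj by (subst sum.UNION_disjoint) blast+
        then have "L2_set (\<lambda>j. sqrt (s j)) {..<N} = L2_set (\<lambda>w. cmod (\<xi> w)) (\<Union>j<N. W j)"
          using s0 by (simp add: L2_set_def)
        also have "\<dots> \<le> ?n"
          by (rule ell2_normD[OF \<xi>]) (simp add: W(1), rule UN_least, rule W(3))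
        finally show ?thesis .
      qed
      finally show ?thesis by (simp add: mult_left_mono)
    qed
    finally show ?thesis by simp
  qed
  then show ?thesis
    unfolding h_def[symmetric] by (intro ell2_normI(2)) (auto simp: left_translate_def)
qed

section \<open>Neumann series in the reduced algebra\<close>

abbreviation cstar where "cstar \<equiv> reduced_cstar_algebra G"

lemma cstar_one: "(\<lambda>\<xi>. if \<xi> \<in> ell2 (carrier G) then \<xi> else (\<lambda>_. 0)) \<in> carrier cstar"
  using left_regular_in_reduced_cstar[OF is_group group_algebra_single[OF is_group one_closed, of 1]]
  by (simp add: left_regular_one[OF is_group])

lemma cstar_zero: "(\<lambda>\<xi> x. 0) \<in> carrier cstar"
  using ring.ring_simprules(2)[OF ring_reduced_cstar_algebra[OF is_group]]
  by (simp add: reduced_cstar_algebra_def)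

text \<open>The powers of \<open>R\<close> are summed coordinatewise, and geometric bounds turn
  pointwise convergence into norm estimates. The partial sums \<open>P k\<close> lie in the algebra
  and converge to \<open>S\<close> in operator norm, so \<open>S\<close> lies in it as well. A left
  inverse of \<open>1 - R\<close> is enough to bring 1 into an ideal that contains
  \<open>1 - R\<close>.\<close>

lemma neumann_inverse:
  assumes R: "R \<in> carrier cstar"
    and half: "\<And>\<xi>. \<xi> \<in> ell2 (carrier G) \<Longrightarrow> ell2_norm (carrier G) (R \<xi>) \<le> ell2_norm (carrier G) \<xi> / 2"
  shows "\<exists>S\<in>carrier cstar. \<forall>\<xi>\<in>ell2 (carrier G). S (\<lambda>x. \<xi> x - R \<xi> x) = \<xi>"
proof -
  let ?A = "carrier G"
  let ?n = "ell2_norm ?A"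
  note R' = reduced_cstar_carrierD(1)[OF is_group R]
  note D = bounded_operatorsD[OF R']
  \<comment> \<open>The 0-th iterate is the identity on all functions; the case distinction restores
    the convention that operators vanish outside \<open>ell2\<close>.\<close>
  define Q where "Q n \<xi> = (if \<xi> \<in> ell2 ?A then (R ^^ n) \<xi> else (\<lambda>_. 0))" for n \<xi>
  have pow: "(R ^^ n) \<xi> \<in> ell2 ?A \<and> ?n ((R ^^ n) \<xi>) \<le> ?n \<xi> / 2 ^ n" if "\<xi> \<in> ell2 ?A" for n \<xi>
  proof (induction n)
    case (Suc n)
    have "?n (R ((R ^^ n) \<xi>)) \<le> ?n ((R ^^ n) \<xi>) / 2" using half Suc by blast
    also have "\<dots> \<le> ?n \<xi> / 2 ^ n / 2" using Suc by (intro divide_right_mono) auto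
    also have "\<dots> = ?n \<xi> / 2 ^ Suc n" by simp
    finally have "?n (R ((R ^^ n) \<xi>)) \<le> ?n \<xi> / 2 ^ Suc n" .
    then show ?case using D(2) Suc by simp
  qed (use that in simp)
  have Q_Suc: "Q (Suc n) = (\<lambda>\<xi>. R (Q n \<xi>))" for n
    by (rule ext) (simp add: Q_def bounded_operators_zero_arg[OF R'])
  have Q: "Q n \<in> carrier cstar" for n
  proof (induction n)
    case 0
    then show ?case using cstar_one by (simp add: Q_def[abs_def] cong: if_cong)
  next
    case (Suc n)
    then show ?case unfolding Q_Suc by (rule reduced_cstar_comp[OF is_group R])
  qed
  note QD = bounded_operatorsD[OF reduced_cstar_carrierD(1)[OF is_group Q]]
  have Q_norm: "?n (Q n \<xi>) \<le> ?n \<xi> / 2 ^ n" if "\<xi> \<in> ell2 ?A" for n \<xi>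
    using pow[OF that] that by (simp add: Q_def)
  have Q_coord: "cmod (Q n \<xi> x) \<le> ?n \<xi> * (1 / 2) ^ n" if "\<xi> \<in> ell2 ?A" for n \<xi> x
    using order_trans[OF ell2_coord_le[OF QD(2)[OF that]] Q_norm[OF that]] by (simp add: power_divide)
  have summ: "summable (\<lambda>n. Q n \<xi> x)" for \<xi> x
  proof (cases "\<xi> \<in> ell2 ?A")
    case True
    show ?thesis
      by (rule summable_comparison_test'[OF summable_mult[OF summable_geometric] Q_coord[OF True]]) simp
  qed (simp add: Q_def)
  define S where "S \<xi> x = suminf (\<lambda>n. Q n \<xi> x)" for \<xi> x
  define P where "P k = (\<lambda>\<xi> x. \<Sum>n<k. Q n \<xi> x)" for k
  have P: "P k \<in> carrier cstar" for k
  proof (induction k)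
    case 0
    then show ?case using cstar_zero by (simp add: P_def)
  next
    case (Suc k)
    then show ?case using reduced_cstar_add[OF is_group Suc Q[of k]] by (simp add: P_def)
  qed
  have S_ell2: "S \<xi> \<in> ell2 ?A \<and> ?n (S \<xi>) \<le> 2 * ?n \<xi>" if \<xi>: "\<xi> \<in> ell2 ?A" for \<xi>
  proof -
    have b: "L2_set (\<lambda>x. cmod (S \<xi> x)) F \<le> 2 * ?n \<xi>" if F: "finite F" "F \<subseteq> ?A" for F
    proof -
      have "(\<lambda>k. L2_set (\<lambda>x. cmod (P k \<xi> x)) F) \<longlonglongrightarrow> L2_set (\<lambda>x. cmod (S \<xi> x)) F"
        unfolding L2_set_def P_def S_def by (intro tendsto_intros summable_LIMSEQ summ)
      moreover have "L2_set (\<lambda>x. cmod (P k \<xi> x)) F \<le> 2 * ?n \<xi>" for k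
      proof -
        have "P k \<xi> \<in> ell2 ?A" "?n (P k \<xi>) \<le> (\<Sum>n<k. ?n (Q n \<xi>))"
          unfolding P_def using ell2_sum[of "{..<k}" "\<lambda>n. Q n \<xi>"] QD(2)[OF \<xi>] by auto
        moreover have "(\<Sum>n<k. ?n (Q n \<xi>)) \<le> (\<Sum>n<k. ?n \<xi> * (1 / 2) ^ n)"
          using Q_norm[OF \<xi>] by (intro sum_mono) (simp add: power_divide)
        moreover have "(\<Sum>n<k. ?n \<xi> * (1 / 2) ^ n) \<le> 2 * ?n \<xi>"
        proof -
          have "(\<Sum>n<k. (1 / 2 :: real) ^ n) = 2 - 2 * (1 / 2) ^ k"
            by (induction k) simp_all
          then have "(\<Sum>n<k. (1 / 2 :: real) ^ n) \<le> 2" by simp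
          then show ?thesis
            using mult_left_mono[OF _ ell2_norm_nonneg[of ?A \<xi>]] by (fastforce simp: sum_distrib_left[symmetric])
        qed
        ultimately show ?thesis using ell2_normD[of "P k \<xi>" ?A F] F by linarith
      qed
      ultimately show ?thesis by (intro LIMSEQ_le_const2) auto
    qed
    have z: "S \<xi> x = 0" if "x \<notin> ?A" for x
      using that QD(2)[OF \<xi>] by (simp add: S_def ell2_def)
    show ?thesis using ell2_normI[OF z b] by blast
  qed
  have S: "S \<in> bounded_operators ?A"
  proof (rule bounded_operatorsI[where K = 2])
    fix \<xi> \<eta> assume "\<xi> \<in> ell2 ?A" "\<eta> \<in> ell2 ?A"
    then show "S (\<lambda>x. \<xi> x + \<eta> x) = (\<lambda>x. S \<xi> x + S \<eta> x)"
      unfolding S_def QD(3)[OF \<open>\<xi> \<in> ell2 ?A\<close> \<open>\<eta> \<in> ell2 ?A\<close>] by (simp add: suminf_add summ)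
  next
    fix c \<xi> assume "\<xi> \<in> ell2 ?A"
    then show "S (\<lambda>x. c * \<xi> x) = (\<lambda>x. c * S \<xi> x)"
      unfolding S_def QD(4)[OF \<open>\<xi> \<in> ell2 ?A\<close>] by (simp add: suminf_mult summ)
  next
    fix \<xi> assume "\<xi> \<notin> ell2 ?A"
    then show "S \<xi> = (\<lambda>_. 0)" by (auto simp: S_def Q_def)
  qed (use S_ell2 in auto)
  \<comment> \<open>The tail of the series at \<xi> is the whole series at \<open>Q k \<xi>\<close>,
    whose norm has shrunk by \<open>2 ^ k\<close>.\<close>
  have tail: "?n (\<lambda>x. S \<xi> x - P k \<xi> x) \<le> (2 / 2 ^ k) * ?n \<xi>" if \<xi>: "\<xi> \<in> ell2 ?A" for \<xi> k
  proof -
    have "Q n (Q k \<xi>) = Q (n + k) \<xi>" for n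
      using \<xi> pow[OF \<xi>, of k] by (simp add: Q_def funpow_add)
    then have "S \<xi> x - P k \<xi> x = S (Q k \<xi>) x" for x
      using suminf_minus_initial_segment[OF summ[of \<xi> x], of k] by (simp add: S_def P_def)
    then have "?n (\<lambda>x. S \<xi> x - P k \<xi> x) = ?n (S (Q k \<xi>))" by simp
    also have "\<dots> \<le> 2 * ?n (Q k \<xi>)" using S_ell2[OF QD(2)[OF \<xi>]] by blast
    also have "\<dots> \<le> 2 * (?n \<xi> / 2 ^ k)" using Q_norm[OF \<xi>] by (intro mult_left_mono) auto
    finally show ?thesis by simp
  qed
  have "S \<in> carrier cstar"
  proof (rule reduced_cstar_carrierI[OF is_group S])
    fix \<epsilon> :: real assume \<epsilon>: "\<epsilon> > 0"
    obtain k where k: "(1 / 2 :: real) ^ k < \<epsilon> / 4"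
      using real_arch_pow_inv[of "\<epsilon> / 4" "1 / 2"] \<epsilon> by auto
    obtain a where a: "a \<in> group_algebra G" "op_norm ?A (\<lambda>\<xi> x. P k \<xi> x - left_regular G a \<xi> x) < \<epsilon> / 2"
      using reduced_cstar_carrierD(2)[OF is_group P, of "\<epsilon> / 2" k] \<epsilon> by auto
    note Pk = reduced_cstar_carrierD(1)[OF is_group P]
    have "op_norm ?A (\<lambda>\<xi> x. S \<xi> x - P k \<xi> x) \<le> 2 / 2 ^ k"
      by (rule op_norm_le) (use tail in auto)
    also have "\<dots> < \<epsilon> / 2" using k by (simp add: power_divide)
    finally have "op_norm ?A (\<lambda>\<xi> x. (S \<xi> x - P k \<xi> x) + (P k \<xi> x - left_regular G a \<xi> x)) < \<epsilon>"
      using bounded_operators_add(2)[OF bounded_operators_diff[OF S Pk]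
        bounded_operators_diff[OF Pk left_regular_bounded[OF is_group a(1)]], of k k] a(2) by linarith
    then show "\<exists>a\<in>group_algebra G. op_norm ?A (\<lambda>\<xi> x. S \<xi> x - left_regular G a \<xi> x) < \<epsilon>"
      using a(1) by auto
  qed
  moreover have "S (\<lambda>x. \<xi> x - R \<xi> x) = \<xi>" if \<xi>: "\<xi> \<in> ell2 ?A" for \<xi>
  proof
    fix x
    have "Q n (\<lambda>x. \<xi> x - R \<xi> x) x = Q n \<xi> x - Q (Suc n) \<xi> x" for n
    proof -
      have "Q n (\<lambda>x. \<xi> x + (-1) * R \<xi> x) = (\<lambda>x. Q n \<xi> x + (-1) * Q n (R \<xi>) x)"
        unfolding QD(3)[OF \<xi> ell2_scale(1)[OF D(2)[OF \<xi>]]] QD(4)[OF D(2)[OF \<xi>]] ..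
      moreover have "Q n (R \<xi>) = Q (Suc n) \<xi>"
        using \<xi> D(2)[OF \<xi>] by (simp add: Q_def funpow_swap1)
      ultimately show ?thesis by simp
    qed
    moreover have "(\<lambda>n. Q n \<xi> x - Q (Suc n) \<xi> x) sums (Q 0 \<xi> x - 0)"
      by (rule telescope_sums'[OF summable_LIMSEQ_zero[OF summ]])
    ultimately show "S (\<lambda>x. \<xi> x - R \<xi> x) x = \<xi> x"
      using \<xi> by (simp add: S_def sums_iff Q_def)
  qed
  ultimately show ?thesis by blast
qed

end

section \<open>Averages of conjugates and simplicity\<close>

context group
begin

definition trans_op :: "'a \<Rightarrow> 'a operator" where
  "trans_op g = left_regular G (Poly_Mapping.single g 1)"

lemma trans_op_apply: "\<xi> \<in> ell2 (carrier G) \<Longrightarrow> trans_op g \<xi> = left_translate G g \<xi>"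
  unfolding trans_op_def left_regular_single[OF is_group] by simp

lemma trans_op_cstar: "g \<in> carrier G \<Longrightarrow> trans_op g \<in> carrier cstar"
  unfolding trans_op_def by (intro left_regular_in_reduced_cstar group_algebra_single is_group)

lemma trans_op_ell2:
  assumes "g \<in> carrier G" "\<xi> \<in> ell2 (carrier G)"
  shows "trans_op g \<xi> \<in> ell2 (carrier G)" "ell2_norm (carrier G) (trans_op g \<xi>) \<le> ell2_norm (carrier G) \<xi>"
  using left_translate_ell2[OF is_group assms] by (simp_all add: trans_op_apply[OF assms(2)])

definition conj_op :: "'a \<Rightarrow> 'a operator \<Rightarrow> 'a operator" where
  "conj_op g T = (\<lambda>\<xi>. trans_op g (T (trans_op (inv g) \<xi>)))"

lemma conj_op_ell2:
  assumes g: "g \<in> carrier G" and T: "T \<in> bounded_operators (carrier G)" and \<xi>: "\<xi> \<in> ell2 (carrier G)"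
  shows "conj_op g T \<xi> \<in> ell2 (carrier G)"
    "ell2_norm (carrier G) (conj_op g T \<xi>) \<le> op_norm (carrier G) T * ell2_norm (carrier G) \<xi>"
proof -
  have 1: "trans_op (inv g) \<xi> \<in> ell2 (carrier G)"
    "ell2_norm (carrier G) (trans_op (inv g) \<xi>) \<le> ell2_norm (carrier G) \<xi>"
    using trans_op_ell2[OF inv_closed[OF g] \<xi>] .
  have 2: "T (trans_op (inv g) \<xi>) \<in> ell2 (carrier G)" using bounded_operatorsD(2)[OF T 1(1)] .
  show "conj_op g T \<xi> \<in> ell2 (carrier G)" unfolding conj_op_def by (rule trans_op_ell2(1)[OF g 2])
  have "ell2_norm (carrier G) (conj_op g T \<xi>) \<le> ell2_norm (carrier G) (T (trans_op (inv g) \<xi>))"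
    unfolding conj_op_def by (rule trans_op_ell2(2)[OF g 2])
  also have "\<dots> \<le> op_norm (carrier G) T * ell2_norm (carrier G) (trans_op (inv g) \<xi>)"
    by (rule le_op_norm[OF T 1(1)])
  also have "\<dots> \<le> op_norm (carrier G) T * ell2_norm (carrier G) \<xi>"
    by (rule mult_left_mono[OF 1(2) op_norm_nonneg[OF T]])
  finally show "ell2_norm (carrier G) (conj_op g T \<xi>) \<le> op_norm (carrier G) T * ell2_norm (carrier G) \<xi>" .
qed

lemma conj_op_diff:
  assumes g: "g \<in> carrier G" and S: "S \<in> bounded_operators (carrier G)" and T: "T \<in> bounded_operators (carrier G)"
    and \<xi>: "\<xi> \<in> ell2 (carrier G)"
  shows "conj_op g (\<lambda>\<xi> x. S \<xi> x - T \<xi> x) \<xi> x = conj_op g S \<xi> x - conj_op g T \<xi> x"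
proof -
  let ?\<eta> = "trans_op (inv g) \<xi>"
  have \<eta>: "?\<eta> \<in> ell2 (carrier G)" using trans_op_ell2[OF inv_closed[OF g] \<xi>] by blast
  note ST = bounded_operatorsD(2)[OF S \<eta>] bounded_operatorsD(2)[OF T \<eta>]
  show ?thesis
    unfolding conj_op_def trans_op_apply[OF ST(1)] trans_op_apply[OF ST(2)] trans_op_apply[OF ell2_diff(1)[OF ST]]
    by (simp add: left_translate_def)
qed

lemma conj_op_left_regular:
  assumes g: "g \<in> carrier G" and a: "a \<in> group_algebra G" and \<xi>: "\<xi> \<in> ell2 (carrier G)"
    and K: "finite K" "Poly_Mapping.keys a \<subseteq> K" "K \<subseteq> carrier G"
  shows "conj_op g (left_regular G a) \<xi> z =
    (\<Sum>\<gamma>\<in>K. Poly_Mapping.lookup a \<gamma> * left_translate G (g \<otimes> \<gamma> \<otimes> inv g) \<xi> z)"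
proof -
  let ?\<eta> = "trans_op (inv g) \<xi>"
  have \<eta>: "?\<eta> \<in> ell2 (carrier G)" using trans_op_ell2[OF inv_closed[OF g] \<xi>] by blast
  note b = bounded_operatorsD(2)[OF left_regular_bounded[OF is_group a] \<eta>]
  show ?thesis
  proof (cases "z \<in> carrier G")
    case True
    have "conj_op g (left_regular G a) \<xi> z = left_regular G a ?\<eta> (inv g \<otimes> z)"
      unfolding conj_op_def trans_op_apply[OF b] using True by (simp add: left_translate_def)
    also have "\<dots> = (\<Sum>\<gamma>\<in>K. Poly_Mapping.lookup a \<gamma> * left_translate G \<gamma> ?\<eta> (inv g \<otimes> z))"
      by (rule left_regular_superset[OF is_group K(1,2) \<eta>])
    also have "\<dots> = (\<Sum>\<gamma>\<in>K. Poly_Mapping.lookup a \<gamma> * left_translate G (g \<otimes> \<gamma> \<otimes> inv g) \<xi> z)"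
    proof (rule sum.cong[OF refl])
      fix \<gamma> assume "\<gamma> \<in> K"
      then have "\<gamma> \<in> carrier G" using K by blast
      then have "left_translate G \<gamma> ?\<eta> (inv g \<otimes> z) = left_translate G (g \<otimes> \<gamma> \<otimes> inv g) \<xi> z"
        unfolding trans_op_apply[OF \<xi>] using g True
        by (simp add: left_translate_def inv_mult_group m_assoc)
      then show "Poly_Mapping.lookup a \<gamma> * left_translate G \<gamma> ?\<eta> (inv g \<otimes> z) =
        Poly_Mapping.lookup a \<gamma> * left_translate G (g \<otimes> \<gamma> \<otimes> inv g) \<xi> z" by simp
    qed
    finally show ?thesis .
  next
    case False
    then show ?thesis unfolding conj_op_def trans_op_apply[OF b] by (simp add: left_translate_def)
  qed
qed

lemma left_regular_delta_one:
  assumes a: "a \<in> group_algebra G"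
  shows "left_regular G a (delta \<one>) \<one> = Poly_Mapping.lookup a \<one>"
proof -
  let ?K = "insert \<one> (Poly_Mapping.keys a)"
  have "left_regular G a (delta \<one>) \<one> = (\<Sum>\<gamma>\<in>?K. Poly_Mapping.lookup a \<gamma> * left_translate G \<gamma> (delta \<one>) \<one>)"
    by (rule left_regular_superset[OF is_group]) (auto simp: delta_ell2)
  also have "\<dots> = (\<Sum>\<gamma>\<in>?K. if \<gamma> = \<one> then Poly_Mapping.lookup a \<gamma> else 0)"
  proof (rule sum.cong[OF refl])
    fix \<gamma> assume "\<gamma> \<in> ?K"
    then have "\<gamma> \<in> carrier G" using a by (auto simp: group_algebra_def)
    then show "Poly_Mapping.lookup a \<gamma> * left_translate G \<gamma> (delta \<one>) \<one> = (if \<gamma> = \<one> then Poly_Mapping.lookup a \<gamma> else 0)"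
      by (auto simp: left_translate_def delta_def inv_eq_1_iff)
  qed
  finally show ?thesis by simp
qed

text \<open>The error has three parts of at most 1/8 each: the defect of the coefficient at the
  identity (\<open>t1\<close>), the averaged nontrivial group elements (\<open>t2\<close>), and the
  averaged approximation error (\<open>t3\<close>).\<close>

lemma average_close_to_one:
  assumes W: "W \<in> bounded_operators (carrier G)" and a: "a \<in> group_algebra G"
    and Wa: "op_norm (carrier G) (\<lambda>\<xi> x. W \<xi> x - left_regular G a \<xi> x) \<le> 1 / 8"
    and a1: "cmod (1 - Poly_Mapping.lookup a \<one>) \<le> 1 / 8"
    and y: "\<And>j. y j \<in> carrier G"
    and D: "\<And>x. x \<in> Poly_Mapping.keys a - {\<one>} \<Longrightarrow> \<exists>D\<subseteq>carrier G. (\<forall>z\<in>carrier G - D. x \<otimes> z \<in> D) \<and>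
      (\<forall>i j. i \<noteq> j \<longrightarrow> (y i <# D) \<inter> (y j <# D) = {})"
  shows "\<exists>N::nat. \<forall>\<xi>\<in>ell2 (carrier G).
    ell2_norm (carrier G) (\<lambda>z. \<xi> z - 1 / of_nat N * (\<Sum>j<N. conj_op (y j) W \<xi> z)) \<le> ell2_norm (carrier G) \<xi> / 2"
proof -
  let ?A = "carrier G" and ?a = "Poly_Mapping.lookup a"
  let ?n = "ell2_norm ?A"
  define J where "J = Poly_Mapping.keys a - {\<one>}"
  have J: "finite J" "J \<subseteq> ?A" using a by (auto simp: J_def group_algebra_def)
  define c where "c = (\<Sum>\<gamma>\<in>J. cmod (?a \<gamma>))"
  have c: "c \<ge> 0" by (simp add: c_def sum_nonneg)
  \<comment> \<open>The bound on \<open>t2\<close> asks for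
    \<open>2 * c / sqrt N \<le> 1 / 8\<close>, that is, \<open>16 * c \<le> sqrt N\<close>.\<close>
  obtain N :: nat where N0: "(16 * c + 1)\<^sup>2 < real N" using reals_Archimedean2 by blast
  then have N: "N > 0" using zero_le_power2[of "16 * c + 1"] by (intro gr0I) simp
  have sN: "16 * c + 1 \<le> sqrt N" using N0 c by (intro real_le_rsqrt) simp
  let ?V = "\<lambda>\<xi> x. W \<xi> x - left_regular G a \<xi> x"
  have V: "?V \<in> bounded_operators ?A" by (rule bounded_operators_diff[OF W left_regular_bounded[OF is_group a]])
  have "?n (\<lambda>z. \<xi> z - 1 / of_nat N * (\<Sum>j<N. conj_op (y j) W \<xi> z)) \<le> ?n \<xi> / 2" if \<xi>: "\<xi> \<in> ell2 ?A" for \<xi>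
  proof -
    define s where "s \<gamma> z = (\<Sum>j<N. left_translate G (y j \<otimes> \<gamma> \<otimes> inv (y j)) \<xi> z)" for \<gamma> z
    define t1 where "t1 z = (1 - ?a \<one>) * \<xi> z" for z
    define t2 where "t2 z = (\<Sum>\<gamma>\<in>J. (?a \<gamma> / of_nat N) * s \<gamma> z)" for z
    define t3 where "t3 z = 1 / of_nat N * (\<Sum>j<N. conj_op (y j) ?V \<xi> z)" for z
    have s: "s \<gamma> \<in> ell2 ?A" "?n (s \<gamma>) \<le> 2 * sqrt N * ?n \<xi>" if \<gamma>J: "\<gamma> \<in> J" for \<gamma>
    proof -
      have \<gamma>: "\<gamma> \<in> ?A" using \<gamma>J J by blast
      have "left_translate G (y j \<otimes> \<gamma> \<otimes> inv (y j)) \<xi> \<in> ell2 ?A" for j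
        using y \<gamma> by (intro left_translate_ell2(1)[OF is_group _ \<xi>]) simp
      then show "s \<gamma> \<in> ell2 ?A"
        using ell2_sum[of "{..<N}" "\<lambda>j. left_translate G (y j \<otimes> \<gamma> \<otimes> inv (y j)) \<xi>" ?A] by (simp add: s_def[abs_def])
      from D[OF \<gamma>J[unfolded J_def]]
      obtain E where E: "E \<subseteq> ?A" "\<forall>z\<in>?A - E. \<gamma> \<otimes> z \<in> E" "\<forall>i j. i \<noteq> j \<longrightarrow> (y i <# E) \<inter> (y j <# E) = {}"
        by (elim exE conjE) (rule that)
      show "?n (s \<gamma>) \<le> 2 * sqrt N * ?n \<xi>"
        unfolding s_def[abs_def] by (rule powers_bound[OF \<gamma> y E(1) bspec[OF E(2)] E(3)[rule_format] \<xi>])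
    qed
    have t1: "t1 \<in> ell2 ?A" "?n t1 \<le> 1 / 8 * ?n \<xi>"
      unfolding t1_def[abs_def] using ell2_scale[OF \<xi>, of "1 - ?a \<one>"] mult_right_mono[OF a1 ell2_norm_nonneg[of ?A \<xi>]]
      by auto
    have t2: "t2 \<in> ell2 ?A" "?n t2 \<le> 1 / 8 * ?n \<xi>"
    proof -
      have *: "(\<lambda>z. (?a \<gamma> / of_nat N) * s \<gamma> z) \<in> ell2 ?A" if "\<gamma> \<in> J" for \<gamma>
        using ell2_scale(1)[OF s(1)[OF that]] .
      note sum = ell2_sum[of J "\<lambda>\<gamma> z. (?a \<gamma> / of_nat N) * s \<gamma> z" ?A, OF *]
      show "t2 \<in> ell2 ?A" using sum by (simp add: t2_def[abs_def])
      have "?n t2 \<le> (\<Sum>\<gamma>\<in>J. ?n (\<lambda>z. (?a \<gamma> / of_nat N) * s \<gamma> z))"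
        using sum by (simp add: t2_def[abs_def])
      also have "\<dots> \<le> (\<Sum>\<gamma>\<in>J. cmod (?a \<gamma>) * (2 / sqrt N * ?n \<xi>))"
      proof (rule sum_mono)
        fix \<gamma> assume \<gamma>: "\<gamma> \<in> J"
        have "?n (\<lambda>z. (?a \<gamma> / of_nat N) * s \<gamma> z) = cmod (?a \<gamma>) * (?n (s \<gamma>) / N)"
          using ell2_scale(2)[OF s(1)[OF \<gamma>], of "?a \<gamma> / of_nat N"] by (simp add: norm_divide)
        also have "\<dots> \<le> cmod (?a \<gamma>) * (2 * sqrt N * ?n \<xi> / N)"
          using s(2)[OF \<gamma>] by (intro mult_left_mono divide_right_mono) auto
        also have "2 * sqrt N * ?n \<xi> / N = 2 / sqrt N * ?n \<xi>"
          using N by (simp add: field_simps)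
        finally show "?n (\<lambda>z. (?a \<gamma> / of_nat N) * s \<gamma> z) \<le> cmod (?a \<gamma>) * (2 / sqrt N * ?n \<xi>)" .
      qed
      also have "\<dots> = (2 * c / sqrt N) * ?n \<xi>"
        unfolding c_def sum_distrib_right[symmetric] by simp
      also have "\<dots> \<le> 1 / 8 * ?n \<xi>"
        using sN c N by (intro mult_right_mono) (auto simp: field_simps ell2_norm_nonneg)
      finally show "?n t2 \<le> 1 / 8 * ?n \<xi>" .
    qed
    have t3: "t3 \<in> ell2 ?A" "?n t3 \<le> 1 / 8 * ?n \<xi>"
    proof -
      let ?S = "\<lambda>z. \<Sum>j<N. conj_op (y j) ?V \<xi> z"
      note sum = ell2_sum[of "{..<N}" "\<lambda>j. conj_op (y j) ?V \<xi>" ?A, OF conj_op_ell2(1)[OF y V \<xi>]]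
      show "t3 \<in> ell2 ?A" unfolding t3_def[abs_def] using ell2_scale(1) sum by blast
      have "?n ?S \<le> (\<Sum>j<N. ?n (conj_op (y j) ?V \<xi>))" using sum by blast
      also have "\<dots> \<le> (\<Sum>j<N. op_norm ?A ?V * ?n \<xi>)"
        by (intro sum_mono conj_op_ell2(2)[OF y V \<xi>])
      finally have nS: "?n ?S \<le> N * (op_norm ?A ?V * ?n \<xi>)" by simp
      have "?n t3 = 1 / N * ?n ?S"
        unfolding t3_def[abs_def] using ell2_scale(2)[OF conjunct1[OF sum], of "1 / of_nat N"] by (simp add: norm_divide)
      also have "\<dots> \<le> 1 / N * (N * (op_norm ?A ?V * ?n \<xi>))" by (rule mult_left_mono[OF nS]) simp
      also have "\<dots> = op_norm ?A ?V * ?n \<xi>" using N by simp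
      also have "\<dots> \<le> 1 / 8 * ?n \<xi>" by (rule mult_right_mono[OF Wa ell2_norm_nonneg])
      finally show "?n t3 \<le> 1 / 8 * ?n \<xi>" .
    qed
    have "\<xi> z - 1 / of_nat N * (\<Sum>j<N. conj_op (y j) W \<xi> z) = t1 z - t2 z - t3 z" for z
    proof -
      have conj_one: "left_translate G (y j \<otimes> \<one> \<otimes> inv (y j)) \<xi> z = \<xi> z" for j
        using y \<xi> by (auto simp: left_translate_def ell2_def)
      have "conj_op (y j) (left_regular G a) \<xi> z =
          ?a \<one> * \<xi> z + (\<Sum>\<gamma>\<in>J. ?a \<gamma> * left_translate G (y j \<otimes> \<gamma> \<otimes> inv (y j)) \<xi> z)" for j
      proof -
        have "conj_op (y j) (left_regular G a) \<xi> z =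
            (\<Sum>\<gamma>\<in>insert \<one> J. ?a \<gamma> * left_translate G (y j \<otimes> \<gamma> \<otimes> inv (y j)) \<xi> z)"
          using J by (intro conj_op_left_regular[OF y a \<xi>]) (auto simp: J_def)
        moreover have "\<one> \<notin> J" by (simp add: J_def)
        ultimately show ?thesis by (simp only: sum.insert[OF J(1)] conj_one simp_thms)
      qed
      then have "(\<Sum>j<N. conj_op (y j) (left_regular G a) \<xi> z) =
          of_nat N * (?a \<one> * \<xi> z) + (\<Sum>j<N. \<Sum>\<gamma>\<in>J. ?a \<gamma> * left_translate G (y j \<otimes> \<gamma> \<otimes> inv (y j)) \<xi> z)"
        by (simp add: sum.distrib)
      also have "(\<Sum>j<N. \<Sum>\<gamma>\<in>J. ?a \<gamma> * left_translate G (y j \<otimes> \<gamma> \<otimes> inv (y j)) \<xi> z) = (\<Sum>\<gamma>\<in>J. ?a \<gamma> * s \<gamma> z)"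
        unfolding s_def sum_distrib_left by (rule sum.swap)
      finally have L: "(\<Sum>j<N. conj_op (y j) (left_regular G a) \<xi> z) = of_nat N * (?a \<one> * \<xi> z) + of_nat N * t2 z"
        using N by (simp add: t2_def sum_distrib_left)
      have "(\<Sum>j<N. conj_op (y j) ?V \<xi> z) =
          (\<Sum>j<N. conj_op (y j) W \<xi> z) - (\<Sum>j<N. conj_op (y j) (left_regular G a) \<xi> z)"
        by (simp add: conj_op_diff[OF y W left_regular_bounded[OF is_group a] \<xi>] sum_subtractf)
      then have "(\<Sum>j<N. conj_op (y j) W \<xi> z) = of_nat N * t3 z + (of_nat N * (?a \<one> * \<xi> z) + of_nat N * t2 z)"
        using N L by (simp add: t3_def)
      then show ?thesis using N by (simp add: t1_def field_simps)
    qed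
    then have "?n (\<lambda>z. \<xi> z - 1 / of_nat N * (\<Sum>j<N. conj_op (y j) W \<xi> z)) = ?n (\<lambda>z. t1 z - t2 z - t3 z)"
      by simp
    also have "\<dots> \<le> ?n t1 + ?n t2 + ?n t3"
      using ell2_diff[OF ell2_diff(1)[OF t1(1) t2(1)] t3(1)] ell2_diff(2)[OF t1(1) t2(1)] by linarith
    also have "\<dots> \<le> ?n \<xi> / 2" using t1(2) t2(2) t3(2) ell2_norm_nonneg[of ?A \<xi>] by linarith
    finally show ?thesis .
  qed
  then show ?thesis by blast
qed

text \<open>Averages of conjugates of an element of \<open>I\<close> stay in \<open>I\<close>. Once
  such an average \<open>Q\<close> is within 1/2 of the identity, it is invertible in the algebra,
  and the identity lies in \<open>I\<close>.\<close>

theorem powers_simple: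
  assumes P: "\<And>J. finite J \<Longrightarrow> J \<subseteq> carrier G - {\<one>} \<Longrightarrow> \<exists>y::nat \<Rightarrow> 'a. (\<forall>j. y j \<in> carrier G) \<and>
    (\<forall>x\<in>J. \<exists>D\<subseteq>carrier G. (\<forall>z\<in>carrier G - D. x \<otimes> z \<in> D) \<and>
      (\<forall>i j. i \<noteq> j \<longrightarrow> (y i <# D) \<inter> (y j <# D) = {}))"
  shows "simple_complex_algebra cstar"
  unfolding simple_complex_algebra_def
proof (intro allI impI)
  let ?A = "carrier G"
  let ?n = "ell2_norm ?A"
  fix I assume "ideal I cstar \<and> (\<forall>c. \<forall>T\<in>I. c \<odot>\<^bsub>cstar\<^esub> T \<in> I)"
  then have I: "ideal I cstar" and sm: "\<And>c T. T \<in> I \<Longrightarrow> (\<lambda>\<xi> x. c * T \<xi> x) \<in> I"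
    by (auto simp: reduced_cstar_algebra_def)
  interpret I: ideal I cstar by (rule I)
  have I_mult: "(\<lambda>\<xi>. S (T \<xi>)) \<in> I" if "S \<in> carrier cstar" "T \<in> I" for S T
    using I.I_l_closed[OF that(2,1)] by (simp add: reduced_cstar_algebra_def)
  have I_mult': "(\<lambda>\<xi>. T (S \<xi>)) \<in> I" if "S \<in> carrier cstar" "T \<in> I" for S T
    using I.I_r_closed[OF that(2,1)] by (simp add: reduced_cstar_algebra_def)
  have I_add: "(\<lambda>\<xi> x. S \<xi> x + T \<xi> x) \<in> I" if "S \<in> I" "T \<in> I" for S T
    using additive_subgroup.a_closed[OF I.is_additive_subgroup that] by (simp add: reduced_cstar_algebra_def)
  have I_zero: "(\<lambda>\<xi> x. 0) \<in> I"
    using additive_subgroup.zero_closed[OF I.is_additive_subgroup] by (simp add: reduced_cstar_algebra_def)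
  have I_carrier: "T \<in> carrier cstar" if "T \<in> I" for T using that by (rule I.Icarr)
  show "I = {\<zero>\<^bsub>cstar\<^esub>} \<or> I = carrier cstar"
  proof (rule disjCI)
    assume "I \<noteq> carrier cstar"
    show "I = {\<zero>\<^bsub>cstar\<^esub>}"
    proof (rule ccontr)
      assume "I \<noteq> {\<zero>\<^bsub>cstar\<^esub>}"
      then obtain T where T: "T \<in> I" "T \<noteq> (\<lambda>\<xi> x. 0)"
        using I_zero by (auto simp: reduced_cstar_algebra_def)
      have T': "T \<in> bounded_operators ?A" using reduced_cstar_carrierD(1)[OF is_group I_carrier[OF T(1)]] .
      obtain g z where g: "g \<in> ?A" "T (delta g) z \<noteq> 0"
        using bounded_operators_eqI_delta[OF T'] T(2) by blast
      note dg = delta_ell2(1)[OF g(1)]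
      have z: "z \<in> ?A" using g(2) bounded_operatorsD(2)[OF T' dg] by (auto simp: ell2_def)
      \<comment> \<open>Two translations move a nonzero matrix entry of \<open>T\<close> to the
        position of the identity, and scaling makes it 1. This takes the place of passing to a
        positive element of nonzero trace.\<close>
      define W where "W = (\<lambda>\<xi> x. 1 / T (delta g) z * trans_op (inv z) (T (trans_op g \<xi>)) x)"
      have W: "W \<in> I"
        unfolding W_def using g(1) z T(1)
        by (intro sm I_mult[OF trans_op_cstar] I_mult'[OF trans_op_cstar]) auto
      have W': "W \<in> bounded_operators ?A" using reduced_cstar_carrierD(1)[OF is_group I_carrier[OF W]] .
      have d1: "delta \<one> \<in> ell2 ?A" "?n (delta \<one>) \<le> 1" using delta_ell2[of \<one> ?A] by auto
      have "trans_op g (delta \<one>) = delta g"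
        unfolding trans_op_apply[OF d1(1)] using g(1)
        by (auto simp: left_translate_def delta_def fun_eq_iff) (metis inv_closed inv_equality inv_inv)
      then have W1: "W (delta \<one>) \<one> = 1"
        unfolding W_def using g z trans_op_apply[OF bounded_operatorsD(2)[OF T' dg], of "inv z"]
        by (simp add: left_translate_def)
      obtain a where a: "a \<in> group_algebra G" "op_norm ?A (\<lambda>\<xi> x. W \<xi> x - left_regular G a \<xi> x) < 1 / 8"
        using reduced_cstar_carrierD(2)[OF is_group I_carrier[OF W], of "1 / 8"] by auto
      note V = bounded_operators_diff[OF W' left_regular_bounded[OF is_group a(1)]]
      have "cmod (1 - Poly_Mapping.lookup a \<one>) = cmod (W (delta \<one>) \<one> - left_regular G a (delta \<one>) \<one>)"
        by (simp add: W1 left_regular_delta_one[OF a(1)])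
      also have "\<dots> \<le> ?n (\<lambda>x. W (delta \<one>) x - left_regular G a (delta \<one>) x)"
        using ell2_coord_le[OF bounded_operatorsD(2)[OF V d1(1)]] .
      also have "\<dots> \<le> op_norm ?A (\<lambda>\<xi> x. W \<xi> x - left_regular G a \<xi> x) * ?n (delta \<one>)"
        by (rule le_op_norm[OF V d1(1)])
      also have "\<dots> \<le> 1 / 8 * 1"
        using a(2) d1(2) by (intro mult_mono) (auto simp: ell2_norm_nonneg)
      finally have a1: "cmod (1 - Poly_Mapping.lookup a \<one>) \<le> 1 / 8" by simp
      have keys: "finite (Poly_Mapping.keys a - {\<one>})" "Poly_Mapping.keys a - {\<one>} \<subseteq> ?A - {\<one>}"
        using a(1) by (auto simp: group_algebra_def)
      from P[OF keys] obtain y :: "nat \<Rightarrow> 'a" where yD: "\<forall>j. y j \<in> ?A"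
        "\<forall>x\<in>Poly_Mapping.keys a - {\<one>}. \<exists>D\<subseteq>carrier G. (\<forall>z\<in>carrier G - D. x \<otimes> z \<in> D) \<and>
          (\<forall>i j. i \<noteq> j \<longrightarrow> (y i <# D) \<inter> (y j <# D) = {})"
        by (elim exE conjE) (rule that)
      have y: "\<And>j. y j \<in> ?A" and D: "\<And>x. x \<in> Poly_Mapping.keys a - {\<one>} \<Longrightarrow> \<exists>D\<subseteq>carrier G. (\<forall>z\<in>carrier G - D. x \<otimes> z \<in> D) \<and>
          (\<forall>i j. i \<noteq> j \<longrightarrow> (y i <# D) \<inter> (y j <# D) = {})"
        using yD(1) by (rule spec) (rule bspec[OF yD(2)])
      have "\<exists>N::nat. \<forall>\<xi>\<in>ell2 ?A.
          ?n (\<lambda>z. \<xi> z - 1 / of_nat N * (\<Sum>j<N. conj_op (y j) W \<xi> z)) \<le> ?n \<xi> / 2"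
        by (rule average_close_to_one[OF W' a(1) less_imp_le[OF a(2)] a1 y]) (rule D)
      then obtain N :: nat where N: "\<forall>\<xi>\<in>ell2 ?A.
          ?n (\<lambda>z. \<xi> z - 1 / of_nat N * (\<Sum>j<N. conj_op (y j) W \<xi> z)) \<le> ?n \<xi> / 2"
        by (elim exE) (rule that)
      define Q where "Q = (\<lambda>\<xi> z. 1 / of_nat N * (\<Sum>j<N. conj_op (y j) W \<xi> z))"
      have conjI: "conj_op (y j) W \<in> I" for j
        unfolding conj_op_def
        by (rule I_mult[OF trans_op_cstar[OF y] I_mult'[OF trans_op_cstar[OF inv_closed[OF y]] W]])
      have "(\<lambda>\<xi> z. \<Sum>j<k. conj_op (y j) W \<xi> z) \<in> I" for k
      proof (induction k)
        case (Suc k)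
        then show ?case using I_add[OF Suc conjI[of k]] by simp
      qed (simp add: I_zero)
      then have Q: "Q \<in> I" unfolding Q_def by (rule sm)
      note Q' = bounded_operatorsD[OF reduced_cstar_carrierD(1)[OF is_group I_carrier[OF Q]]]
      let ?one = "\<lambda>\<xi>. if \<xi> \<in> ell2 ?A then \<xi> else (\<lambda>_. 0)"
      \<comment> \<open>The Neumann series of \<open>R\<close> inverts \<open>Q\<close>, since
        \<open>R\<close> is the identity minus \<open>Q\<close>.\<close>
      define R where "R = (\<lambda>\<xi> x. ?one \<xi> x + (-1) * Q \<xi> x)"
      have R: "R \<in> carrier cstar"
        unfolding R_def by (rule reduced_cstar_add[OF is_group cstar_one reduced_cstar_smult[OF is_group I_carrier[OF Q]]])
      have "?n (R \<xi>) \<le> ?n \<xi> / 2" if "\<xi> \<in> ell2 ?A" for \<xi>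
        using bspec[OF N that] that by (simp add: R_def Q_def)
      from neumann_inverse[OF R this]
      obtain S where S: "S \<in> carrier cstar" "\<And>\<xi>. \<xi> \<in> ell2 ?A \<Longrightarrow> S (\<lambda>x. \<xi> x - R \<xi> x) = \<xi>"
        by blast
      have "(\<lambda>\<xi>. S (Q \<xi>)) = ?one"
      proof
        fix \<xi> show "S (Q \<xi>) = ?one \<xi>"
        proof (cases "\<xi> \<in> ell2 ?A")
          case True
          then have "(\<lambda>x. \<xi> x - R \<xi> x) = Q \<xi>" by (simp add: R_def)
          then show ?thesis using S(2)[OF True] True by simp
        next
          case False
          then show ?thesis
            using Q'(1) bounded_operators_zero_arg[OF reduced_cstar_carrierD(1)[OF is_group S(1)]] by simp
        qed
      qed
      then have "\<one>\<^bsub>cstar\<^esub> \<in> I"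
        using I_mult[OF S(1) Q] by (simp add: reduced_cstar_algebra_def)
      then show False using I.one_imp_carrier \<open>I \<noteq> carrier cstar\<close> by blast
    qed
  qed
qed

end

text \<open>In the free group itself take the words that begin with a nonzero power of
  \<open>x\<close>. Multiplication by \<open>x\<close> moves all other words among them, and
  multiplication by \<open>y [^] i\<close> puts exactly \<open>i\<close> letters \<open>y\<close> in
  front. The decomposition of \<open>G\<close> into right cosets of the free subgroup transfers this
  to \<open>G\<close>.\<close>

lemma (in group) free_pair_powers:
  fixes h :: "bool letter list \<Rightarrow> 'a"
  defines "x \<equiv> h [(False, True)]" and "y \<equiv> h [(True, True)]"
  assumes h: "h \<in> hom (free_group UNIV) G" "inj_on h (carrier (free_group UNIV))"
  shows "\<exists>D\<subseteq>carrier G. (\<forall>z\<in>carrier G - D. x \<otimes> z \<in> D) \<and>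
    (\<forall>i j :: nat. i \<noteq> j \<longrightarrow> (y [^] i <# D) \<inter> (y [^] j <# D) = {})"
proof -
  let ?F = "free_group (UNIV :: bool set)"
  interpret F: group ?F by (rule group_free_group)
  interpret h: group_hom ?F G h by unfold_locales (rule h(1))
  have carF: "carrier ?F = {w. reduced_word w}" by (simp add: free_group_def)
  have letter: "[a] \<in> carrier ?F" for a by (simp add: carF)
  define H where "H = h ` carrier ?F"
  have H: "subgroup H G" unfolding H_def by (rule h.img_is_subgroup)
  \<comment> \<open>One representative for each right coset of \<open>H\<close>. Every element is
    then uniquely the image of a word times a representative, and left multiplication by
    \<open>H\<close> changes the word alone.\<close>
  define rep where "rep z = (SOME t. t \<in> H #> z)" for z
  have rep: "rep z \<in> H #> z" if "z \<in> carrier G" for z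
    unfolding rep_def by (rule someI) (rule rcos_self[OF that H])
  have rep_coset: "rep (u \<otimes> z) = rep z" if "u \<in> H" "z \<in> carrier G" for u z
  proof -
    have "u \<otimes> z \<in> H #> z" using that by (auto simp: r_coset_def)
    then have "H #> z = H #> (u \<otimes> z)" by (rule repr_independence[OF _ that(2) H])
    then show ?thesis by (simp add: rep_def)
  qed
  define wd where "wd z = (THE w. w \<in> carrier ?F \<and> h w = z \<otimes> inv (rep z))" for z
  have rep_carrier: "rep z \<in> carrier G" if "z \<in> carrier G" for z
    using rep[OF that] r_coset_subset_G[OF subgroup.subset[OF H] that] by blast
  have wd_eq: "wd z = w" if "z \<in> carrier G" "w \<in> carrier ?F" "h w = z \<otimes> inv (rep z)" for z w
    unfolding wd_def by (rule the_equality) (use that in \<open>auto intro: inj_onD[OF h(2)]\<close>)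
  have wd: "wd z \<in> carrier ?F" "h (wd z) = z \<otimes> inv (rep z)" if z: "z \<in> carrier G" for z
  proof -
    obtain k where k: "k \<in> H" "rep z = k \<otimes> z" using rep[OF z] by (auto simp: r_coset_def)
    have kc: "k \<in> carrier G" using k(1) subgroup.mem_carrier[OF H] by blast
    have "z \<otimes> inv (rep z) = inv k" using k z kc by (simp add: inv_mult_group inv_cancel_left)
    then have "z \<otimes> inv (rep z) \<in> H" using k(1) subgroup.m_inv_closed[OF H] by simp
    then obtain w where w: "w \<in> carrier ?F" "h w = z \<otimes> inv (rep z)" unfolding H_def by (metis imageE)
    then have "wd z = w" by (rule wd_eq[OF z])
    then show "wd z \<in> carrier ?F" "h (wd z) = z \<otimes> inv (rep z)" using w by simp_all
  qed
  have push: "wd (h [a] \<otimes> z) = push_letter a (wd z)" if z: "z \<in> carrier G" for a z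
  proof -
    have ha: "h [a] \<in> H" "h [a] \<in> carrier G" using letter by (auto simp: H_def)
    have p: "[a] \<otimes>\<^bsub>?F\<^esub> wd z = push_letter a (wd z)"
      using wd(1)[OF z] reduce_append[of "[a]" "wd z"] by (simp add: free_group_def reduce_eq)
    have "h (push_letter a (wd z)) = h [a] \<otimes> h (wd z)"
      unfolding p[symmetric] by (rule h.hom_mult[OF letter wd(1)[OF z]])
    also have "\<dots> = h [a] \<otimes> z \<otimes> inv (rep (h [a] \<otimes> z))"
      using rep_coset[OF ha(1) z] wd(2)[OF z] rep_carrier[OF z] ha(2) z by (simp add: m_assoc)
    finally show ?thesis
      using wd(1)[OF z] ha(2) z by (intro wd_eq) (auto simp: carF intro: reduced_push)
  qed
  define D where "D = {z \<in> carrier G. wd z \<noteq> [] \<and> \<not> fst (hd (wd z))}"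
  have xy: "x \<in> carrier G" "y \<in> carrier G" unfolding x_def y_def using letter by auto
  have 1: "x \<otimes> z \<in> D" if z: "z \<in> carrier G - D" for z
  proof -
    have zc: "z \<in> carrier G" using z by simp
    have "wd z = [] \<or> fst (hd (wd z))" using z by (simp add: D_def)
    then have "push_letter (False, True) (wd z) = (False, True) # wd z"
      by (cases "wd z") (auto simp: inv_letter_def)
    then have "wd (x \<otimes> z) = (False, True) # wd z" unfolding x_def push[OF zc] .
    then show ?thesis using xy zc by (simp add: D_def)
  qed
  have rp: "wd (y [^] i \<otimes> d) = replicate i (True, True) @ wd d" if d: "d \<in> D" for d and i :: nat
  proof (induction i)
    case 0
    then show ?case using d by (simp add: D_def)
  next
    case (Suc i)
    have dc: "d \<in> carrier G" "wd d \<noteq> []" "\<not> fst (hd (wd d))" using d by (auto simp: D_def)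
    have "y [^] Suc i \<otimes> d = y \<otimes> (y [^] i \<otimes> d)" using xy dc(1) nat_pow_Suc2[OF xy(2)] by (simp add: m_assoc)
    then have "wd (y [^] Suc i \<otimes> d) = push_letter (True, True) (replicate i (True, True) @ wd d)"
      using push[of "y [^] i \<otimes> d" "(True, True)"] xy dc(1) Suc by (simp add: y_def)
    also have "\<dots> = (True, True) # replicate i (True, True) @ wd d"
      using dc(2,3) by (cases i; cases "wd d") (auto simp: inv_letter_def)
    finally show ?case by simp
  qed
  have 2: "(y [^] i <# D) \<inter> (y [^] j <# D) = {}" if ij: "i \<noteq> j" for i j :: nat
  proof (rule ccontr)
    assume "(y [^] i <# D) \<inter> (y [^] j <# D) \<noteq> {}"
    then obtain d d' where d: "d \<in> D" "d' \<in> D" "y [^] i \<otimes> d = y [^] j \<otimes> d'"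
      unfolding l_coset_def by blast
    \<comment> \<open>The number of leading letters of generator \<open>y\<close> recovers the
      exponent, because words of \<open>D\<close> begin with \<open>x\<close> or its
      inverse.\<close>
    let ?t = "\<lambda>w. length (takeWhile (\<lambda>a. fst a) w)"
    have t: "?t (replicate k (True, True) @ wd e) = k" if "e \<in> D" for k e
    proof -
      have "wd e \<noteq> []" "\<not> fst (hd (wd e))" using that by (auto simp: D_def)
      then have "?t (wd e) = 0" by (cases "wd e") auto
      then show ?thesis by (induction k) auto
    qed
    have "replicate i (True, True) @ wd d = replicate j (True, True) @ wd d'"
      using rp[OF d(1), of i] rp[OF d(2), of j] d(3) by simp
    then show False using t[OF d(1), of i] t[OF d(2), of j] ij by simp
  qed
  show ?thesis using 1 2 by (intro exI[of _ D]) (auto simp: D_def)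
qed

section \<open>Linear parts\<close>

lemma coeff_linear_mult:
  fixes f a :: "'x nc_series"
  shows "coeff (hpart 1 f * a) (j # w) = coeff f [j] * coeff a w"
proof -
  have "lquot j (hpart 1 f) = of_int (coeff f [j]) * 1"
    by (rule nc_series_eqI, unfold coeff_of_int_mult) (simp add: coeff_hpart coeff_1)
  then show ?thesis by (simp add: coeff_mult_Cons coeff_hpart)
qed

text \<open>Precision 2 is enough to see linear coefficients. They form a homomorphism with kernel
  \<open>lc 2\<close>, hence faithful coordinates on the abelianization.\<close>

locale approx_group = group G for G (structure) +
  fixes c :: nat and \<psi> :: "'a \<Rightarrow> 'x nc_series"
  assumes approx: "approx_rep G c \<psi>" and c2: "c \<ge> 2"
begin

lemma \<psi>_const: "g \<in> carrier G \<Longrightarrow> coeff (\<psi> g) [] = 1"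
  using approx_repD(2)[OF approx, of g 1] c2 ord_geD[of "\<psi> g - 1" 1 "[]"] by (simp add: coeff_1)

lemma lin_mult:
  assumes "g \<in> carrier G" "h \<in> carrier G"
  shows "coeff (\<psi> (g \<otimes> h)) [j] = coeff (\<psi> g) [j] + coeff (\<psi> h) [j]"
proof -
  have "coeff (\<psi> (g \<otimes> h) - \<psi> g * \<psi> h) [j] = 0"
    by (rule ord_geD[OF approx_repD(1)[OF approx assms]]) (use c2 in simp)
  then show ?thesis using assms by (simp add: coeff_mult_Cons \<psi>_const)
qed

lemma lin_one: "coeff (\<psi> \<one>) [j] = 0"
  using lin_mult[of \<one> \<one> j] by simp

lemma lin_inv:
  assumes "g \<in> carrier G" shows "coeff (\<psi> (inv g)) [j] = - coeff (\<psi> g) [j]"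
  using lin_mult[of g "inv g" j] assms lin_one[of j] by simp

lemma lin_pow: "g \<in> carrier G \<Longrightarrow> coeff (\<psi> (g [^] (k::nat))) [j] = int k * coeff (\<psi> g) [j]"
  by (induction k) (simp_all add: lin_one lin_mult algebra_simps)

lemma lin_int_pow:
  assumes "g \<in> carrier G" shows "coeff (\<psi> (g [^] (k::int))) [j] = k * coeff (\<psi> g) [j]"
proof (cases k rule: int_cases2)
  case (nonneg n)
  then show ?thesis using assms by (simp add: int_pow_int lin_pow)
next
  case (nonpos n)
  then show ?thesis using assms by (simp add: int_pow_neg int_pow_int lin_pow lin_inv)
qed

lemma lin_eq_0_iff:
  assumes "g \<in> carrier G"
  shows "(\<forall>j. coeff (\<psi> g) [j] = 0) \<longleftrightarrow> g \<in> lc 2"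
proof -
  have "\<psi> g - 1 \<in> ord_ge 2 \<longleftrightarrow> (\<forall>j. coeff (\<psi> g) [j] = 0)"
  proof
    assume *: "\<psi> g - 1 \<in> ord_ge 2"
    show "\<forall>j. coeff (\<psi> g) [j] = 0"
    proof
      fix j show "coeff (\<psi> g) [j] = 0" using ord_geD[OF *, of "[j]"] by (simp add: coeff_1)
    qed
  next
    assume *: "\<forall>j. coeff (\<psi> g) [j] = 0"
    show "\<psi> g - 1 \<in> ord_ge 2"
    proof (rule ord_geI)
      fix w :: "'x list" assume "length w < 2"
      then have "w = [] \<or> (\<exists>j. w = [j])" by (cases w) auto
      then show "coeff (\<psi> g - 1) w = 0" using * \<psi>_const[OF assms] by (auto simp: coeff_1)
    qed
  qed
  then show ?thesis using approx_repD(2)[OF approx assms, of 2] c2 by simp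
qed

end

text \<open>
  Linear independence of (the images of) the elements of \<open>T\<close> in the abelianization, expressed by
  the linear parts of an arbitrary approximate representation.
\<close>

definition (in group) lin_indep :: "'x itself \<Rightarrow> 'a set \<Rightarrow> bool" where
  "lin_indep _ T \<longleftrightarrow> (\<forall>c\<ge>2. \<forall>\<psi>::'a \<Rightarrow> 'x nc_series. approx_rep G c \<psi> \<longrightarrow>
    (\<forall>k::'a \<Rightarrow> int. (\<forall>j. (\<Sum>t\<in>T. k t * coeff (\<psi> t) [j]) = 0) \<longrightarrow> (\<forall>t\<in>T. k t = 0)))"

lemma (in group) lin_indepD:
  fixes \<psi> :: "'a \<Rightarrow> 'x nc_series"
  assumes "lin_indep TYPE('x) T" "approx_rep G c \<psi>" "c \<ge> 2"
    and "\<And>j. (\<Sum>t\<in>T. k t * coeff (\<psi> t) [j]) = 0" "t \<in> T"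
  shows "k t = 0"
  using assms unfolding lin_indep_def by blast

text \<open>One representation suffices as a test: a relation in another one yields an element of
  \<open>lc 2\<close>, a set that does not depend on the representation.\<close>

lemma (in group) lin_indepI:
  fixes \<psi>2 :: "'a \<Rightarrow> 'x nc_series"
  assumes \<psi>2: "approx_rep G c2 \<psi>2" "c2 \<ge> 2" and T: "finite T" "T \<subseteq> carrier G"
    and ind: "\<And>k :: 'a \<Rightarrow> int. (\<And>j. (\<Sum>t\<in>T. k t * coeff (\<psi>2 t) [j]) = 0) \<Longrightarrow> \<forall>t\<in>T. k t = 0"
  shows "lin_indep TYPE('x) T"
  unfolding lin_indep_def
proof (intro allI impI)
  fix c and \<psi> :: "'a \<Rightarrow> 'x nc_series" and k :: "'a \<Rightarrow> int"
  assume c: "c \<ge> 2" and \<psi>: "approx_rep G c \<psi>" and k: "\<forall>j. (\<Sum>t\<in>T. k t * coeff (\<psi> t) [j]) = 0"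
  interpret A: approx_group G c \<psi> by unfold_locales (use c \<psi> in auto)
  interpret A2: approx_group G c2 \<psi>2 by unfold_locales (use \<psi>2 in auto)
  \<comment> \<open>The witness is the product of the powers \<open>t [^] k t\<close>; its linear
    part realizes the combination in both representations at once.\<close>
  have "\<exists>g\<in>carrier G. (\<forall>j. coeff (\<psi> g) [j] = (\<Sum>t\<in>T. k t * coeff (\<psi> t) [j])) \<and>
      (\<forall>j. coeff (\<psi>2 g) [j] = (\<Sum>t\<in>T. k t * coeff (\<psi>2 t) [j]))"
    using T
  proof (induction T)
    case empty
    then show ?case by (intro bexI[of _ \<one>]) (simp_all add: A.lin_one A2.lin_one)
  next
    case (insert t T)
    then obtain g where g: "g \<in> carrier G" "\<forall>j. coeff (\<psi> g) [j] = (\<Sum>t\<in>T. k t * coeff (\<psi> t) [j])"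
      "\<forall>j. coeff (\<psi>2 g) [j] = (\<Sum>t\<in>T. k t * coeff (\<psi>2 t) [j])" by auto
    then show ?case using insert
      by (intro bexI[of _ "t [^] k t \<otimes> g"])
        (simp_all add: A.lin_mult A2.lin_mult A.lin_int_pow A2.lin_int_pow)
  qed
  then obtain g where g: "g \<in> carrier G" "\<forall>j. coeff (\<psi> g) [j] = (\<Sum>t\<in>T. k t * coeff (\<psi> t) [j])"
      "\<forall>j. coeff (\<psi>2 g) [j] = (\<Sum>t\<in>T. k t * coeff (\<psi>2 t) [j])" by auto
  have "g \<in> lc 2" using A.lin_eq_0_iff[OF g(1)] g(2) k by simp
  then have "\<forall>j. coeff (\<psi>2 g) [j] = 0" using A2.lin_eq_0_iff[OF g(1)] by simp
  then show "\<forall>t\<in>T. k t = 0" using g(3) by (intro ind) simp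
qed

lemma vector_space_fun: "vector_space (\<lambda>(a::real) (v::nat \<Rightarrow> real) i. a * v i)"
  by unfold_locales (auto simp: fun_eq_iff algebra_simps)

lemma sum_fun_apply: "(\<Sum>a\<in>A. f a) x = (\<Sum>a\<in>A. f a x :: real)" for f :: "'b \<Rightarrow> nat \<Rightarrow> real"
  by (induction A rule: infinite_finite_induct) simp_all

lemma (in group) exists_lin_indep_subset:
  fixes \<psi> :: "'a \<Rightarrow> nat nc_series"
  assumes \<psi>: "approx_rep G c \<psi>" "c \<ge> 2"
    and var: "\<And>x. x < r \<Longrightarrow> \<exists>g\<in>carrier G. \<psi> g - (1 + var_series x) \<in> ord_ge c"
    and S: "S \<subseteq> carrier G" "generate G S = carrier G"
  shows "\<exists>T\<subseteq>S. finite T \<and> card T = r \<and> lin_indep TYPE(nat) T"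
proof -
  interpret A: approx_group G c \<psi> by unfold_locales (use \<psi> in auto)
  interpret V: vector_space "\<lambda>(a::real) (v::nat \<Rightarrow> real) i. a * v i" by (rule vector_space_fun)
  \<comment> \<open>Coordinates from \<open>r\<close> on are cut off so that all vectors lie in the
    span of the \<open>r\<close> unit vectors. Independence after the cut implies independence
    before it.\<close>
  define vec where "vec g = (\<lambda>j. if j < r then real_of_int (coeff (\<psi> g) [j]) else 0)" for g
  define e where "e j = (\<lambda>i. if i = j then 1 else 0 :: real)" for j :: nat
  let ?E = "e ` {..<r}"
  have vec_span: "vec g \<in> V.span (vec ` S)" if "g \<in> carrier G" for g
  proof -
    have "g \<in> generate G S" using that S by simp
    then have "g \<in> carrier G \<and> vec g \<in> V.span (vec ` S)"
    proof induction
      case one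
      have "vec \<one> = 0" by (simp add: vec_def A.lin_one fun_eq_iff)
      then show ?case by (simp only: V.span_zero one_closed simp_thms)
    next
      case (incl h)
      then show ?case using S V.span_base by blast
    next
      case (inv h)
      then have h: "h \<in> carrier G" using S by blast
      then have "vec (inv h) = (\<lambda>i. (-1) * vec h i)" by (simp add: vec_def A.lin_inv fun_eq_iff)
      then show ?case using h inv V.span_scale[OF V.span_base[of "vec h" "vec ` S"], of "-1"] by simp
    next
      case (eng h1 h2)
      then have "vec (h1 \<otimes> h2) = vec h1 + vec h2" by (simp add: vec_def A.lin_mult fun_eq_iff)
      moreover have "vec h1 + vec h2 \<in> V.span (vec ` S)" using eng by (blast intro: V.span_add)
      ultimately show ?case using eng by (simp only: m_closed simp_thms)
    qed
    then show ?thesis ..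
  qed
  have e_vec: "e j \<in> vec ` carrier G" if "j < r" for j
  proof -
    obtain g where g: "g \<in> carrier G" "\<psi> g - (1 + var_series j) \<in> ord_ge c" using var[OF \<open>j < r\<close>] by blast
    have "coeff (\<psi> g) [i] = (if i = j then 1 else 0)" for i
      using ord_geD[OF g(2), of "[i]"] \<psi>(2) by (simp add: coeff_1 coeff_var_series)
    then have "vec g = e j" using that by (auto simp: vec_def e_def fun_eq_iff)
    then show ?thesis by (intro image_eqI[where f = vec, OF _ g(1)]) (rule sym)
  qed
  have vec_E: "vec g \<in> V.span ?E" for g
  proof -
    have "vec g = (\<Sum>j<r. (\<lambda>i. vec g j * e j i))"
      by (rule ext) (auto simp: sum_fun_apply e_def vec_def if_distrib[of "\<lambda>a. _ * a"] cong: if_cong)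
    also have "\<dots> \<in> V.span ?E"
      by (intro V.span_sum V.span_scale V.span_base) auto
    finally show ?thesis .
  qed
  have inj_e: "inj_on e {..<r}"
  proof (rule inj_onI)
    fix i j assume "e i = e j"
    then have "e i i = e j i" by simp
    then show "i = j" by (simp add: e_def split: if_splits)
  qed
  have ind_E: "V.independent ?E"
    unfolding V.independent_explicit_finite_subsets
  proof (intro allI impI ballI)
    fix W u v assume W: "W \<subseteq> ?E" "finite W" "(\<Sum>v\<in>W. (\<lambda>i. u v * v i)) = 0" "v \<in> W"
    then obtain j where j: "j < r" "v = e j" by blast
    have "(\<Sum>v\<in>W. u v * v j) = (\<Sum>w\<in>W. if w = v then u w else 0)"
    proof (rule sum.cong[OF refl])
      fix w assume "w \<in> W"
      then obtain i where i: "i < r" "w = e i" using W(1) by blast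
      show "u w * w j = (if w = v then u w else 0)"
        using inj_onD[OF inj_e, of i j] i j by (auto simp: e_def)
    qed
    also have "(\<Sum>v\<in>W. u v * v j) = 0" using fun_cong[OF W(3), of j] by (simp add: sum_fun_apply)
    finally show "u v = 0" using W(2,4) by simp
  qed
  obtain U where U: "U \<subseteq> vec ` S" "V.independent U" "vec ` S \<subseteq> V.span U"
    using V.maximal_independent_subset by blast
  have "U \<subseteq> V.span ?E" using U(1) vec_E by blast
  then have finU: "finite U" "card U \<le> card ?E" using V.independent_span_bound[of ?E U, OF _ U(2)] by auto
  have "V.span (vec ` S) \<subseteq> V.span U" using U(3) by (simp add: V.span_minimal)
  then have "?E \<subseteq> V.span U" using e_vec vec_span by fastforce
  then have "card ?E \<le> card U" using V.independent_span_bound[OF finU(1) ind_E] by blast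
  then have cardU: "card U = r" using finU(2) card_image[OF inj_e] by simp
  obtain T where T: "T \<subseteq> S" "inj_on vec T" "U = vec ` T" using U(1) by (auto simp: subset_image_inj)
  have finT: "finite T" "card T = r"
    using T finU cardU by (auto simp: finite_image_iff card_image)
  have "lin_indep TYPE(nat) T"
  proof (rule lin_indepI[OF \<psi> finT(1)])
    show "T \<subseteq> carrier G" using T S by blast
    fix k :: "'a \<Rightarrow> int" assume k: "\<And>j. (\<Sum>t\<in>T. k t * coeff (\<psi> t) [j]) = 0"
    define u where "u v = real_of_int (k (the_inv_into T vec v))" for v
    have uv: "u (vec t) = real_of_int (k t)" if "t \<in> T" for t
      using T(2) that by (simp add: u_def the_inv_into_f_f)
    have "(\<Sum>v\<in>U. (\<lambda>i. u v * v i)) = 0"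
    proof
      fix j
      have "(\<Sum>v\<in>U. u v * v j) = (\<Sum>t\<in>T. real_of_int (k t) * vec t j)"
        unfolding T(3) by (simp add: sum.reindex[OF T(2)] uv)
      also have "\<dots> = (if j < r then real_of_int (\<Sum>t\<in>T. k t * coeff (\<psi> t) [j]) else 0)"
        by (simp add: vec_def)
      finally show "(\<Sum>v\<in>U. (\<lambda>i. u v * v i)) j = 0 j" using k by (simp add: sum_fun_apply)
    qed
    then have "u v = 0" if "v \<in> U" for v by (rule V.independentD[OF U(2) finU(1) order_refl _ that])
    then show "\<forall>t\<in>T. k t = 0" using T(3) uv by fastforce
  qed
  then show ?thesis using T(1) finT by blast
qed

text \<open>In a relation with series as coefficients, the words \<open>j # w\<close> with
  \<open>w\<close> fixed give an integer relation between linear parts, one for each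
  \<open>w\<close>.\<close>

lemma (in group) lin_indep_right_indep:
  fixes \<psi> :: "'a \<Rightarrow> 'x nc_series"
  assumes T: "finite T" "lin_indep TYPE('x) T" and \<psi>: "approx_rep G c \<psi>" "c \<ge> 2"
  shows "right_indep T (\<lambda>t. hpart 1 (\<psi> t - 1))"
proof (rule right_indepI)
  fix J a t assume J: "finite J" "J \<subseteq> T" "(\<Sum>t\<in>J. hpart 1 (\<psi> t - 1) * a t) = 0" "t \<in> J"
  show "a t = 0"
  proof (rule nc_series_eqI)
    fix w
    let ?k = "\<lambda>t. if t \<in> J then coeff (a t) w else 0"
    have "(\<Sum>t\<in>T. ?k t * coeff (\<psi> t) [j]) = 0" for j
    proof -
      have "(\<Sum>t\<in>T. ?k t * coeff (\<psi> t) [j]) = (\<Sum>t\<in>J. coeff (\<psi> t - 1) [j] * coeff (a t) w)"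
        using T J by (intro sum.mono_neutral_cong_right) (auto simp: coeff_1)
      also have "\<dots> = coeff (\<Sum>t\<in>J. hpart 1 (\<psi> t - 1) * a t) (j # w)"
        by (simp only: coeff_sum coeff_linear_mult)
      finally show ?thesis using J(3) by simp
    qed
    then have "?k t = 0" using J by (intro lin_indepD[OF T(2) \<psi>, of ?k]) auto
    then show "coeff (a t) w = coeff 0 w" using J(4) by simp
  qed
qed

text \<open>
  Right dependence forces the linear form to divide \<open>\<xi>\<close> from the left over the rationals.
\<close>

lemma dependent_pair_proportional:
  fixes \<xi> f :: "'x nc_series"
  assumes \<xi>: "coeff \<xi> [] = 0" and f: "hpart 1 f \<noteq> 0"
    and dep: "\<not> right_indep UNIV (\<lambda>b. if b then hpart 1 f else \<xi>)"
  shows "coeff f [i] * coeff \<xi> (j # w) = coeff f [j] * coeff \<xi> (i # w)"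
proof -
  let ?f = "\<lambda>b. if b then hpart 1 f else \<xi>"
  obtain J a b where J: "(\<Sum>b\<in>J. ?f b * a b) = 0" "b \<in> J" "a b \<noteq> 0"
    using dep by (auto simp: right_indep_def)
  define a' where "a' b = (if b \<in> J then a b else 0)" for b
  have "(\<Sum>b\<in>J. ?f b * a b) = (\<Sum>b\<in>UNIV. ?f b * a' b)"
    by (rule sum.mono_neutral_cong_left) (auto simp: a'_def)
  then have sum: "hpart 1 f * a' True + \<xi> * a' False = 0" using J(1) by (simp add: UNIV_bool add.commute)
  have "a' False \<noteq> 0"
  proof
    assume 0: "a' False = 0"
    then have "b = True" using J(2,3) by (cases b) (auto simp: a'_def)
    then have "a' True \<noteq> 0" using J(2,3) by (simp add: a'_def)
    then show False using sum 0 f nc_series_no_zero_divisors[of "hpart 1 f" "a' True"] by simp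
  qed
  define \<zeta> where "\<zeta> = of_int (coeff f [i]) * lquot j \<xi> - of_int (coeff f [j]) * lquot i \<xi>"
  have "\<zeta> * a' False = 0"
  proof (rule nc_series_eqI)
    fix v
    have q: "coeff (lquot l \<xi> * a' False) v = - (coeff f [l] * coeff (a' True) v)" for l
    proof -
      have "coeff (lquot l \<xi> * a' False) v = coeff (\<xi> * a' False) (l # v)"
        using \<xi> by (simp add: coeff_mult_Cons)
      also have "\<xi> * a' False = - (hpart 1 f * a' True)" using sum by (simp add: eq_neg_iff_add_eq_0 add.commute)
      finally show ?thesis by (simp only: coeff_simps coeff_linear_mult)
    qed
    have "\<zeta> * a' False = of_int (coeff f [i]) * (lquot j \<xi> * a' False) - of_int (coeff f [j]) * (lquot i \<xi> * a' False)"
      by (simp add: \<zeta>_def left_diff_distrib mult.assoc)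
    then show "coeff (\<zeta> * a' False) v = coeff 0 v"
      by (simp only: coeff_simps coeff_of_int_mult q) simp
  qed
  then have "\<zeta> = 0" using \<open>a' False \<noteq> 0\<close> by (rule nc_series_no_zero_divisors)
  then have "coeff \<zeta> w = 0" by simp
  then show ?thesis by (simp add: \<zeta>_def)
qed

context group
begin

lemma lin_indep_pair:
  fixes \<psi> :: "'a \<Rightarrow> 'x nc_series" and p q :: int
  assumes T: "finite T" "lin_indep TYPE('x) T" "t \<in> T" "t' \<in> T" "t \<noteq> t'"
    and \<psi>: "approx_rep G c \<psi>" "c \<ge> 2"
    and pq: "\<And>j. p * coeff (\<psi> t) [j] + q * coeff (\<psi> t') [j] = 0"
  shows "p = 0 \<and> q = 0"
proof -
  let ?k = "\<lambda>s. if s = t then p else if s = t' then q else 0"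
  have "(\<Sum>s\<in>T. ?k s * coeff (\<psi> s) [j]) = 0" for j
  proof -
    have "(\<Sum>s\<in>T. ?k s * coeff (\<psi> s) [j]) = (\<Sum>s\<in>{t, t'}. ?k s * coeff (\<psi> s) [j])"
      using T by (intro sum.mono_neutral_right) auto
    then show ?thesis using T(5) pq by simp
  qed
  then have "?k s = 0" if "s \<in> T" for s using that by (intro lin_indepD[OF T(2) \<psi>, of ?k]) auto
  from this[of t] this[of t'] show ?thesis using T(3-5) by auto
qed

text \<open>
  Two independent linear forms cannot both divide \<open>\<xi>\<close> from the left.
\<close>

lemma bad_exponent_unique:
  fixes \<psi> :: "'a \<Rightarrow> 'x nc_series" and k k' :: nat
  assumes T: "finite T" "lin_indep TYPE('x) T" "t \<in> T" "t' \<in> T" "t \<noteq> t'" "T \<subseteq> carrier G"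
    and \<psi>: "approx_rep G c \<psi>" "c \<ge> 2" and \<xi>: "coeff \<xi> [] = 0" "\<xi> \<noteq> 0"
    and dep: "\<not> right_indep UNIV (\<lambda>b. if b then hpart 1 (\<psi> (t \<otimes> t' [^] k) - 1) else \<xi>)"
    and dep': "\<not> right_indep UNIV (\<lambda>b. if b then hpart 1 (\<psi> (t \<otimes> t' [^] k') - 1) else \<xi>)"
  shows "k = k'"
proof (rule ccontr)
  assume neq: "k \<noteq> k'"
  interpret A: approx_group G c \<psi> by unfold_locales (use \<psi> in auto)
  have tc: "t \<in> carrier G" "t' \<in> carrier G" using T by auto
  let ?l = "\<lambda>j. coeff (\<psi> t) [j]" and ?l' = "\<lambda>j. coeff (\<psi> t') [j]"
  have lin: "coeff (\<psi> (t \<otimes> t' [^] n) - 1) [j] = ?l j + int n * ?l' j" for n :: nat and j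
    using tc by (simp add: coeff_1 A.lin_mult A.lin_pow)
  have nz: "hpart 1 (\<psi> (t \<otimes> t' [^] n) - 1) \<noteq> 0" for n :: nat
  proof
    assume 0: "hpart 1 (\<psi> (t \<otimes> t' [^] n) - 1) = 0"
    have "coeff (\<psi> (t \<otimes> t' [^] n) - 1) [j] = 0" for j
      using arg_cong[OF 0, of "\<lambda>f. coeff f [j]"] by (simp add: coeff_hpart)
    then have "1 * ?l j + int n * ?l' j = 0" for j by (simp only: lin mult_1_left)
    then show False using lin_indep_pair[OF T(1-5) \<psi>, of 1 "int n"] by simp
  qed
  obtain u where u: "coeff \<xi> u \<noteq> 0" using \<xi>(2) nc_series_eqI[of \<xi> 0] by fastforce
  then obtain j w where jw: "u = j # w" using \<xi>(1) by (cases u) auto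
  define v where "v i = coeff \<xi> (i # w)" for i
  have vj: "v j \<noteq> 0" using u jw by (simp add: v_def)
  have proportional: "(?l i + int n * ?l' i) * v j = (?l j + int n * ?l' j) * v i"
    if "\<not> right_indep UNIV (\<lambda>b. if b then hpart 1 (\<psi> (t \<otimes> t' [^] n) - 1) else \<xi>)" for n i
    using dependent_pair_proportional[OF \<xi>(1) nz[of n] that, of i j w] unfolding lin v_def .
  \<comment> \<open>Both forms are proportional to the same vector \<open>v\<close>. Their
    difference is a nonzero multiple of the form of \<open>t'\<close>, so the forms of
    \<open>t'\<close> and then of \<open>t\<close> are proportional to \<open>v\<close>, against
    independence.\<close>
  have l': "?l' i * v j = ?l' j * v i" for i
  proof -
    have "(int k - int k') * (?l' i * v j) = (int k - int k') * (?l' j * v i)"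
      using proportional[OF dep, of i] proportional[OF dep', of i] by (simp add: algebra_simps)
    then show ?thesis using neq by simp
  qed
  have l: "?l i * v j = ?l j * v i" for i
  proof -
    have "?l i * v j + int k * (?l' i * v j) = ?l j * v i + int k * (?l' j * v i)"
      using proportional[OF dep, of i] by (simp add: algebra_simps)
    then show ?thesis using l'[of i] by simp
  qed
  have "?l' j * ?l i + (- ?l j) * ?l' i = 0" for i
  proof -
    have "(?l' j * ?l i + (- ?l j) * ?l' i) * v j = ?l' j * (?l i * v j) - ?l j * (?l' i * v j)"
      by (simp add: algebra_simps)
    also have "\<dots> = 0" unfolding l l' by simp
    finally show ?thesis using vj by simp
  qed
  then have "?l' j = 0 \<and> - ?l j = 0" by (rule lin_indep_pair[OF T(1-5) \<psi>])
  then have "?l i * v j = 0" for i using l[of i] by simp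
  then have "1 * ?l i + 0 * ?l' i = 0" for i using vj by simp
  then show False using lin_indep_pair[OF T(1-5) \<psi>, of 1 0] by simp
qed

text \<open>The weight is 1 for every generator and every \<open>c\<close>, so one independent set
  meets the requirements of \<open>word_eval_neq_one\<close> at all precisions.\<close>

lemma lin_indep_free:
  fixes r :: nat
  assumes T: "finite T" "card T = r" "T \<subseteq> carrier G" "lin_indep TYPE('x) T"
    and approx: "\<And>c. c \<ge> 2 \<Longrightarrow> \<exists>\<psi>::'a \<Rightarrow> 'x nc_series. approx_rep G c \<psi>"
  shows "subgroup_generated G T \<cong> free_group {..<r}"
proof -
  obtain t where t: "bij_betw t {..<r} T"
    using ex_bij_betw_nat_finite[OF T(1)] T(2) by (auto simp: atLeast0LessThan)
  have tT: "t i \<in> T" if "i < r" for i using t that by (auto simp: bij_betw_def)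
  have free: "word_eval G t w \<noteq> \<one>" if "w \<in> lists ({..<r} \<times> UNIV)" "reduced_word w" "w \<noteq> []" for w
  proof (rule word_eval_neq_one[OF is_group _ _ _ _ that, where m = "\<lambda>_. 1" and ?'x = 'x])
    show "t i \<in> carrier G" if "i \<in> {..<r}" for i using that tT T(3) by auto
    fix N :: nat
    obtain \<psi> :: "'a \<Rightarrow> 'x nc_series" where \<psi>: "approx_rep G (max N 2) \<psi>" using approx[of "max N 2"] by auto
    have c2: "max N 2 \<ge> 2" by simp
    interpret A: approx_group G "max N 2" \<psi> by unfold_locales (use \<psi> in auto)
    have ri: "right_indep T (\<lambda>s. hpart 1 (\<psi> s - 1))" by (rule lin_indep_right_indep[OF T(1,4) \<psi> c2])
    have "right_indep {..<r} (\<lambda>i. hpart 1 (\<psi> (t i) - 1))"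
    proof (rule right_indepI)
      fix J a i assume J: "finite J" "J \<subseteq> {..<r}" "(\<Sum>i\<in>J. hpart 1 (\<psi> (t i) - 1) * a i) = 0" "i \<in> J"
      have inj: "inj_on t J" using t J(2) by (auto simp: bij_betw_def intro: inj_on_subset)
      have "(\<Sum>s\<in>t ` J. hpart 1 (\<psi> s - 1) * a (the_inv_into J t s)) = 0"
        using J(3) by (simp add: sum.reindex[OF inj] the_inv_into_f_f[OF inj])
      then have "a (the_inv_into J t (t i)) = 0"
        by (rule right_indepD[OF ri]) (use J tT in auto)
      then show "a i = 0" using the_inv_into_f_f[OF inj J(4)] by simp
    qed
    moreover have "\<psi> (t i) - 1 \<in> ord_ge 1" if "i \<in> {..<r}" for i
      using A.\<psi>_const[of "t i"] that tT[of i] T(3) by (auto simp: ord_ge_def coeff_1)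
    ultimately show "\<exists>c\<ge>N. \<exists>\<psi>::'a \<Rightarrow> 'x nc_series. approx_rep G c \<psi> \<and>
        (\<forall>i\<in>{..<r}. \<psi> (t i) - 1 \<in> ord_ge 1) \<and> right_indep {..<r} (\<lambda>i. hpart 1 (\<psi> (t i) - 1))"
      using \<psi> by (intro exI[of _ "max N 2"] conjI exI[of _ \<psi>]) auto
  qed auto
  have tc: "t i \<in> carrier G" if "i \<in> {..<r}" for i using that tT T(3) by auto
  have "\<exists>h\<in>hom (free_group {..<r}) G. inj_on h (carrier (free_group {..<r})) \<and> (\<forall>i\<in>{..<r}. h [(i, True)] = t i)"
    by (rule free_group_embedding[OF is_group]) (rule tc, assumption, rule free)
  then obtain h where h: "h \<in> hom (free_group {..<r}) G" "inj_on h (carrier (free_group {..<r}))"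
    "\<forall>i\<in>{..<r}. h [(i, True)] = t i"
    by (elim bexE conjE) (rule that)
  let ?F = "free_group {..<r}"
  interpret F: group ?F by (rule group_free_group)
  interpret h: group_hom ?F G h by unfold_locales (rule h(1))
  let ?E = "(\<lambda>i. [(i, True)]) ` {..<r}"
  have "h ` ?E = t ` {..<r}"
    unfolding image_image by (rule image_cong[OF refl]) (rule bspec[OF h(3)])
  also have "\<dots> = T" using t by (rule bij_betw_imp_surj_on)
  finally have hE: "h ` ?E = T" .
  have "?E \<subseteq> carrier ?F" by (auto simp: free_group_def)
  then have img: "h ` carrier ?F = generate G T"
    using h.generate_img[of ?E] unfolding hE generate_free_group by simp
  have car: "carrier (subgroup_generated G T) = generate G T"
    using T(3) by (simp add: carrier_subgroup_generated Int_absorb1)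
  have "h \<in> iso ?F (subgroup_generated G T)"
    unfolding iso_def hom_def bij_betw_def car
    using h(2) img by (auto simp: subgroup_generated_def)
  then have "?F \<cong> subgroup_generated G T" by (auto simp: is_iso_def)
  then show ?thesis by (rule F.iso_sym)
qed

text \<open>For each \<open>c\<close> an element \<open>x\<close> spoils at most one exponent
  (\<open>bad_exponent_unique\<close>), so one of \<open>0, ..., card J\<close> is good for all of
  \<open>J\<close>. As this range is the same for every \<open>c\<close>, one exponent recurs for
  unboundedly many \<open>c\<close>, which is what \<open>word_eval_neq_one\<close> asks
  for.\<close>

lemma lin_indep_powers:
  assumes T: "finite T" "lin_indep TYPE('x) T" "t \<in> T" "t' \<in> T" "t \<noteq> t'" "T \<subseteq> carrier G"
    and approx: "\<And>c. c \<ge> 2 \<Longrightarrow> \<exists>\<psi>::'a \<Rightarrow> 'x nc_series. approx_rep G c \<psi>"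
    and rn: "residually_nilpotent G"
    and J: "finite J" "J \<subseteq> carrier G - {\<one>}"
  shows "\<exists>y::nat \<Rightarrow> 'a. (\<forall>j. y j \<in> carrier G) \<and> (\<forall>x\<in>J. \<exists>D\<subseteq>carrier G. (\<forall>z\<in>carrier G - D. x \<otimes> z \<in> D) \<and>
    (\<forall>i j. i \<noteq> j \<longrightarrow> (y i <# D) \<inter> (y j <# D) = {}))"
proof -
  have tc: "t \<in> carrier G" "t' \<in> carrier G" using T by auto
  \<comment> \<open>Residual nilpotence gives each \<open>x\<close> a finite depth, which is its
    leading degree in every representation of sufficient precision.\<close>
  have "\<exists>m\<ge>1. x \<in> lc m \<and> x \<notin> lc (Suc m)" if "x \<in> J" for x
  proof -
    have x: "x \<in> carrier G" "x \<noteq> \<one>" using that J by auto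
    have "x \<notin> (\<Inter>n\<in>{1..}. lc n)" using rn x(2) by (simp add: residually_nilpotent_def)
    then obtain n where n: "n \<ge> 1" "x \<notin> lc n" by auto
    define m where "m = (LEAST n. x \<notin> lc (Suc n))"
    have ex: "x \<notin> lc (Suc (n - 1))" using n by simp
    have m: "x \<notin> lc (Suc m)" unfolding m_def using ex by (rule LeastI)
    have "m \<noteq> 0" using m x(1) by (intro notI) simp
    moreover from this have "x \<in> lc (Suc (m - 1))"
      using not_less_Least[of "m - 1" "\<lambda>n. x \<notin> lc (Suc n)"] unfolding m_def by auto
    ultimately show ?thesis using m by (intro exI[of _ m]) simp
  qed
  then obtain m where m: "\<And>x. x \<in> J \<Longrightarrow> m x \<ge> 1" "\<And>x. x \<in> J \<Longrightarrow> x \<in> lc (m x)" "\<And>x. x \<in> J \<Longrightarrow> x \<notin> lc (Suc (m x))"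
    by metis
  obtain \<psi> :: "nat \<Rightarrow> 'a \<Rightarrow> 'x nc_series" where \<psi>: "\<And>c. c \<ge> 2 \<Longrightarrow> approx_rep G c (\<psi> c)"
    using approx by metis
  \<comment> \<open>From precision \<open>M\<close> on, membership in \<open>lc (Suc (m x))\<close>
    is detected, so the part of degree \<open>m x\<close> is known to be nonzero.\<close>
  define M where "M = Suc (Suc (\<Sum>x\<in>J. m x))"
  have M: "m x < M" "M \<ge> 2" if "x \<in> J" for x
    using member_le_sum[OF that, of m] J(1) by (simp_all add: M_def)
  define \<xi> where "\<xi> c x = hpart (m x) (\<psi> c x - 1)" for c x
  have \<xi>: "coeff (\<xi> c x) [] = 0" "\<xi> c x \<noteq> 0" "\<psi> c x - 1 \<in> ord_ge (m x)" if x: "x \<in> J" and c: "c \<ge> M" for c x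
  proof -
    have xc: "x \<in> carrier G" using x J by blast
    have c2: "c \<ge> 2" "Suc (m x) \<le> c" using M[OF x] c by auto
    note ar = approx_repD(2)[OF \<psi>[OF c2(1)] xc]
    show 1: "\<psi> c x - 1 \<in> ord_ge (m x)" using ar[of "m x"] m(1,2)[OF x] c2 by simp
    have "\<psi> c x - 1 \<notin> ord_ge (Suc (m x))" using ar[of "Suc (m x)"] m(3)[OF x] c2 by simp
    then show "\<xi> c x \<noteq> 0" using ord_ge_SucI[OF 1] by (auto simp: \<xi>_def)
    show "coeff (\<xi> c x) [] = 0" using m(1)[OF x] by (simp add: \<xi>_def coeff_hpart)
  qed
  define y where "y k = t \<otimes> t' [^] k" for k :: nat
  define good where "good c k \<longleftrightarrow> (\<forall>x\<in>J. right_indep UNIV (\<lambda>b. if b then hpart 1 (\<psi> c (y k) - 1) else \<xi> c x))" for c k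
  have ex_good: "\<exists>k\<le>card J. good c k" if c: "c \<ge> M" "c \<ge> 2" for c
  proof (rule ccontr)
    assume "\<not> (\<exists>k\<le>card J. good c k)"
    then have "\<forall>k\<in>{..card J}. \<exists>x. x \<in> J \<and> \<not> right_indep UNIV (\<lambda>b. if b then hpart 1 (\<psi> c (y k) - 1) else \<xi> c x)"
      by (auto simp: good_def)
    from bchoice[OF this] obtain b where b: "\<And>k. k \<le> card J \<Longrightarrow> b k \<in> J"
      "\<And>k. k \<le> card J \<Longrightarrow> \<not> right_indep UNIV (\<lambda>s. if s then hpart 1 (\<psi> c (y k) - 1) else \<xi> c (b k))"
      by auto
    have "inj_on b {..card J}"
    proof (rule inj_onI)
      fix k k' assume k: "k \<in> {..card J}" "k' \<in> {..card J}" "b k = b k'"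
      have dep': "\<not> right_indep UNIV (\<lambda>s. if s then hpart 1 (\<psi> c (y k') - 1) else \<xi> c (b k))"
        unfolding k(3) using b(2)[of k'] k(2) by simp
      have bk: "b k \<in> J" and dep: "\<not> right_indep UNIV (\<lambda>s. if s then hpart 1 (\<psi> c (y k) - 1) else \<xi> c (b k))"
        using b[of k] k(1) by simp_all
      show "k = k'"
        by (rule bad_exponent_unique[OF T \<psi>[OF c(2)] c(2) \<xi>(1)[OF bk c(1)] \<xi>(2)[OF bk c(1)]
              dep[unfolded y_def] dep'[unfolded y_def]])
    qed
    then have "card {..card J} \<le> card J"
      using b(1) by (intro card_inj_on_le[OF _ _ J(1)]) auto
    then show False by simp
  qed
  have "\<exists>k. \<forall>N. \<exists>c\<ge>N. c \<ge> M \<and> c \<ge> 2 \<and> good c k"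
  proof (rule ccontr)
    assume "\<not> ?thesis"
    then have "\<forall>k. \<exists>N. \<forall>c\<ge>N. c \<ge> M \<longrightarrow> c \<ge> 2 \<longrightarrow> \<not> good c k" by blast
    from choice[OF this] obtain N where N: "\<And>k c. c \<ge> N k \<Longrightarrow> c \<ge> M \<Longrightarrow> c \<ge> 2 \<Longrightarrow> \<not> good c k" by blast
    \<comment> \<open>A precision beyond the finitely many thresholds \<open>N k\<close> would leave
      no good exponent at all.\<close>
    define c where "c = M + 2 + (\<Sum>k\<le>card J. N k)"
    obtain k where k: "k \<le> card J" "good c k" using ex_good[of c] by (auto simp: c_def)
    have "N k \<le> c" using member_le_sum[of k "{..card J}" N] k(1) by (simp add: c_def)
    then show False using N[of k c] k(2) by (simp add: c_def)
  qed
  then obtain k where k: "\<And>N. \<exists>c\<ge>N. c \<ge> M \<and> c \<ge> 2 \<and> good c k" by blast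
  have yc: "y k \<in> carrier G" using tc by (simp add: y_def)
  have D: "\<exists>D\<subseteq>carrier G. (\<forall>z\<in>carrier G - D. x \<otimes> z \<in> D) \<and>
    (\<forall>i j :: nat. i \<noteq> j \<longrightarrow> (y k [^] i <# D) \<inter> (y k [^] j <# D) = {})" if x: "x \<in> J" for x
  proof -
    have xc: "x \<in> carrier G" using x J by blast
    let ?g = "\<lambda>b. if b then y k else x" and ?m = "\<lambda>b. if b then 1 else m x"
    have gc: "?g b \<in> carrier G" for b using xc yc by simp
    have free: "word_eval G ?g w \<noteq> \<one>" if "w \<in> lists (UNIV \<times> UNIV)" "reduced_word w" "w \<noteq> []" for w
    proof (rule word_eval_neq_one[OF is_group finite_class.finite_UNIV gc _ _ that, where m = ?m and ?'x = 'x])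
      show "?m b \<ge> 1" for b using m(1)[OF x] by simp
      fix N :: nat
      obtain c where c: "c \<ge> N" "c \<ge> M" "c \<ge> 2" "good c k" using k by blast
      interpret A: approx_group G c "\<psi> c" by unfold_locales (use \<psi> c in auto)
      have "right_indep UNIV (\<lambda>b. if b then hpart 1 (\<psi> c (y k) - 1) else \<xi> c x)"
        using c(4) x by (simp add: good_def)
      then have "right_indep UNIV (\<lambda>b. hpart (?m b) (\<psi> c (?g b) - 1))"
        by (rule right_indep_cong[rotated]) (simp add: \<xi>_def)
      moreover have "\<psi> c (?g b) - 1 \<in> ord_ge (?m b)" for b
        using \<xi>(3)[OF x c(2)] yc by (auto simp: ord_ge_def A.\<psi>_const coeff_1)
      ultimately show "\<exists>c\<ge>N. \<exists>\<psi>::'a \<Rightarrow> 'x nc_series. approx_rep G c \<psi> \<and>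
          (\<forall>b\<in>UNIV. \<psi> (?g b) - 1 \<in> ord_ge (?m b)) \<and> right_indep UNIV (\<lambda>b. hpart (?m b) (\<psi> (?g b) - 1))"
        using \<psi>[OF c(3)] c(1) by blast
    qed
    have "\<exists>h\<in>hom (free_group UNIV) G. inj_on h (carrier (free_group UNIV)) \<and> (\<forall>b\<in>UNIV. h [(b, True)] = ?g b)"
      by (rule free_group_embedding[OF is_group gc]) (rule free)
    then obtain h where h: "h \<in> hom (free_group UNIV) G" "inj_on h (carrier (free_group UNIV))"
      "\<forall>b\<in>UNIV. h [(b, True)] = ?g b"
      by (elim bexE conjE) (rule that)
    show ?thesis using free_pair_powers[OF h(1,2)] h(3) by simp
  qed
  show ?thesis using D yc by (intro exI[of _ "\<lambda>j. y k [^] j"]) simp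
qed

end

theorem theoremD:
  fixes G :: "('a, 'b) monoid_scheme" and r :: nat
  assumes "r \<ge> 2"
    and "group G"
    and "finitely_generated G"
    and "parafree G"
    and "same_nilpotent_genus G (free_group {..<r})"
  shows "simple_complex_algebra (reduced_cstar_algebra G) \<and>
    (\<forall>S. S \<subseteq> carrier G \<and> generate G S = carrier G \<longrightarrow>
      (\<exists>T\<subseteq>S. card T = r \<and> subgroup_generated G T \<cong> free_group {..<r}))"
proof -
  interpret group G by fact
  have ex: "\<exists>\<psi>::'a \<Rightarrow> nat nc_series. approx_rep G c \<psi> \<and>
      (\<forall>x\<in>{..<r}. \<exists>g\<in>carrier G. \<psi> g - (1 + var_series x) \<in> ord_ge c)" if "c \<ge> 2" for c
    using assms(5) that by (intro approx_rep_exists[OF is_group]) (auto simp: same_nilpotent_genus_def)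
  then have approx: "\<exists>\<psi>::'a \<Rightarrow> nat nc_series. approx_rep G c \<psi>" if "c \<ge> 2" for c
    using that by blast
  have indep: "\<exists>T\<subseteq>S. finite T \<and> card T = r \<and> lin_indep TYPE(nat) T"
    if "S \<subseteq> carrier G" "generate G S = carrier G" for S
  proof -
    \<comment> \<open>Precision 2 suffices for selecting \<open>T\<close>; the definition of
      \<open>lin_indep\<close> covers all other precisions by way of
      \<open>lin_indepI\<close>.\<close>
    obtain \<psi> :: "'a \<Rightarrow> nat nc_series" where "approx_rep G 2 \<psi>"
      "\<forall>x\<in>{..<r}. \<exists>g\<in>carrier G. \<psi> g - (1 + var_series x) \<in> ord_ge 2"
      using ex[of 2] by auto
    then show ?thesis using that by (intro exists_lin_indep_subset) auto
  qed
  have "simple_complex_algebra (reduced_cstar_algebra G)"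
  proof (rule powers_simple)
    fix J assume J: "finite J" "J \<subseteq> carrier G - {\<one>\<^bsub>G\<^esub>}"
    have "generate G (carrier G) = carrier G" using generate_incl generate.incl by (metis order_refl subset_antisym subsetI)
    then obtain T where T: "T \<subseteq> carrier G" "finite T" "card T = r" "lin_indep TYPE(nat) T"
      using indep[of "carrier G"] by blast
    then have "\<not> card T \<le> Suc 0" using assms(1) by simp
    then obtain t t' where "t \<in> T" "t' \<in> T" "t \<noteq> t'" using card_le_Suc0_iff_eq[OF T(2)] by blast
    then show "\<exists>y::nat \<Rightarrow> 'a. (\<forall>j. y j \<in> carrier G) \<and> (\<forall>x\<in>J. \<exists>D\<subseteq>carrier G.
        (\<forall>z\<in>carrier G - D. x \<otimes>\<^bsub>G\<^esub> z \<in> D) \<and> (\<forall>i j. i \<noteq> j \<longrightarrow> (y i <#\<^bsub>G\<^esub> D) \<inter> (y j <#\<^bsub>G\<^esub> D) = {}))"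
      using T J assms(4) by (intro lin_indep_powers[OF T(2,4) _ _ _ T(1) approx]) (auto simp: parafree_def)
  qed
  moreover have "\<exists>T\<subseteq>S. card T = r \<and> subgroup_generated G T \<cong> free_group {..<r}"
    if S: "S \<subseteq> carrier G" "generate G S = carrier G" for S
  proof -
    obtain T where T: "T \<subseteq> S" "finite T" "card T = r" "lin_indep TYPE(nat) T"
      using indep[OF S] by blast
    have "subgroup_generated G T \<cong> free_group {..<r}"
      using T S(1) by (intro lin_indep_free[OF T(2,3) _ T(4) approx]) auto
    then show ?thesis using T by blast
  qed
  ultimately show ?thesis by blast
qed

end
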